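(* Let $\rho_1,\rho_2,\kappa_1,\kappa_2>0$. Let $D_1,D_2\in L^\infty(-1,1)$ be such that one of them vanishes identically on $(-1,1)$, while the other one, denoted $D_i$ (with $i\in\{1,2\}$), satisfies: $D_i(x)=0$ for $x\in[-1,0]$ and $D_i(x)=a_i(x)$ for $x\in(0,1]$, where $a_i\in C([0,1])\cap C^1((0,1])$ satisfies $a_i(0)=0$, $a_i(x)>0$ for all $x\in(0,1]$, and $$0\le \alpha_i:=\sup_{0<x\le 1}\frac{x|a_i'(x)|}{a_i(x)}<1 .$$ Let $\mathcal{A}:D(\mathcal{A})\subset\mathcal{H}\to\mathcal{H}$ be the Timoshenko operator with local Kelvin-Voigt damping associated with these data (defined in the context), and let $e^{t\mathcal{A}}$ be the $C_0$-semigroup of contractions on $\mathcal{H}$ that it generates. Then $e^{t\mathcal{A}}$ is polynomially stable of order $\frac12$, i.e., there exists a constant $C>0$ such that $$\|e^{t\mathcal{A}}U_0\|_{\mathcal{H}}\le \frac{C}{\sqrt{t}}\,\|U_0\|_{D(\mathcal{A})}\qquad\text{for all } t>0 \text{ and all } U_0\in D(\mathcal{A}).$$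
   Context: The functions are complex-valued, and a prime denotes the (weak) derivative in $x\in(-1,1)$. The underlying system is the Timoshenko beam equation with local viscoelastic damping of Kelvin-Voigt type on $(-1,1)\times\mathbb{R}^+$: $$\rho_1 w_{tt}-\big[\kappa_1(w'+\phi)+D_1(w'+\phi)_t\big]'=0,$$ $$\rho_2\phi_{tt}-\big(\kappa_2\phi'+D_2\phi_t'\big)'+\kappa_1(w'+\phi)+D_1(w'+\phi)_t=0,$$ with boundary conditions $w(\pm1,t)=\phi(\pm1,t)=0$ and initial conditions $w(\cdot,0)=w_0$, $w_t(\cdot,0)=w_1$, $\phi(\cdot,0)=\phi_0$, $\phi_t(\cdot,0)=\phi_1$. It is written as the evolution equation $U_t=\mathcal{A}U$, $U(0)=U_0$, with $U=(w,\phi,w_t,\phi_t)$. The energy space is $$\mathcal{H}=H_0^1(-1,1)\times H_0^1(-1,1)\times L^2(-1,1)\times L^2(-1,1)$$ with the Hilbert norm $$\|(w,\phi,v,\psi)\|_{\mathcal{H}}^2=\int_{-1}^1\big(\kappa_1|w'+\phi|^2+\kappa_2|\phi'|^2+\rho_1|v|^2+\rho_2|\psi|^2\big)\,dx .$$ For $(w,\phi,v,\psi)\in\mathcal{H}$ with $v,\psi\in H_0^1(-1,1)$ put $$T=\kappa_1(w'+\phi)+D_1(v'+\psi),\qquad R=\kappa_2\phi'+D_2\psi'.$$ The operator $\mathcal{A}$ is defined by $$D(\mathcal{A})=\big\{(w,\phi,v,\psi)\in\mathcal{H}:\ v,\psi\in H_0^1(-1,1),\ T',R'\in L^2(-1,1)\big\},$$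 $$\mathcal{A}(w,\phi,v,\psi)=\Big(v,\ \psi,\ \tfrac1{\rho_1}T',\ \tfrac1{\rho_2}(R'-T)\Big).$$ The space $D(\mathcal{A})$ carries the graph norm $\|U\|_{D(\mathcal{A})}=\|U\|_{\mathcal{H}}+\|\mathcal{A}U\|_{\mathcal{H}}$. Under the stated hypotheses $\mathcal{A}$ generates a $C_0$-semigroup of contractions $e^{t\mathcal{A}}$ on $\mathcal{H}$. *)

theory Defs
  imports "HOL-Analysis.Analysis"
begin

section \<open>The complex space \<open>L\<^sup>2(-1,1)\<close>\<close>

abbreviation I11 :: "real measure" where
  "I11 \<equiv> lebesgue_on {-1<..<1}"

definition sq_integrable :: "(real \<Rightarrow> complex) \<Rightarrow> bool" where
  "sq_integrable f \<longleftrightarrow> f \<in> borel_measurable I11 \<and> integrable I11 (\<lambda>x. (cmod (f x))\<^sup>2)"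

definition l2_rel :: "(real \<Rightarrow> complex) \<Rightarrow> (real \<Rightarrow> complex) \<Rightarrow> bool" where
  "l2_rel f g \<longleftrightarrow> sq_integrable f \<and> sq_integrable g \<and> (AE x in I11. f x = g x)"

lemma sq_integrable_zero: "sq_integrable (\<lambda>x. 0)"
  by (simp add: sq_integrable_def)

lemma sq_integrable_cmult:
  assumes "sq_integrable f" shows "sq_integrable (\<lambda>x. c * f x)"
  using assms by (auto simp: sq_integrable_def norm_mult power_mult_distrib)

lemma sq_integrable_add:
  assumes f: "sq_integrable f" and g: "sq_integrable g"
  shows "sq_integrable (\<lambda>x. f x + g x)"
proof -
  have mf: "f \<in> borel_measurable I11" and mg: "g \<in> borel_measurable I11"
    using f g by (auto simp: sq_integrable_def)
  have m: "(\<lambda>x. f x + g x) \<in> borel_measurable I11"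
    using mf mg by (rule borel_measurable_add)
  have "integrable I11 (\<lambda>x. 2 * (cmod (f x))\<^sup>2 + 2 * (cmod (g x))\<^sup>2)"
    using f g by (auto simp: sq_integrable_def)
  moreover have "(\<lambda>x. (cmod (f x + g x))\<^sup>2) \<in> borel_measurable I11"
    using m by measurable
  moreover have "AE x in I11. norm ((cmod (f x + g x))\<^sup>2) \<le> norm (2 * (cmod (f x))\<^sup>2 + 2 * (cmod (g x))\<^sup>2)"
  proof (rule AE_I2)
    fix x
    have "(cmod (f x + g x))\<^sup>2 \<le> (cmod (f x) + cmod (g x))\<^sup>2"
      by (intro power_mono norm_triangle_ineq) simp
    also have "\<dots> \<le> 2 * (cmod (f x))\<^sup>2 + 2 * (cmod (g x))\<^sup>2"
      using sum_squares_bound[of "cmod (f x)" "cmod (g x)"] by (simp add: power2_sum)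
    finally show "norm ((cmod (f x + g x))\<^sup>2) \<le> norm (2 * (cmod (f x))\<^sup>2 + 2 * (cmod (g x))\<^sup>2)"
      by simp
  qed
  ultimately have "integrable I11 (\<lambda>x. (cmod (f x + g x))\<^sup>2)"
    by (rule Bochner_Integration.integrable_bound)
  with m show ?thesis by (simp add: sq_integrable_def)
qed

lemma sq_integrable_prod:
  assumes f: "sq_integrable f" and g: "sq_integrable g"
  shows "integrable I11 (\<lambda>x. f x * cnj (g x))"
proof (rule Bochner_Integration.integrable_bound)
  have mf: "f \<in> borel_measurable I11" and mg: "g \<in> borel_measurable I11"
    using f g by (auto simp: sq_integrable_def)
  have "(\<lambda>x. cnj (g x)) \<in> borel_measurable I11"
    using measurable_compose[OF mg, of cnj borel]
    by (simp add: borel_measurable_continuous_onI continuous_on_cnj)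
  with mf show "(\<lambda>x. f x * cnj (g x)) \<in> borel_measurable I11"
    by (rule borel_measurable_times)
  show "integrable I11 (\<lambda>x. (cmod (f x))\<^sup>2 + (cmod (g x))\<^sup>2)"
    using f g by (auto simp: sq_integrable_def)
  show "AE x in I11. norm (f x * cnj (g x)) \<le> norm ((cmod (f x))\<^sup>2 + (cmod (g x))\<^sup>2)"
  proof (rule AE_I2)
    fix x
    have "cmod (f x) * cmod (g x) \<le> (cmod (f x))\<^sup>2 + (cmod (g x))\<^sup>2"
      using sum_squares_bound[of "cmod (f x)" "cmod (g x)"]
        mult_nonneg_nonneg[OF norm_ge_zero[of "f x"] norm_ge_zero[of "g x"]] by linarith
    then show "norm (f x * cnj (g x)) \<le> norm ((cmod (f x))\<^sup>2 + (cmod (g x))\<^sup>2)"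
      by (simp add: norm_mult)
  qed
qed

quotient_type l2 = "real \<Rightarrow> complex" / partial: l2_rel
proof (rule part_equivpI)
  show "\<exists>f. l2_rel f f"
    using sq_integrable_zero by (auto simp: l2_rel_def)
  show "symp l2_rel"
    by (auto simp: symp_def l2_rel_def elim: AE_mp)
  show "transp l2_rel"
    by (auto simp: transp_def l2_rel_def elim: AE_mp)
qed

text \<open>Only the real part of the sesquilinear \<open>L\<^sup>2\<close> product is used as the library inner product
  (which is real-valued); complex scalars act through \<open>cscale_l2\<close>.\<close>

instantiation l2 :: real_inner
begin

lift_definition zero_l2 :: l2 is "\<lambda>x. 0"
  by (simp add: l2_rel_def sq_integrable_zero)

lift_definition plus_l2 :: "l2 \<Rightarrow> l2 \<Rightarrow> l2" is "\<lambda>f g x. f x + g x"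
  unfolding l2_rel_def by (auto intro: sq_integrable_add)

lift_definition uminus_l2 :: "l2 \<Rightarrow> l2" is "\<lambda>f x. - f x"
  unfolding l2_rel_def using sq_integrable_cmult[where c = "-1"] by auto

definition minus_l2 :: "l2 \<Rightarrow> l2 \<Rightarrow> l2" where
  "f - g = f + (- g)" for f g :: l2

lift_definition scaleR_l2 :: "real \<Rightarrow> l2 \<Rightarrow> l2" is "\<lambda>r f x. complex_of_real r * f x"
  unfolding l2_rel_def by (auto intro: sq_integrable_cmult)

lift_definition inner_l2 :: "l2 \<Rightarrow> l2 \<Rightarrow> real" is "\<lambda>f g. Re (\<integral>x. f x * cnj (g x) \<partial>I11)"
proof -
  fix f f' g g' assume a: "l2_rel f f'" "l2_rel g g'"
  have "(\<integral>x. f x * cnj (g x) \<partial>I11) = (\<integral>x. f' x * cnj (g' x) \<partial>I11)"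
  proof (rule integral_cong_AE)
    show "(\<lambda>x. f x * cnj (g x)) \<in> borel_measurable I11"
      using a by (intro borel_measurable_integrable sq_integrable_prod) (auto simp: l2_rel_def)
    show "(\<lambda>x. f' x * cnj (g' x)) \<in> borel_measurable I11"
      using a by (intro borel_measurable_integrable sq_integrable_prod) (auto simp: l2_rel_def)
    show "AE x in I11. f x * cnj (g x) = f' x * cnj (g' x)"
      using a unfolding l2_rel_def by auto
  qed
  then show "Re (\<integral>x. f x * cnj (g x) \<partial>I11) = Re (\<integral>x. f' x * cnj (g' x) \<partial>I11)" by simp
qed

lift_definition norm_l2 :: "l2 \<Rightarrow> real" is "\<lambda>f. sqrt (\<integral>x. (cmod (f x))\<^sup>2 \<partial>I11)"
proof -
  fix f g assume a: "l2_rel f g"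
  have "(\<integral>x. (cmod (f x))\<^sup>2 \<partial>I11) = (\<integral>x. (cmod (g x))\<^sup>2 \<partial>I11)"
    by (rule integral_cong_AE) (use a in \<open>auto simp: l2_rel_def sq_integrable_def\<close>)
  then show "sqrt (\<integral>x. (cmod (f x))\<^sup>2 \<partial>I11) = sqrt (\<integral>x. (cmod (g x))\<^sup>2 \<partial>I11)" by simp
qed

definition sgn_l2 :: "l2 \<Rightarrow> l2" where
  "sgn_l2 f = inverse (norm f) *\<^sub>R f"

definition dist_l2 :: "l2 \<Rightarrow> l2 \<Rightarrow> real" where
  "dist_l2 f g = norm (f - g)"

definition uniformity_l2 :: "(l2 \<times> l2) filter" where
  "uniformity_l2 = (INF e\<in>{0<..}. principal {(x, y). dist x y < e})"

definition open_l2 :: "l2 set \<Rightarrow> bool" where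
  "open_l2 U \<longleftrightarrow> (\<forall>x\<in>U. \<forall>\<^sub>F (x', y) in uniformity. x' = x \<longrightarrow> y \<in> U)"

instance
proof
  fix a b c :: l2 and r s :: real
  show "a + b + c = a + (b + c)"
    by transfer (auto simp: l2_rel_def add.assoc intro!: sq_integrable_add)
  show "a + b = b + a"
    by transfer (auto simp: l2_rel_def add.commute intro!: sq_integrable_add)
  show "0 + a = a"
    by transfer (auto simp: l2_rel_def)
  show "- a + a = 0"
    by transfer (auto simp: l2_rel_def sq_integrable_zero)
  show "a - b = a + - b"
    by (rule minus_l2_def)
  show "r *\<^sub>R (a + b) = r *\<^sub>R a + r *\<^sub>R b"
    by transfer (auto simp: l2_rel_def distrib_left intro!: sq_integrable_add sq_integrable_cmult)
  show "(r + s) *\<^sub>R a = r *\<^sub>R a + s *\<^sub>R a"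
    by transfer (auto simp: l2_rel_def distrib_right intro!: sq_integrable_add sq_integrable_cmult)
  show "r *\<^sub>R s *\<^sub>R a = (r * s) *\<^sub>R a"
    by transfer (auto simp: l2_rel_def mult.assoc intro!: sq_integrable_cmult)
  show "1 *\<^sub>R a = a"
    by transfer (auto simp: l2_rel_def)
  show "dist a b = norm (a - b)"
    by (rule dist_l2_def)
  show "sgn a = inverse (norm a) *\<^sub>R a"
    by (rule sgn_l2_def)
  show "uniformity = (INF e\<in>{0<..}. principal {(x, y). dist (x::l2) y < e})"
    by (rule uniformity_l2_def)
  show "open U \<longleftrightarrow> (\<forall>x\<in>U. \<forall>\<^sub>F (x', y) in uniformity. x' = x \<longrightarrow> y \<in> U)" for U :: "l2 set"
    by (rule open_l2_def)
  show "inner a b = inner b a"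
  proof (transfer)
    fix f g assume a: "l2_rel f f" "l2_rel g g"
    have "(\<integral>x. g x * cnj (f x) \<partial>I11) = (\<integral>x. cnj (f x * cnj (g x)) \<partial>I11)"
      by (simp add: mult.commute)
    also have "\<dots> = cnj (\<integral>x. f x * cnj (g x) \<partial>I11)"
      by (rule Bochner_Integration.integral_cnj)
    finally show "Re (\<integral>x. f x * cnj (g x) \<partial>I11) = Re (\<integral>x. g x * cnj (f x) \<partial>I11)"
      by simp
  qed
  show "inner (a + b) c = inner a c + inner b c"
    by transfer (simp add: l2_rel_def distrib_right sq_integrable_prod)
  show "inner (r *\<^sub>R a) b = r * inner a b"
    by transfer (simp add: l2_rel_def mult.assoc)
  have sq: "f x * cnj (f x) = complex_of_real ((cmod (f x))\<^sup>2)" for f :: "real \<Rightarrow> complex" and x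
    by (rule complex_norm_square[symmetric])
  show "0 \<le> inner a a"
    by transfer (simp only: sq integral_complex_of_real Re_complex_of_real, simp)
  show "inner a a = 0 \<longleftrightarrow> a = 0"
  proof transfer
    fix f assume "l2_rel f f"
    then have f: "sq_integrable f" by (simp add: l2_rel_def)
    have "(\<integral>x. (cmod (f x))\<^sup>2 \<partial>I11) = 0 \<longleftrightarrow> (AE x in I11. (cmod (f x))\<^sup>2 = 0)"
      by (rule integral_nonneg_eq_0_iff_AE) (use f in \<open>auto simp: sq_integrable_def\<close>)
    with f show "Re (\<integral>x. f x * cnj (f x) \<partial>I11) = 0 \<longleftrightarrow> l2_rel f (\<lambda>x. 0)"
      by (simp add: sq integral_complex_of_real l2_rel_def sq_integrable_zero del: of_real_power)
  qed
  show "norm a = sqrt (inner a a)"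
    by transfer (simp add: sq integral_complex_of_real del: of_real_power)
qed

end

lift_definition cscale_l2 :: "complex \<Rightarrow> l2 \<Rightarrow> l2" is "\<lambda>c f x. c * f x"
  unfolding l2_rel_def by (auto intro: sq_integrable_cmult)

definition Linfty :: "(real \<Rightarrow> real) \<Rightarrow> bool" where
  "Linfty D \<longleftrightarrow> D \<in> borel_measurable I11 \<and> (\<exists>M. AE x in I11. \<bar>D x\<bar> \<le> M)"

text \<open>For \<open>D\<close> in \<open>L\<^sup>\<infinity>\<close> the product below is again square integrable and its class does not depend on
  the chosen representative; for other \<open>D\<close> the value may be meaningless.\<close>

definition mult_l2 :: "(real \<Rightarrow> real) \<Rightarrow> l2 \<Rightarrow> l2" where
  "mult_l2 D f = abs_l2 (\<lambda>x. complex_of_real (D x) * rep_l2 f x)"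


section \<open>Weak derivatives and \<open>H\<^sub>0\<^sup>1(-1,1)\<close>\<close>

definition test_function :: "(real \<Rightarrow> complex) \<Rightarrow> bool" where
  "test_function \<theta> \<longleftrightarrow>
     (\<exists>d :: nat \<Rightarrow> real \<Rightarrow> complex. d 0 = \<theta> \<and>
        (\<forall>n x. (d n has_vector_derivative d (Suc n) x) (at x))) \<and>
     (\<exists>K. compact K \<and> K \<subseteq> {-1<..<1} \<and> (\<forall>x. x \<notin> K \<longrightarrow> \<theta> x = 0))"

definition has_weak_derivative :: "l2 \<Rightarrow> l2 \<Rightarrow> bool" where
  "has_weak_derivative f g \<longleftrightarrow>
     (\<forall>\<theta>. test_function \<theta> \<longrightarrow>
        (\<integral>x. rep_l2 f x * vector_derivative \<theta> (at x) \<partial>I11) = - (\<integral>x. rep_l2 g x * \<theta> x \<partial>I11))"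

definition H1 :: "l2 set" where
  "H1 = {f. \<exists>g. has_weak_derivative f g}"

definition wderiv :: "l2 \<Rightarrow> l2" where
  "wderiv f = (THE g. has_weak_derivative f g)"

text \<open>The closure of the test functions in the \<open>H\<^sup>1\<close> norm.\<close>

definition H10 :: "l2 set" where
  "H10 = {f \<in> H1. \<exists>\<theta> :: nat \<Rightarrow> real \<Rightarrow> complex. (\<forall>n. test_function (\<theta> n)) \<and>
            (\<lambda>n. abs_l2 (\<theta> n)) \<longlonglongrightarrow> f \<and>
            (\<lambda>n. abs_l2 (\<lambda>x. vector_derivative (\<theta> n) (at x))) \<longlonglongrightarrow> wderiv f}"


section \<open>Contraction semigroups on a complex normed space\<close>

text \<open>The normed space is given by a carrier \<open>X\<close> inside an ambient real vector space, a norm \<open>N\<close> on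
  \<open>X\<close> and the complex scalar multiplication \<open>sc\<close>.  The values \<open>S t U\<close> for \<open>t < 0\<close> or \<open>U \<notin> X\<close> are
  irrelevant.\<close>

definition C0_contraction_semigroup ::
  "('a::real_vector) set \<Rightarrow> ('a \<Rightarrow> real) \<Rightarrow> (complex \<Rightarrow> 'a \<Rightarrow> 'a) \<Rightarrow> (real \<Rightarrow> 'a \<Rightarrow> 'a) \<Rightarrow> bool" where
  "C0_contraction_semigroup X N sc S \<longleftrightarrow>
     (\<forall>t\<ge>0. \<forall>U\<in>X. S t U \<in> X) \<and>
     (\<forall>t\<ge>0. \<forall>U\<in>X. \<forall>V\<in>X. S t (U + V) = S t U + S t V) \<and>
     (\<forall>t\<ge>0. \<forall>c. \<forall>U\<in>X. S t (sc c U) = sc c (S t U)) \<and>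
     (\<forall>U\<in>X. S 0 U = U) \<and>
     (\<forall>s\<ge>0. \<forall>t\<ge>0. \<forall>U\<in>X. S (s + t) U = S s (S t U)) \<and>
     (\<forall>U\<in>X. ((\<lambda>t. N (S t U - U)) \<longlongrightarrow> 0) (at_right 0)) \<and>
     (\<forall>t\<ge>0. \<forall>U\<in>X. N (S t U) \<le> N U)"

definition generator_graph ::
  "('a::real_vector) set \<Rightarrow> ('a \<Rightarrow> real) \<Rightarrow> (real \<Rightarrow> 'a \<Rightarrow> 'a) \<Rightarrow> ('a \<times> 'a) set" where
  "generator_graph X N S =
     {(U, F). U \<in> X \<and> F \<in> X \<and> ((\<lambda>h. N ((1 / h) *\<^sub>R (S h U - U) - F)) \<longlongrightarrow> 0) (at_right 0)}"


section \<open>The Timoshenko operator\<close>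

type_synonym state = "l2 \<times> l2 \<times> l2 \<times> l2"

definition energy_space :: "state set" where
  "energy_space = {(w, \<phi>, v, \<psi>). w \<in> H10 \<and> \<phi> \<in> H10}"

definition cscale_state :: "complex \<Rightarrow> state \<Rightarrow> state" where
  "cscale_state c = (\<lambda>(w, \<phi>, v, \<psi>). (cscale_l2 c w, cscale_l2 c \<phi>, cscale_l2 c v, cscale_l2 c \<psi>))"

definition energy_norm :: "real \<Rightarrow> real \<Rightarrow> real \<Rightarrow> real \<Rightarrow> state \<Rightarrow> real" where
  "energy_norm \<rho>\<^sub>1 \<rho>\<^sub>2 \<kappa>\<^sub>1 \<kappa>\<^sub>2 = (\<lambda>(w, \<phi>, v, \<psi>).
     sqrt (\<kappa>\<^sub>1 * (norm (wderiv w + \<phi>))\<^sup>2 + \<kappa>\<^sub>2 * (norm (wderiv \<phi>))\<^sup>2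
           + \<rho>\<^sub>1 * (norm v)\<^sup>2 + \<rho>\<^sub>2 * (norm \<psi>)\<^sup>2))"

definition stress_T :: "real \<Rightarrow> (real \<Rightarrow> real) \<Rightarrow> state \<Rightarrow> l2" where
  "stress_T \<kappa>\<^sub>1 D\<^sub>1 = (\<lambda>(w, \<phi>, v, \<psi>).
     \<kappa>\<^sub>1 *\<^sub>R (wderiv w + \<phi>) + mult_l2 D\<^sub>1 (wderiv v + \<psi>))"

definition stress_R :: "real \<Rightarrow> (real \<Rightarrow> real) \<Rightarrow> state \<Rightarrow> l2" where
  "stress_R \<kappa>\<^sub>2 D\<^sub>2 = (\<lambda>(w, \<phi>, v, \<psi>).
     \<kappa>\<^sub>2 *\<^sub>R wderiv \<phi> + mult_l2 D\<^sub>2 (wderiv \<psi>))"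

text \<open>Since the weak derivatives are taken in \<open>L\<^sup>2\<close>, the conditions \<open>T', R' \<in> L\<^sup>2\<close> say that the
  \<open>L\<^sup>2\<close> functions \<open>T\<close> and \<open>R\<close> lie in \<open>H\<^sup>1\<close>.\<close>

definition timoshenko_domain ::
  "real \<Rightarrow> real \<Rightarrow> (real \<Rightarrow> real) \<Rightarrow> (real \<Rightarrow> real) \<Rightarrow> state set" where
  "timoshenko_domain \<kappa>\<^sub>1 \<kappa>\<^sub>2 D\<^sub>1 D\<^sub>2 =
     {(w, \<phi>, v, \<psi>). (w, \<phi>, v, \<psi>) \<in> energy_space \<and> v \<in> H10 \<and> \<psi> \<in> H10 \<and>
        stress_T \<kappa>\<^sub>1 D\<^sub>1 (w, \<phi>, v, \<psi>) \<in> H1 \<and> stress_R \<kappa>\<^sub>2 D\<^sub>2 (w, \<phi>, v, \<psi>) \<in> H1}"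

definition timoshenko_op ::
  "real \<Rightarrow> real \<Rightarrow> real \<Rightarrow> real \<Rightarrow> (real \<Rightarrow> real) \<Rightarrow> (real \<Rightarrow> real) \<Rightarrow> state \<Rightarrow> state" where
  "timoshenko_op \<rho>\<^sub>1 \<rho>\<^sub>2 \<kappa>\<^sub>1 \<kappa>\<^sub>2 D\<^sub>1 D\<^sub>2 = (\<lambda>(w, \<phi>, v, \<psi>).
     let T = stress_T \<kappa>\<^sub>1 D\<^sub>1 (w, \<phi>, v, \<psi>); R = stress_R \<kappa>\<^sub>2 D\<^sub>2 (w, \<phi>, v, \<psi>)
     in (v, \<psi>, (1 / \<rho>\<^sub>1) *\<^sub>R wderiv T, (1 / \<rho>\<^sub>2) *\<^sub>R (wderiv R - T)))"

definition timoshenko_graph ::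
  "real \<Rightarrow> real \<Rightarrow> real \<Rightarrow> real \<Rightarrow> (real \<Rightarrow> real) \<Rightarrow> (real \<Rightarrow> real) \<Rightarrow> (state \<times> state) set" where
  "timoshenko_graph \<rho>\<^sub>1 \<rho>\<^sub>2 \<kappa>\<^sub>1 \<kappa>\<^sub>2 D\<^sub>1 D\<^sub>2 =
     {(U, timoshenko_op \<rho>\<^sub>1 \<rho>\<^sub>2 \<kappa>\<^sub>1 \<kappa>\<^sub>2 D\<^sub>1 D\<^sub>2 U) | U. U \<in> timoshenko_domain \<kappa>\<^sub>1 \<kappa>\<^sub>2 D\<^sub>1 D\<^sub>2}"

definition graph_norm ::
  "real \<Rightarrow> real \<Rightarrow> real \<Rightarrow> real \<Rightarrow> (real \<Rightarrow> real) \<Rightarrow> (real \<Rightarrow> real) \<Rightarrow> state \<Rightarrow> real" where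
  "graph_norm \<rho>\<^sub>1 \<rho>\<^sub>2 \<kappa>\<^sub>1 \<kappa>\<^sub>2 D\<^sub>1 D\<^sub>2 U =
     energy_norm \<rho>\<^sub>1 \<rho>\<^sub>2 \<kappa>\<^sub>1 \<kappa>\<^sub>2 U
     + energy_norm \<rho>\<^sub>1 \<rho>\<^sub>2 \<kappa>\<^sub>1 \<kappa>\<^sub>2 (timoshenko_op \<rho>\<^sub>1 \<rho>\<^sub>2 \<kappa>\<^sub>1 \<kappa>\<^sub>2 D\<^sub>1 D\<^sub>2 U)"

text \<open>\<open>S t\<close> plays the role of \<open>exp (t \<A>)\<close>.\<close>

definition timoshenko_semigroup ::
  "real \<Rightarrow> real \<Rightarrow> real \<Rightarrow> real \<Rightarrow> (real \<Rightarrow> real) \<Rightarrow> (real \<Rightarrow> real) \<Rightarrow>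
     (real \<Rightarrow> state \<Rightarrow> state) \<Rightarrow> bool" where
  "timoshenko_semigroup \<rho>\<^sub>1 \<rho>\<^sub>2 \<kappa>\<^sub>1 \<kappa>\<^sub>2 D\<^sub>1 D\<^sub>2 S \<longleftrightarrow>
     C0_contraction_semigroup energy_space (energy_norm \<rho>\<^sub>1 \<rho>\<^sub>2 \<kappa>\<^sub>1 \<kappa>\<^sub>2) cscale_state S \<and>
     generator_graph energy_space (energy_norm \<rho>\<^sub>1 \<rho>\<^sub>2 \<kappa>\<^sub>1 \<kappa>\<^sub>2) S
       = timoshenko_graph \<rho>\<^sub>1 \<rho>\<^sub>2 \<kappa>\<^sub>1 \<kappa>\<^sub>2 D\<^sub>1 D\<^sub>2"

text \<open>The supremum is taken in the extended reals, so that \<open>damping_index a a' < 1\<close> includes its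
  finiteness; \<open>a'\<close> is the derivative of \<open>a\<close>.\<close>

definition damping_index :: "(real \<Rightarrow> real) \<Rightarrow> (real \<Rightarrow> real) \<Rightarrow> ereal" where
  "damping_index a a' = (SUP x\<in>{0<..1}. ereal (x * \<bar>a' x\<bar> / a x))"

end

theory Submission
  imports Defs
begin

text \<open>The decay follows from \<open>\<integral>\<^sub>0\<^sup>\<tau> E dt \<le> C (E(U\<^sub>0) + E(\<A>U\<^sub>0))\<close>, because the energy \<open>E\<close> does not increase along orbits.
  Both the dissipation and the dissipation of the time-differentiated orbit are integrable in time with
  such a bound, and the integrated estimate is obtained from them by multipliers, without resolvent
  estimates. On a strip in the interior of the damped region the dissipation controls the stresses and
  the velocities one after the other; low frequencies are handled by multipliers solving the static
  problem. A multiplier \<open>q\<close> times the stresses, with \<open>q'\<close> dominating a large multiple of \<open>\<bar>q\<bar>\<close> off the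
  strip, then propagates the bound to the whole beam.\<close>

section \<open>Smooth functions\<close>

text \<open>Along an orbit in the domain, A (S t U) = S t (A U) is only an element of the energy
  space, so its own dissipation has no direct meaning. The difference quotients
  \<open>dq h U\<close> do lie in the domain, dissipate at most E (A U) up to a vanishing error, and
  approximate the derivative uniformly along the orbit. Estimates for the differentiated orbit are
  therefore stated for pairs U, V with V near A U, applied to V = \<open>dq h U\<close>, and h tends
  to 0. The differentiated orbit is needed because the multiplier q times strain leaves products of
  a damping force with an acceleration; the time derivative is moved from the velocity onto the
  force, which the differentiated dissipation controls. This loss of one derivative is why the bound
  involves E U + E (A U); t E (S t U) <= C (E U + E (A U)) gives the rate t^(-1/2) after a square
  root. The bookkeeping is the predicate \<open>absorbable\<close>: a time integral is at most e
  times that of E plus a constant times the data, for every e > 0. It is stable under sums and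
  Cauchy-Schwarz, and e = 1/2 for E itself closes the argument.\<close>

fun ndiff :: "nat \<Rightarrow> (real \<Rightarrow> 'a::real_normed_vector) \<Rightarrow> bool" where
  "ndiff 0 f \<longleftrightarrow> True"
| "ndiff (Suc n) f \<longleftrightarrow> (\<exists>f'. (\<forall>x. (f has_vector_derivative f' x) (at x)) \<and> ndiff n f')"

text \<open>Recursion on the order turns closure under sums, products and affine substitution into
  short inductions. \<open>test_function_iff\<close> matches it with the sequence of derivatives in
  \<open>test_function\<close>.\<close>

definition smooth :: "(real \<Rightarrow> 'a::real_normed_vector) \<Rightarrow> bool" where
  "smooth f \<longleftrightarrow> (\<forall>n. ndiff n f)"

definition vder :: "(real \<Rightarrow> 'a::real_normed_vector) \<Rightarrow> real \<Rightarrow> 'a" where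
  "vder f = (\<lambda>x. vector_derivative f (at x))"

lemma ndiff_Suc_imp: "ndiff (Suc n) f \<Longrightarrow> ndiff n f"
  by (induction n arbitrary: f) auto

lemma vder_eq: "(\<And>x. (f has_vector_derivative f' x) (at x)) \<Longrightarrow> vder f = f'"
  unfolding vder_def by (auto intro: vector_derivative_at)

lemma smooth_deriv:
  assumes "smooth f"
  shows "(f has_vector_derivative vder f x) (at x)"
proof -
  have "ndiff (Suc 0) f" using assms unfolding smooth_def by blast
  then obtain f' where "\<forall>x. (f has_vector_derivative f' x) (at x)" by auto
  with vder_eq[of f f'] show ?thesis by simp
qed

lemma smooth_vder: "smooth f \<Longrightarrow> smooth (vder f)"
  unfolding smooth_def
proof
  fix n assume "\<forall>n. ndiff n f"
  then have "ndiff (Suc n) f" by blast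
  then obtain f' where f': "\<forall>x. (f has_vector_derivative f' x) (at x)" "ndiff n f'" by auto
  with vder_eq[of f f'] show "ndiff n (vder f)" by simp
qed

lemma smoothI:
  assumes "\<And>x. (f has_vector_derivative f' x) (at x)" "smooth f'"
  shows "smooth f"
  unfolding smooth_def
proof
  fix n show "ndiff n f"
    using assms by (cases n) (auto simp: smooth_def)
qed

lemma ndiff_const: "ndiff n (\<lambda>x. c)"
proof (induction n arbitrary: c)
  case (Suc n)
  have "\<forall>x. ((\<lambda>x. c) has_vector_derivative 0) (at x)" by (auto intro: derivative_eq_intros)
  with Suc[of 0] show ?case by (auto intro!: exI[of _ "\<lambda>x. 0"])
qed simp

lemma ndiff_add: "ndiff n f \<Longrightarrow> ndiff n g \<Longrightarrow> ndiff n (\<lambda>x. f x + g x)"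
proof (induction n arbitrary: f g)
  case (Suc n)
  then obtain f' g' where
    "\<forall>x. (f has_vector_derivative f' x) (at x)" "ndiff n f'"
    "\<forall>x. (g has_vector_derivative g' x) (at x)" "ndiff n g'" by auto
  with Suc.IH show ?case
    by (auto intro!: exI[of _ "\<lambda>x. f' x + g' x"] has_vector_derivative_add)
qed simp

lemma ndiff_mult:
  fixes f g :: "real \<Rightarrow> 'a::real_normed_algebra"
  shows "ndiff n f \<Longrightarrow> ndiff n g \<Longrightarrow> ndiff n (\<lambda>x. f x * g x)"
proof (induction n arbitrary: f g)
  case (Suc n)
  have fg: "ndiff n f" "ndiff n g" using Suc.prems ndiff_Suc_imp by blast+
  from Suc.prems obtain f' g' where
    d: "\<forall>x. (f has_vector_derivative f' x) (at x)" "ndiff n f'"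
    "\<forall>x. (g has_vector_derivative g' x) (at x)" "ndiff n g'" by auto
  have "ndiff n (\<lambda>x. f x * g' x + f' x * g x)"
    by (intro ndiff_add Suc.IH fg d)
  moreover have "\<forall>x. ((\<lambda>x. f x * g x) has_vector_derivative (f x * g' x + f' x * g x)) (at x)"
    using d by (auto intro: has_vector_derivative_mult)
  ultimately show ?case by (auto intro!: exI[of _ "\<lambda>x. f x * g' x + f' x * g x"])
qed simp

lemma ndiff_bounded_linear:
  assumes "bounded_linear L"
  shows "ndiff n f \<Longrightarrow> ndiff n (\<lambda>x. L (f x))"
proof (induction n arbitrary: f)
  case (Suc n)
  then obtain f' where
    "\<forall>x. (f has_vector_derivative f' x) (at x)" "ndiff n f'" by auto
  with Suc.IH show ?case
    by (auto intro!: exI[of _ "\<lambda>x. L (f' x)"] bounded_linear.has_vector_derivative[OF assms])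
qed simp

lemma ndiff_affine: "ndiff n f \<Longrightarrow> ndiff n (\<lambda>x. f (c * x + d))"
proof (induction n arbitrary: f)
  case (Suc n)
  then obtain f' where f':
    "\<forall>x. (f has_vector_derivative f' x) (at x)" "ndiff n f'" by auto
  have "((\<lambda>x. f (c * x + d)) has_vector_derivative c *\<^sub>R f' (c * x + d)) (at x)" for x
  proof -
    have "((\<lambda>x. c * x + d) has_real_derivative c) (at x)"
      by (auto intro!: derivative_eq_intros)
    then have "((\<lambda>x. c * x + d) has_vector_derivative c) (at x)"
      by (simp add: has_real_derivative_iff_has_vector_derivative)
    from vector_diff_chain_at[OF this, of f "f' (c * x + d)"] f'(1) show ?thesis
      by (simp add: o_def)
  qed
  moreover have "ndiff n (\<lambda>x. c *\<^sub>R f' (c * x + d))"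
    by (rule ndiff_bounded_linear[OF bounded_linear_scaleR_right Suc.IH[OF f'(2)]])
  ultimately show ?case by (auto intro!: exI[of _ "\<lambda>x. c *\<^sub>R f' (c * x + d)"])
qed simp

lemma smooth_const [intro]: "smooth (\<lambda>x. c)" by (simp add: smooth_def ndiff_const)
lemma smooth_add [intro]: "smooth f \<Longrightarrow> smooth g \<Longrightarrow> smooth (\<lambda>x. f x + g x)"
  by (simp add: smooth_def ndiff_add)
lemma smooth_mult [intro]:
  fixes f g :: "real \<Rightarrow> 'a::real_normed_algebra"
  shows "smooth f \<Longrightarrow> smooth g \<Longrightarrow> smooth (\<lambda>x. f x * g x)"
  by (simp add: smooth_def ndiff_mult)
lemma smooth_bounded_linear: "bounded_linear L \<Longrightarrow> smooth f \<Longrightarrow> smooth (\<lambda>x. L (f x))"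
  by (simp add: smooth_def ndiff_bounded_linear)
lemma smooth_affine: "smooth f \<Longrightarrow> smooth (\<lambda>x. f (c * x + d))"
  by (simp add: smooth_def ndiff_affine)
lemma smooth_id [intro]: "smooth (\<lambda>x. x)"
  by (rule smoothI[of _ "\<lambda>x. 1"]) auto
lemma smooth_diff [intro]: "smooth f \<Longrightarrow> smooth g \<Longrightarrow> smooth (\<lambda>x. f x - g x)"
  using smooth_add[OF _ smooth_bounded_linear[OF bounded_linear_minus[OF bounded_linear_ident]], of f g]
  by simp

lemma smooth_of_real: "smooth f \<Longrightarrow> smooth (\<lambda>x. complex_of_real (f x))"
  by (rule smooth_bounded_linear[OF bounded_linear_of_real])

lemma smooth_cnj: "smooth f \<Longrightarrow> smooth (\<lambda>x. cnj (f x))"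
  by (rule smooth_bounded_linear[OF bounded_linear_cnj])

lemma smooth_continuous: "smooth f \<Longrightarrow> continuous_on A f"
  by (rule continuous_at_imp_continuous_on) (auto intro: has_vector_derivative_continuous[OF smooth_deriv])

text \<open>The derivative exp(h) h' contains the function itself, so the induction hypothesis at
  order n together with the product rule gives order n + 1.\<close>

lemma smooth_exp_comp:
  fixes h :: "real \<Rightarrow> real"
  assumes "smooth h"
  shows "smooth (\<lambda>x. exp (h x))"
  unfolding smooth_def
proof
  fix n show "ndiff n (\<lambda>x. exp (h x))"
  proof (induction n)
    case (Suc n)
    have "ndiff n (vder h)" using smooth_vder[OF assms] by (simp add: smooth_def)
    then have "ndiff n (\<lambda>x. exp (h x) * vder h x)" using Suc ndiff_mult by blast
    moreover have "((\<lambda>x. exp (h x)) has_vector_derivative exp (h x) * vder h x) (at x)" for x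
      using smooth_deriv[OF assms, of x]
      by (auto simp flip: has_real_derivative_iff_has_vector_derivative intro!: derivative_eq_intros)
    ultimately show ?case by (auto intro!: exI[of _ "\<lambda>x. exp (h x) * vder h x"])
  qed simp
qed

section \<open>Smooth functions that are flat at the origin\<close>

definition flat_poly :: "real poly \<Rightarrow> real \<Rightarrow> real" where
  "flat_poly p x = (if x > 0 then poly p (1 / x) * exp (- 1 / x) else 0)"

lemma poly_mult_exp_tendsto_0: "((\<lambda>u. poly p u * exp (- u)) \<longlongrightarrow> (0::real)) at_top"
proof -
  have "((\<lambda>u. \<Sum>i\<le>degree p. coeff p i * (u ^ i / exp u)) \<longlongrightarrow> (\<Sum>i\<le>degree p. coeff p i * 0)) at_top"
    by (intro tendsto_intros tendsto_power_div_exp_0)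
  then show ?thesis
    by (simp add: poly_altdef sum_distrib_right exp_minus divide_inverse mult.assoc)
qed

text \<open>With u = 1/x, the derivative in x is -u^2 times the derivative in u, so p(u) exp(-u)
  becomes u^2 (p - p')(u) exp(-u). The family is closed under differentiation, and one induction
  over all p gives smoothness.\<close>

lemma flat_poly_deriv:
  "(flat_poly p has_real_derivative flat_poly ([:0, 0, 1:] * (p - pderiv p)) x) (at x)"
proof -
  consider "x > 0" | "x < 0" | "x = 0" by linarith
  then show ?thesis
  proof cases
    case 1
    have "((\<lambda>x. poly p (1 / x)) has_real_derivative poly (pderiv p) (1 / x) * (- 1 / x\<^sup>2)) (at x)"
      by (rule DERIV_chain2[OF poly_DERIV]) (use 1 in \<open>auto intro!: derivative_eq_intros simp: power2_eq_square\<close>)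
    moreover have "((\<lambda>x. exp (- 1 / x)) has_real_derivative exp (- 1 / x) * (1 / x\<^sup>2)) (at x)"
      using 1 by (auto intro!: derivative_eq_intros simp: power2_eq_square)
    ultimately have "((\<lambda>x. poly p (1 / x) * exp (- 1 / x)) has_real_derivative
        flat_poly ([:0, 0, 1:] * (p - pderiv p)) x) (at x)"
      by (rule DERIV_cong[OF DERIV_mult]) (use 1 in \<open>simp add: flat_poly_def field_simps power2_eq_square\<close>)
    moreover have "\<forall>\<^sub>F y in nhds x. poly p (1 / y) * exp (- 1 / y) = flat_poly p y"
      using 1 eventually_nhds_in_open[of "{0<..}" x]
      by (auto simp: flat_poly_def elim!: eventually_mono)
    ultimately show ?thesis by (rule DERIV_cong_ev[OF refl _ refl, THEN iffD1, rotated])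
  next
    case 2
    have "((\<lambda>x. 0) has_real_derivative flat_poly ([:0, 0, 1:] * (p - pderiv p)) x) (at x)"
      using 2 by (auto simp: flat_poly_def)
    moreover have "\<forall>\<^sub>F y in nhds x. 0 = flat_poly p y"
      using 2 eventually_nhds_in_open[of "{..<0}" x]
      by (auto simp: flat_poly_def elim!: eventually_mono)
    ultimately show ?thesis by (rule DERIV_cong_ev[OF refl _ refl, THEN iffD1, rotated])
  next
    case 3
    have "((\<lambda>y. flat_poly p y / y) \<longlongrightarrow> 0) (at_left 0)"
      by (rule tendsto_eventually) (auto simp: eventually_at_filter flat_poly_def)
    moreover have "((\<lambda>y. flat_poly p y / y) \<longlongrightarrow> 0) (at_right 0)"
    proof -
      \<comment> \<open>For u = 1/y the difference quotient at 0 is u p(u) exp(-u), and u tends to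
        infinity.\<close>
      have "((\<lambda>y. poly ([:0, 1:] * p) (inverse y) * exp (- inverse y)) \<longlongrightarrow> 0) (at_right 0)"
        by (rule filterlim_compose[OF poly_mult_exp_tendsto_0 filterlim_inverse_at_top_right])
      then show ?thesis
        by (rule Lim_transform_eventually)
           (auto simp: eventually_at_filter flat_poly_def field_simps)
    qed
    ultimately have "((\<lambda>y. flat_poly p y / y) \<longlongrightarrow> 0) (at 0)"
      by (simp add: filterlim_split_at)
    then show ?thesis using 3 by (simp add: has_field_derivative_iff flat_poly_def)
  qed
qed

lemma smooth_flat_poly: "smooth (flat_poly p)"
  unfolding smooth_def
proof
  fix n show "ndiff n (flat_poly p)"
  proof (induction n arbitrary: p)
    case (Suc n)
    then show ?case
      using flat_poly_deriv[of p]
      by (auto simp: has_real_derivative_iff_has_vector_derivative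
          intro!: exI[of _ "flat_poly ([:0, 0, 1:] * (p - pderiv p))"])
  qed simp
qed

definition bump :: "real \<Rightarrow> real" where
  "bump x = (if x > 0 then exp (- 1 / x) else 0)"

lemma bump_flat: "bump = flat_poly 1"
  by (auto simp: bump_def flat_poly_def fun_eq_iff)

lemma smooth_bump: "smooth bump" by (simp add: bump_flat smooth_flat_poly)

lemma bump_nonneg: "0 \<le> bump x" and bump_le_1: "bump x \<le> 1"
  by (auto simp: bump_def)

lemma vder_bump: "vder bump x = (if x > 0 then exp (- 1 / x) / x\<^sup>2 else 0)"
proof -
  have "vder bump = flat_poly ([:0, 0, 1:] * (1 - pderiv 1))"
    unfolding bump_flat
    by (rule vder_eq) (use flat_poly_deriv[of 1] in \<open>simp only: has_real_derivative_iff_has_vector_derivative\<close>)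
  then show ?thesis by (auto simp: flat_poly_def power2_eq_square)
qed

lemma test_function_iff:
  "test_function \<theta> \<longleftrightarrow> smooth \<theta> \<and> (\<exists>K. compact K \<and> K \<subseteq> {-1<..<1} \<and> (\<forall>x. x \<notin> K \<longrightarrow> \<theta> x = 0))"
proof -
  have "smooth \<theta> \<longleftrightarrow> (\<exists>d :: nat \<Rightarrow> real \<Rightarrow> complex. d 0 = \<theta> \<and>
        (\<forall>n x. (d n has_vector_derivative d (Suc n) x) (at x)))" (is "_ \<longleftrightarrow> ?R")
  proof
    assume s: "smooth \<theta>"
    have "smooth ((vder ^^ n) \<theta>)" for n by (induction n) (use s smooth_vder in auto)
    then show ?R
      by (intro exI[of _ "\<lambda>n. (vder ^^ n) \<theta>"]) (auto intro: smooth_deriv)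
  next
    assume ?R
    then obtain d where d: "d 0 = \<theta>" "\<And>n x. (d n has_vector_derivative d (Suc n) x) (at x)" by blast
    have "ndiff n (d k)" for n k
      by (induction n arbitrary: k) (use d in auto)
    then show "smooth \<theta>" unfolding smooth_def using d(1) by auto
  qed
  then show ?thesis by (simp add: test_function_def)
qed

section \<open>The space \<open>l2\<close>\<close>

lemma l2_rel_refl: "sq_integrable f \<Longrightarrow> l2_rel f f"
  by (simp add: l2_rel_def)

lemma sq_integrable_rep: "sq_integrable (rep_l2 f)"
  using Quotient3_rep_reflp[OF Quotient3_l2, of f] by (simp add: l2_rel_def)

lemma abs_rep_l2: "abs_l2 (rep_l2 f) = f"
  by (rule Quotient3_abs_rep[OF Quotient3_l2])

lemma rep_abs_l2: "sq_integrable f \<Longrightarrow> AE x in I11. rep_l2 (abs_l2 f) x = f x"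
  using Quotient3_rep_abs[OF Quotient3_l2, of f] by (simp add: l2_rel_def)

lemma abs_l2_eqI: "sq_integrable f \<Longrightarrow> sq_integrable g \<Longrightarrow> AE x in I11. f x = g x \<Longrightarrow> abs_l2 f = abs_l2 g"
  using Quotient3_rel[OF Quotient3_l2, of f g] by (simp add: l2_rel_def)

lemma l2_eqI: "AE x in I11. rep_l2 f x = rep_l2 g x \<Longrightarrow> f = g"
  using abs_l2_eqI[OF sq_integrable_rep sq_integrable_rep, of f g] by (simp add: abs_rep_l2)

lemma abs_l2_add: "sq_integrable f \<Longrightarrow> sq_integrable g \<Longrightarrow> abs_l2 (\<lambda>x. f x + g x) = abs_l2 f + abs_l2 g"
  by (simp add: plus_l2.abs_eq l2_rel_refl)

lemma abs_l2_scaleR: "sq_integrable f \<Longrightarrow> abs_l2 (\<lambda>x. of_real r * f x) = r *\<^sub>R abs_l2 f"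
  by (simp add: scaleR_l2.abs_eq l2_rel_refl)

lemma sq_integrable_diff: "sq_integrable f \<Longrightarrow> sq_integrable g \<Longrightarrow> sq_integrable (\<lambda>x. f x - g x)"
  using sq_integrable_add[OF _ sq_integrable_cmult[of _ "-1"], of f g] by simp

lemma abs_l2_diff:
  assumes "sq_integrable f" "sq_integrable g"
  shows "abs_l2 (\<lambda>x. f x - g x) = abs_l2 f - abs_l2 g"
proof -
  have "abs_l2 (\<lambda>x. f x - g x) + abs_l2 g = abs_l2 f"
    using abs_l2_add[OF sq_integrable_diff[OF assms] assms(2)] by simp
  then show ?thesis by (simp add: eq_diff_eq)
qed

lemma rep_l2_add: "AE x in I11. rep_l2 (f + g) x = rep_l2 f x + rep_l2 g x"
  using rep_abs_l2[OF sq_integrable_add[OF sq_integrable_rep sq_integrable_rep], of f g]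
  by (simp add: abs_l2_add sq_integrable_rep abs_rep_l2)

lemma rep_l2_scaleR: "AE x in I11. rep_l2 (r *\<^sub>R f) x = of_real r * rep_l2 f x"
  using rep_abs_l2[OF sq_integrable_cmult[OF sq_integrable_rep], of "of_real r" f]
  by (simp add: abs_l2_scaleR sq_integrable_rep abs_rep_l2)

lemma inner_abs_l2:
  assumes "sq_integrable f" "sq_integrable g"
  shows "inner (abs_l2 f) (abs_l2 g) = (\<integral>x. Re (f x * cnj (g x)) \<partial>I11)"
  unfolding inner_l2.abs_eq[OF l2_rel_refl[OF assms(1)] l2_rel_refl[OF assms(2)]]
  by (rule integral_Re[OF sq_integrable_prod[OF assms], symmetric])

lemma inner_l2_eq: "inner f g = (\<integral>x. Re (rep_l2 f x * cnj (rep_l2 g x)) \<partial>I11)"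
  using inner_abs_l2[OF sq_integrable_rep sq_integrable_rep, of f g] by (simp add: abs_rep_l2)

lemma norm_abs_l2: "sq_integrable f \<Longrightarrow> norm (abs_l2 f) = sqrt (\<integral>x. (cmod (f x))\<^sup>2 \<partial>I11)"
  by (simp add: norm_l2.abs_eq l2_rel_refl)

lemma finite_measure_I11: "finite_measure I11"
  by (rule finite_measureI) (simp add: emeasure_restrict_space)

interpretation I11: finite_measure I11 by (rule finite_measure_I11)

lemma continuous_measurable_I11: "continuous_on UNIV f \<Longrightarrow> f \<in> borel_measurable I11"
  for f :: "real \<Rightarrow> 'a::topological_space"
  by (intro measurable_restrict_space1 measurable_completion) (simp add: borel_measurable_continuous_onI)

text \<open>Dominated convergence in \<open>l2\<close>: the limit inherits the majorant w, hence |u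
  n - v|^2 <= 4 w^2. The dominating function is asked to be square integrable, not merely
  integrable.\<close>

lemma l2_dominated:
  fixes u :: "nat \<Rightarrow> real \<Rightarrow> complex" and w :: "real \<Rightarrow> real"
  assumes meas: "\<And>n. u n \<in> borel_measurable I11" "v \<in> borel_measurable I11"
    and w: "integrable I11 (\<lambda>x. (w x)\<^sup>2)"
    and lim: "AE x in I11. (\<lambda>n. u n x) \<longlonglongrightarrow> v x"
    and bnd: "\<And>n. AE x in I11. cmod (u n x) \<le> w x"
  shows "sq_integrable (u n)" "sq_integrable v" "(\<lambda>n. abs_l2 (u n)) \<longlonglongrightarrow> abs_l2 v"
proof -
  have bnd': "AE x in I11. cmod (v x) \<le> w x"
  proof -
    have "AE x in I11. \<forall>n. cmod (u n x) \<le> w x" using bnd by (simp add: AE_all_countable)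
    with lim show ?thesis
    proof eventually_elim
      case (elim x)
      then show ?case by (intro LIMSEQ_le_const2[OF tendsto_norm[OF elim(1)]]) auto
    qed
  qed
  have sq: "sq_integrable f" if "f \<in> borel_measurable I11" "AE x in I11. cmod (f x) \<le> w x" for f
    unfolding sq_integrable_def
  proof (intro conjI that Bochner_Integration.integrable_bound[OF w])
    show "(\<lambda>x. (cmod (f x))\<^sup>2) \<in> borel_measurable I11" using that(1) by measurable
    show "AE x in I11. norm ((cmod (f x))\<^sup>2) \<le> norm ((w x)\<^sup>2)"
      using that(2) by eventually_elim (simp add: power_mono)
  qed
  show su: "sq_integrable (u n)" for n by (intro sq meas bnd)
  show sv: "sq_integrable v" by (intro sq meas bnd')
  have "(\<lambda>n. \<integral>x. (cmod (u n x - v x))\<^sup>2 \<partial>I11) \<longlonglongrightarrow> (\<integral>x. 0 \<partial>I11)"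
  proof (rule integral_dominated_convergence[where w = "\<lambda>x. 4 * (w x)\<^sup>2"])
    show "(\<lambda>x. (cmod (u n x - v x))\<^sup>2) \<in> borel_measurable I11" for n using meas by measurable
    show "integrable I11 (\<lambda>x. 4 * (w x)\<^sup>2)" using w by simp
    show "AE x in I11. (\<lambda>n. (cmod (u n x - v x))\<^sup>2) \<longlonglongrightarrow> 0"
      using lim
    proof eventually_elim
      case (elim x)
      then have "(\<lambda>n. (cmod (u n x - v x))\<^sup>2) \<longlonglongrightarrow> (cmod (v x - v x))\<^sup>2"
        by (intro tendsto_intros)
      then show ?case by simp
    qed
    show "AE x in I11. norm ((cmod (u n x - v x))\<^sup>2) \<le> 4 * (w x)\<^sup>2" for n
      using bnd[of n] bnd'
    proof eventually_elim
      case (elim x)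
      then have "cmod (u n x - v x) \<le> 2 * w x" using norm_triangle_ineq4[of "u n x" "v x"] by linarith
      then have "(cmod (u n x - v x))\<^sup>2 \<le> (2 * w x)\<^sup>2" by (intro power_mono) auto
      then show ?case by (simp add: power_mult_distrib)
    qed
  qed auto
  then have "(\<lambda>n. sqrt (\<integral>x. (cmod (u n x - v x))\<^sup>2 \<partial>I11)) \<longlonglongrightarrow> sqrt 0"
    by (intro tendsto_real_sqrt) simp
  then have "(\<lambda>n. norm (abs_l2 (u n) - abs_l2 v)) \<longlonglongrightarrow> 0"
    using su sv by (simp add: abs_l2_diff[symmetric] norm_abs_l2 sq_integrable_diff)
  then show "(\<lambda>n. abs_l2 (u n)) \<longlonglongrightarrow> abs_l2 v"
    by (simp add: LIM_zero_iff tendsto_norm_zero_iff)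
qed

lemma sq_integrable_bounded:
  assumes "f \<in> borel_measurable I11" "AE x in I11. cmod (f x) \<le> K"
  shows "sq_integrable f"
  \<comment> \<open>The constant sequence: only the square integrability of the limit is taken from
    the lemma.\<close>
  by (rule l2_dominated(2)[where u = "\<lambda>n. f" and w = "\<lambda>x. K"]) (use assms in auto)

lemma continuous_bounded_I11:
  assumes "continuous_on UNIV (f :: real \<Rightarrow> 'a::real_normed_vector)"
  obtains K where "\<And>x. x \<in> {-1..1} \<Longrightarrow> norm (f x) \<le> K"
proof -
  have "compact (f ` {-1..1})"
    by (intro compact_continuous_image continuous_on_subset[OF assms]) auto
  then show ?thesis using compact_imp_bounded bounded_iff that by (metis image_eqI)
qed

lemma sq_integrable_continuous:
  assumes "continuous_on UNIV f" shows "sq_integrable f"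
proof -
  obtain K where "\<And>x. x \<in> {-1..1} \<Longrightarrow> norm (f x) \<le> K"
    using continuous_bounded_I11[OF assms] by blast
  then show ?thesis
    by (intro sq_integrable_bounded[where K = K] continuous_measurable_I11 assms AE_I2) auto
qed

subsection \<open>Test functions\<close>

lemma test_function_smooth: "test_function \<theta> \<Longrightarrow> smooth \<theta>"
  by (simp add: test_function_iff)

lemma test_function_mult:
  assumes "smooth m" "test_function \<theta>" shows "test_function (\<lambda>x. m x * \<theta> x)"
  using assms by (auto simp: test_function_iff intro: smooth_mult) 

lemma test_function_add:
  assumes "test_function f" "test_function g" shows "test_function (\<lambda>x. f x + g x)"
proof -
  obtain K L where "compact K" "K \<subseteq> {-1<..<1}" "\<forall>x. x \<notin> K \<longrightarrow> f x = 0"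
    "compact L" "L \<subseteq> {-1<..<1}" "\<forall>x. x \<notin> L \<longrightarrow> g x = 0"
    using assms unfolding test_function_iff by blast
  then have "compact (K \<union> L) \<and> K \<union> L \<subseteq> {-1<..<1} \<and> (\<forall>x. x \<notin> K \<union> L \<longrightarrow> f x + g x = 0)"
    by auto
  then show ?thesis using assms unfolding test_function_iff by (blast intro: smooth_add)
qed

lemma test_function_cnj: "test_function \<theta> \<Longrightarrow> test_function (\<lambda>x. cnj (\<theta> x))"
  by (auto simp: test_function_iff intro: smooth_cnj)

lemma test_function_vder:
  assumes "test_function \<theta>" shows "test_function (vder \<theta>)"
proof -
  obtain K where K: "compact K" "K \<subseteq> {-1<..<1}" "\<And>x. x \<notin> K \<Longrightarrow> \<theta> x = 0"
    using assms unfolding test_function_iff by blast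
  have "vder \<theta> x = 0" if "x \<notin> K" for x
  proof -
    have "open (- K)" using K(1) compact_imp_closed by blast
    then have "(\<theta> has_vector_derivative 0) (at x)"
      using that K(3)
      by (intro has_vector_derivative_transform_within_open[of "\<lambda>y. 0" 0 x "- K" \<theta>]) auto
    then show ?thesis unfolding vder_def by (rule vector_derivative_at)
  qed
  then show ?thesis using assms K(1,2) smooth_vder unfolding test_function_iff by blast
qed

lemma smooth_sq: "smooth f \<Longrightarrow> sq_integrable f"
  by (rule sq_integrable_continuous[OF smooth_continuous])

lemma test_function_sq: "test_function \<theta> \<Longrightarrow> sq_integrable \<theta>"
  by (rule smooth_sq[OF test_function_smooth])

text \<open>The arguments are n(1 + x) - 1 and n(1 - x) - 1, so the support lies in
  [-1 + 1/n, 1 - 1/n] and the values tend to 1 inside the interval. They are spelled out in the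
  shape that \<open>smooth_affine\<close> expects.\<close>

definition cutoff :: "nat \<Rightarrow> real \<Rightarrow> complex" where
  "cutoff n x = complex_of_real (bump (real n * x + (real n - 1)) * bump (- real n * x + (real n - 1)))"

lemma smooth_cutoff: "smooth (cutoff n)"
  unfolding cutoff_def by (intro smooth_of_real smooth_mult smooth_affine smooth_bump)

lemma norm_cutoff: "cmod (cutoff n x) \<le> 1"
  unfolding cutoff_def using bump_nonneg bump_le_1 by (simp add: norm_mult mult_le_one)

lemma test_function_cutoff: "test_function (cutoff n)"
proof (cases "n = 0")
  case True
  then have "cutoff n = (\<lambda>x. 0)" by (auto simp: cutoff_def bump_def)
  then show ?thesis by (auto simp: test_function_iff intro!: exI[of _ "{}"])
next
  case False
  let ?K = "{-1 + 1 / real n .. 1 - 1 / real n}"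
  have "cutoff n x = 0" if "x \<notin> ?K" for x
  proof -
    have "x < -1 + 1 / real n \<or> x > 1 - 1 / real n" using that by auto
    then have "real n * x + (real n - 1) < 0 \<or> - real n * x + (real n - 1) < 0"
      using False by (auto simp: field_simps)
    then show ?thesis by (auto simp: cutoff_def bump_def)
  qed
  moreover have "?K \<subseteq> {-1<..<1}"
  proof -
    have "1 / real n > 0" using False by simp
    then show ?thesis
      unfolding subset_iff atLeastAtMost_iff greaterThanLessThan_iff by (intro allI impI conjI; linarith)
  qed
  ultimately show ?thesis unfolding test_function_iff using smooth_cutoff compact_Icc by blast
qed

lemma bump_at_top:
  assumes "a > 0" shows "(\<lambda>n. bump (real n * a - 1)) \<longlonglongrightarrow> 1"
proof -
  have top: "filterlim (\<lambda>n. real n * a - 1) at_top sequentially"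
  proof -
    have "filterlim (\<lambda>n. a * real n) at_top sequentially"
      using assms filterlim_real_sequentially
      by (intro filterlim_tendsto_pos_mult_at_top[OF tendsto_const]) auto
    then have "filterlim (\<lambda>n. -1 + a * real n) at_top sequentially"
      by (rule filterlim_tendsto_add_at_top[OF tendsto_const])
    then show ?thesis by (simp add: mult.commute)
  qed
  have "(\<lambda>n. inverse (real n * a - 1)) \<longlonglongrightarrow> 0"
    by (rule tendsto_inverse_0_at_top[OF top])
  then have "(\<lambda>n. exp (- inverse (real n * a - 1))) \<longlonglongrightarrow> exp (- 0)"
    by (intro tendsto_intros)
  moreover have "\<forall>\<^sub>F n in sequentially. exp (- inverse (real n * a - 1)) = bump (real n * a - 1)"
    using filterlim_at_top_dense[THEN iffD1, OF top, rule_format, of 0]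
    by eventually_elim (simp add: bump_def divide_inverse)
  ultimately show ?thesis by (simp add: Lim_transform_eventually)
qed

lemma cutoff_tendsto:
  assumes "x \<in> {-1<..<1}" shows "(\<lambda>n. cutoff n x) \<longlonglongrightarrow> 1"
proof -
  have "(\<lambda>n. bump (real n * (x + 1) - 1) * bump (real n * (1 - x) - 1)) \<longlonglongrightarrow> 1 * 1"
    using assms by (intro tendsto_mult bump_at_top) auto
  then have "(\<lambda>n. complex_of_real (bump (real n * (x + 1) - 1) * bump (real n * (1 - x) - 1))) \<longlonglongrightarrow> of_real 1"
    by (intro tendsto_of_real) simp
  moreover have "complex_of_real (bump (real n * (x + 1) - 1) * bump (real n * (1 - x) - 1)) = cutoff n x" for n
    unfolding cutoff_def by (simp add: algebra_simps)
  ultimately show ?thesis by simp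
qed

section \<open>Density of the test functions in \<open>l2\<close>\<close>

definition test_l2 :: "l2 set" where
  "test_l2 = {abs_l2 \<theta> | \<theta>. test_function \<theta>}"

lemma polynomial_smooth:
  fixes p :: "real \<Rightarrow> complex"
  assumes "polynomial_function p" shows "smooth p"
  unfolding smooth_def
proof
  fix n show "ndiff n p"
    using assms
  proof (induction n arbitrary: p)
    case (Suc n)
    then obtain p' where "polynomial_function p'" "\<And>x. (p has_vector_derivative p' x) (at x)"
      using has_vector_derivative_polynomial_function by blast
    with Suc.IH show ?case by auto
  qed simp
qed

lemma smooth_closure: "smooth g \<Longrightarrow> abs_l2 g \<in> closure test_l2"
proof -
  assume g: "smooth g"
  have c: "continuous_on UNIV g" by (rule smooth_continuous[OF g])
  obtain K where K: "\<And>x. x \<in> {-1..1} \<Longrightarrow> norm (g x) \<le> K"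
    using continuous_bounded_I11[OF c] by blast
  have "(\<lambda>n. abs_l2 (\<lambda>x. cutoff n x * g x)) \<longlonglongrightarrow> abs_l2 g"
  proof (rule l2_dominated(3)[where w = "\<lambda>x. K"])
    show "(\<lambda>x. cutoff n x * g x) \<in> borel_measurable I11" for n
      by (intro continuous_measurable_I11 smooth_continuous smooth_mult smooth_cutoff g)
    show "g \<in> borel_measurable I11" by (rule continuous_measurable_I11[OF c])
    show "AE x in I11. (\<lambda>n. cutoff n x * g x) \<longlonglongrightarrow> g x"
    proof (rule AE_I2)
      fix x assume "x \<in> space I11"
      then have "(\<lambda>n. cutoff n x * g x) \<longlonglongrightarrow> 1 * g x"
        by (intro tendsto_mult tendsto_const cutoff_tendsto) auto
      then show "(\<lambda>n. cutoff n x * g x) \<longlonglongrightarrow> g x" by simp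
    qed
    show "AE x in I11. cmod (cutoff n x * g x) \<le> K" for n
    proof (rule AE_I2)
      fix x assume "x \<in> space I11"
      then have "cmod (g x) \<le> K" using K by auto
      then show "cmod (cutoff n x * g x) \<le> K"
        using norm_cutoff[of n x] mult_left_le_one_le[of "cmod (g x)" "cmod (cutoff n x)"] by (simp add: norm_mult)
    qed
  qed auto
  moreover have "abs_l2 (\<lambda>x. cutoff n x * g x) \<in> test_l2" for n
    using test_function_mult[OF g test_function_cutoff[of n]]
    unfolding test_l2_def by (auto simp: mult.commute)
  ultimately show ?thesis unfolding closure_sequential by (intro exI[of _ "\<lambda>n. abs_l2 (\<lambda>x. cutoff n x * g x)"]) auto
qed

lemma closure_closure_sequentially:
  "(\<And>n. u n \<in> closure S) \<Longrightarrow> u \<longlonglongrightarrow> f \<Longrightarrow> f \<in> closure S"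
  using closed_sequentially[OF closed_closure] by blast

lemma continuous_closure:
  assumes c: "continuous_on UNIV g" shows "abs_l2 g \<in> closure test_l2"
proof -
  have "\<exists>p. polynomial_function p \<and> (\<forall>x\<in>{-1..1}. norm (g x - p x) < inverse (Suc n))" for n :: nat
    using c by (intro Stone_Weierstrass_polynomial_function) (auto intro: continuous_on_subset)
  then obtain p where p: "\<And>n. polynomial_function (p n)"
    "\<And>n x. x \<in> {-1..1} \<Longrightarrow> norm (g x - p n x) < inverse (Suc n)"
    by metis
  obtain K where K: "\<And>x. x \<in> {-1..1} \<Longrightarrow> norm (g x) \<le> K"
    using continuous_bounded_I11[OF c] by blast
  have "(\<lambda>n. abs_l2 (p n)) \<longlonglongrightarrow> abs_l2 g"
  proof (rule l2_dominated(3)[where w = "\<lambda>x. K + 1"])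
    show "p n \<in> borel_measurable I11" for n
      by (intro continuous_measurable_I11 smooth_continuous polynomial_smooth p)
    show "g \<in> borel_measurable I11" by (rule continuous_measurable_I11[OF c])
    show "AE x in I11. (\<lambda>n. p n x) \<longlonglongrightarrow> g x"
    proof (rule AE_I2)
      fix x assume "x \<in> space I11"
      then have "norm (p n x - g x) \<le> inverse (Suc n)" for n
        using p(2)[of x n] by (simp add: norm_minus_commute less_imp_le)
      then have "(\<lambda>n. p n x - g x) \<longlonglongrightarrow> 0"
        by (intro Lim_null_comparison[OF _ LIMSEQ_inverse_real_of_nat]) auto
      then show "(\<lambda>n. p n x) \<longlonglongrightarrow> g x" by (simp add: LIM_zero_iff)
    qed
    show "AE x in I11. cmod (p n x) \<le> K + 1" for n
    proof (rule AE_I2)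
      fix x assume "x \<in> space I11"
      then have x: "x \<in> {-1..1}" by auto
      have "inverse (real (Suc n)) \<le> 1" by (simp add: inverse_le_1_iff)
      with p(2)[OF x, of n] K[OF x] show "cmod (p n x) \<le> K + 1"
        using norm_triangle_ineq2[of "p n x" "g x"] by (simp add: norm_minus_commute)
    qed
  qed auto
  then show ?thesis
    by (rule closure_closure_sequentially[rotated]) (intro smooth_closure polynomial_smooth p)
qed

text \<open>Radial projection onto the closed disc of radius k: continuous in z, bounded by k, and
  the identity once k >= |z|.\<close>

definition trunc :: "real \<Rightarrow> complex \<Rightarrow> complex" where
  "trunc k z = of_real (k / max k (cmod z)) * z"

lemma trunc_le: "k > 0 \<Longrightarrow> cmod (trunc k z) \<le> k" "k > 0 \<Longrightarrow> cmod (trunc k z) \<le> cmod z"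
  by (auto simp: trunc_def norm_mult norm_divide max_def)

lemma continuous_trunc: "k > 0 \<Longrightarrow> continuous_on UNIV (trunc k)"
  unfolding trunc_def by (intro continuous_intros) (auto simp: max_def)

lemma trunc_eq: "k > 0 \<Longrightarrow> cmod z \<le> k \<Longrightarrow> trunc k z = z"
  by (auto simp: trunc_def max_def)

text \<open>The chain of approximations is: square integrable by bounded, bounded by continuous,
  continuous by polynomial (Stone-Weierstrass), smooth by compactly supported via
  \<open>cutoff\<close>. Each link is an instance of \<open>l2_dominated\<close>.\<close>

lemma test_l2_dense: "closure test_l2 = UNIV"
proof -
  have "f \<in> closure test_l2" for f
  proof -
    define F where "F = rep_l2 f"
    have F: "F \<in> borel_measurable I11" "integrable I11 (\<lambda>x. (cmod (F x))\<^sup>2)"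
      using sq_integrable_rep[of f] by (auto simp: sq_integrable_def F_def)
    have "F measurable_on {-1<..<1}"
      using F(1) by (subst measurable_on_iff_borel_measurable) auto
    then obtain N g where N: "negligible N" and g: "\<And>n. continuous_on UNIV (g n)"
      and lim: "\<And>x. x \<notin> N \<Longrightarrow> (\<lambda>n. g n x) \<longlonglongrightarrow> (if x \<in> {-1<..<1} then F x else 0)"
      unfolding measurable_on_def by blast
    have ae: "AE x in I11. (\<lambda>n. g n x) \<longlonglongrightarrow> F x"
    proof -
      have "AE x in lebesgue. x \<notin> N"
        using N by (auto simp: negligible_iff_null_sets intro: AE_not_in)
      then have "AE x in lebesgue. x \<in> {-1<..<1} \<longrightarrow> (\<lambda>n. g n x) \<longlonglongrightarrow> F x"
        by eventually_elim (use lim in fastforce)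
      then show ?thesis by (subst AE_restrict_space_iff) auto
    qed
    have mF: "(\<lambda>x. trunc k (F x)) \<in> borel_measurable I11" if "k > 0" for k
      using measurable_compose[OF F(1), of "trunc k" borel] continuous_trunc[OF that]
      by (simp add: borel_measurable_continuous_onI)
    \<comment> \<open>The continuous functions g n converge to F only almost everywhere, without a
      majorant. Truncating both sides at level k supplies the constant majorant k.\<close>
    have tr: "abs_l2 (\<lambda>x. trunc k (F x)) \<in> closure test_l2" if k: "k > 0" for k
    proof (rule closure_closure_sequentially)
      have c: "continuous_on UNIV (\<lambda>x. trunc k (g n x))" for n
        using continuous_on_compose2[OF continuous_trunc[OF k] g] by auto
      then show "abs_l2 (\<lambda>x. trunc k (g n x)) \<in> closure test_l2" for n
        by (rule continuous_closure)
      show "(\<lambda>n. abs_l2 (\<lambda>x. trunc k (g n x))) \<longlonglongrightarrow> abs_l2 (\<lambda>x. trunc k (F x))"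
      proof (rule l2_dominated(3)[where w = "\<lambda>x. k"])
        show "(\<lambda>x. trunc k (g n x)) \<in> borel_measurable I11" for n
          by (rule continuous_measurable_I11[OF c])
        show "AE x in I11. (\<lambda>n. trunc k (g n x)) \<longlonglongrightarrow> trunc k (F x)"
          using ae
        proof eventually_elim
          case (elim x)
          show ?case
            using continuous_on_tendsto_compose[OF continuous_trunc[OF k] elim] by auto
        qed
      qed (use k trunc_le mF in auto)
    qed
    have "(\<lambda>n. abs_l2 (\<lambda>x. trunc (real (Suc n)) (F x))) \<longlonglongrightarrow> abs_l2 F"
    proof (rule l2_dominated(3)[where w = "\<lambda>x. cmod (F x)"])
      show "AE x in I11. (\<lambda>n. trunc (real (Suc n)) (F x)) \<longlonglongrightarrow> F x"
      proof (rule AE_I2, rule tendsto_eventually)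
        fix x
        have "\<forall>\<^sub>F n in sequentially. cmod (F x) \<le> real n"
          using filterlim_real_sequentially by (simp add: filterlim_at_top)
        then show "\<forall>\<^sub>F n in sequentially. trunc (real (Suc n)) (F x) = F x"
          by eventually_elim (auto intro: trunc_eq)
      qed
    qed (use F mF trunc_le in auto)
    then have "abs_l2 F \<in> closure test_l2"
      by (rule closure_closure_sequentially[rotated]) (auto intro: tr)
    then show ?thesis by (simp add: F_def abs_rep_l2)
  qed
  then show ?thesis by blast
qed

subsection \<open>Multiplication operators\<close>

lemma Linfty_continuous: "continuous_on UNIV m \<Longrightarrow> Linfty m"
proof -
  assume c: "continuous_on UNIV m"
  obtain K where K: "\<And>x. x \<in> {-1..1} \<Longrightarrow> norm (m x) \<le> K"
    using continuous_bounded_I11[OF c] by blast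
  then have "AE x in I11. \<bar>m x\<bar> \<le> K" by (intro AE_I2) auto
  then show ?thesis unfolding Linfty_def using continuous_measurable_I11[OF c] by blast
qed

lemma Linfty_smooth: "smooth m \<Longrightarrow> Linfty m"
  by (rule Linfty_continuous[OF smooth_continuous])

lemma Linfty_const [intro, simp]: "Linfty (\<lambda>x. c)"
  by (rule Linfty_continuous) simp

lemma Linfty_mult [intro]:
  assumes "Linfty m" "Linfty n" shows "Linfty (\<lambda>x. m x * n x)"
proof -
  obtain K L where K: "AE x in I11. \<bar>m x\<bar> \<le> K" and L: "AE x in I11. \<bar>n x\<bar> \<le> L"
    using assms unfolding Linfty_def by blast
  have "AE x in I11. \<bar>m x * n x\<bar> \<le> K * L"
    using K L
  proof eventually_elim
    case (elim x)
    moreover have "0 \<le> \<bar>m x\<bar>" by simp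
    ultimately show ?case unfolding abs_mult by (intro mult_mono) linarith+
  qed
  moreover have "(\<lambda>x. m x * n x) \<in> borel_measurable I11" using assms by (auto simp: Linfty_def)
  ultimately show ?thesis by (auto simp: Linfty_def)
qed

lemma Linfty_add [intro]:
  assumes "Linfty m" "Linfty n" shows "Linfty (\<lambda>x. m x + n x)"
proof -
  obtain K L where K: "AE x in I11. \<bar>m x\<bar> \<le> K" and L: "AE x in I11. \<bar>n x\<bar> \<le> L"
    using assms unfolding Linfty_def by blast
  have "AE x in I11. \<bar>m x + n x\<bar> \<le> K + L"
    using K L by eventually_elim linarith
  moreover have "(\<lambda>x. m x + n x) \<in> borel_measurable I11" using assms by (auto simp: Linfty_def)
  ultimately show ?thesis by (auto simp: Linfty_def)
qed

lemma Linfty_cmult [intro]: "Linfty m \<Longrightarrow> Linfty (\<lambda>x. c * m x)"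
  by (rule Linfty_mult) auto

lemma Linfty_abs [intro]: "Linfty m \<Longrightarrow> Linfty (\<lambda>x. \<bar>m x\<bar>)"
  by (auto simp: Linfty_def)

lemma sq_integrable_mult:
  assumes m: "Linfty m" and f: "sq_integrable f"
  shows "sq_integrable (\<lambda>x. complex_of_real (m x) * f x)"
proof -
  obtain K where K: "AE x in I11. \<bar>m x\<bar> \<le> K" using m unfolding Linfty_def by blast
  have mm: "(\<lambda>x. complex_of_real (m x) * f x) \<in> borel_measurable I11"
    using m f by (auto simp: Linfty_def sq_integrable_def)
  show ?thesis
  proof (rule l2_dominated(2)[where u = "\<lambda>n. \<lambda>x. complex_of_real (m x) * f x" and w = "\<lambda>x. \<bar>K\<bar> * cmod (f x)"])
    show "integrable I11 (\<lambda>x. (\<bar>K\<bar> * cmod (f x))\<^sup>2)"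
      using f by (simp add: sq_integrable_def power_mult_distrib)
    show "AE x in I11. cmod (complex_of_real (m x) * f x) \<le> \<bar>K\<bar> * cmod (f x)"
      using K by eventually_elim (auto simp: norm_mult intro!: mult_right_mono)
  qed (use mm in auto)
qed

lemma rep_mult_l2:
  assumes m: "Linfty m"
  shows "AE x in I11. rep_l2 (mult_l2 m f) x = complex_of_real (m x) * rep_l2 f x"
  unfolding mult_l2_def by (rule rep_abs_l2[OF sq_integrable_mult[OF m sq_integrable_rep]])

lemma mult_abs_l2:
  assumes m: "Linfty m" and f: "sq_integrable f"
  shows "mult_l2 m (abs_l2 f) = abs_l2 (\<lambda>x. complex_of_real (m x) * f x)"
  unfolding mult_l2_def
proof (rule abs_l2_eqI)
  show "AE x in I11. complex_of_real (m x) * rep_l2 (abs_l2 f) x = complex_of_real (m x) * f x"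
    using rep_abs_l2[OF f] by eventually_elim simp
qed (intro sq_integrable_mult m f sq_integrable_rep)+

lemma mult_l2_add_right:
  assumes m: "Linfty m" shows "mult_l2 m (f + g) = mult_l2 m f + mult_l2 m g"
proof (rule l2_eqI)
  show "AE x in I11. rep_l2 (mult_l2 m (f + g)) x = rep_l2 (mult_l2 m f + mult_l2 m g) x"
    using rep_mult_l2[OF m, of f] rep_mult_l2[OF m, of g] rep_mult_l2[OF m, of "f + g"]
      rep_l2_add[of f g] rep_l2_add[of "mult_l2 m f" "mult_l2 m g"]
    by eventually_elim (simp add: algebra_simps)
qed

lemma mult_l2_scaleR_right:
  assumes m: "Linfty m" shows "mult_l2 m (r *\<^sub>R f) = r *\<^sub>R mult_l2 m f"
proof (rule l2_eqI)
  show "AE x in I11. rep_l2 (mult_l2 m (r *\<^sub>R f)) x = rep_l2 (r *\<^sub>R mult_l2 m f) x"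
    using rep_mult_l2[OF m, of f] rep_mult_l2[OF m, of "r *\<^sub>R f"]
      rep_l2_scaleR[of r f] rep_l2_scaleR[of r "mult_l2 m f"]
    by eventually_elim (simp add: algebra_simps)
qed

lemma mult_l2_add_left:
  assumes "Linfty m" "Linfty n" shows "mult_l2 (\<lambda>x. m x + n x) f = mult_l2 m f + mult_l2 n f"
proof (rule l2_eqI)
  show "AE x in I11. rep_l2 (mult_l2 (\<lambda>x. m x + n x) f) x = rep_l2 (mult_l2 m f + mult_l2 n f) x"
    using rep_mult_l2[OF assms(1), of f] rep_mult_l2[OF assms(2), of f]
      rep_mult_l2[OF Linfty_add[OF assms], of f] rep_l2_add[of "mult_l2 m f" "mult_l2 n f"]
    by eventually_elim (simp add: algebra_simps)
qed

lemma mult_l2_mult: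
  assumes "Linfty m" "Linfty n" shows "mult_l2 m (mult_l2 n f) = mult_l2 (\<lambda>x. m x * n x) f"
proof (rule l2_eqI)
  show "AE x in I11. rep_l2 (mult_l2 m (mult_l2 n f)) x = rep_l2 (mult_l2 (\<lambda>x. m x * n x) f) x"
    using rep_mult_l2[OF assms(1), of "mult_l2 n f"] rep_mult_l2[OF assms(2), of f]
      rep_mult_l2[OF Linfty_mult[OF assms], of f]
    by eventually_elim (simp add: algebra_simps)
qed

lemma mult_l2_cong:
  assumes "Linfty m" "Linfty n" "\<And>x. -1 < x \<Longrightarrow> x < 1 \<Longrightarrow> m x = n x"
  shows "mult_l2 m f = mult_l2 n f"
proof (rule l2_eqI)
  have "AE x in I11. m x = n x" by (rule AE_I2) (use assms(3) in auto)
  then show "AE x in I11. rep_l2 (mult_l2 m f) x = rep_l2 (mult_l2 n f) x"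
    using rep_mult_l2[OF assms(1), of f] rep_mult_l2[OF assms(2), of f]
    by eventually_elim simp
qed

lemma mult_l2_const: "mult_l2 (\<lambda>x. c) f = c *\<^sub>R f"
proof (rule l2_eqI)
  show "AE x in I11. rep_l2 (mult_l2 (\<lambda>x. c) f) x = rep_l2 (c *\<^sub>R f) x"
    using rep_mult_l2[OF Linfty_const[of c], of f] rep_l2_scaleR[of c f]
    by eventually_elim simp
qed

lemma mult_l2_cmult: "Linfty m \<Longrightarrow> mult_l2 (\<lambda>x. c * m x) f = c *\<^sub>R mult_l2 m f"
  using mult_l2_mult[of "\<lambda>x. c" m f] by (simp add: mult_l2_const)

lemma mult_l2_zero: "mult_l2 (\<lambda>x. 0) f = 0"
  by (simp add: mult_l2_const)

section \<open>Weighted inner products and quadratic forms\<close>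

lemma integrable_inner: "integrable I11 (\<lambda>x. Re (rep_l2 f x * cnj (rep_l2 g x)))"
  using sq_integrable_prod[OF sq_integrable_rep sq_integrable_rep, of f g] by (rule integrable_Re)

lemma integrable_inner_mult:
  assumes m: "Linfty m" shows "integrable I11 (\<lambda>x. m x * Re (rep_l2 f x * cnj (rep_l2 g x)))"
    and "inner (mult_l2 m f) g = (\<integral>x. m x * Re (rep_l2 f x * cnj (rep_l2 g x)) \<partial>I11)"
proof -
  have ae: "AE x in I11. Re (rep_l2 (mult_l2 m f) x * cnj (rep_l2 g x)) = m x * Re (rep_l2 f x * cnj (rep_l2 g x))"
    using rep_mult_l2[OF m, of f] by eventually_elim (simp add: algebra_simps)
  have mm: "(\<lambda>x. m x * Re (rep_l2 f x * cnj (rep_l2 g x))) \<in> borel_measurable I11"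
    using m borel_measurable_integrable[OF integrable_inner[of f g]]
    unfolding Linfty_def by (auto intro: borel_measurable_times simp del: times_complex.sel)
  show "integrable I11 (\<lambda>x. m x * Re (rep_l2 f x * cnj (rep_l2 g x)))"
    using integrable_cong_AE[THEN iffD1, OF borel_measurable_integrable[OF integrable_inner] mm ae integrable_inner] .
  show "inner (mult_l2 m f) g = (\<integral>x. m x * Re (rep_l2 f x * cnj (rep_l2 g x)) \<partial>I11)"
    unfolding inner_l2_eq
    by (rule integral_cong_AE[OF borel_measurable_integrable[OF integrable_inner] mm ae])
qed

lemma inner_mult_commute:
  assumes m: "Linfty m" shows "inner (mult_l2 m f) g = inner f (mult_l2 m g)"
  unfolding inner_commute[of f] integrable_inner_mult(2)[OF m] by (simp add: algebra_simps)

abbreviation wsq :: "(real \<Rightarrow> real) \<Rightarrow> l2 \<Rightarrow> real" where "wsq m f \<equiv> inner (mult_l2 m f) f"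

lemma inner_mult_mono_AE:
  assumes m: "Linfty m" "Linfty n" and le: "AE x in I11. m x \<le> n x"
  shows "wsq m f \<le> wsq n f"
  unfolding integrable_inner_mult(2)[OF m(1)] integrable_inner_mult(2)[OF m(2)]
proof (rule integral_mono_AE[OF integrable_inner_mult(1)[OF m(1)] integrable_inner_mult(1)[OF m(2)]])
  show "AE x in I11. m x * Re (rep_l2 f x * cnj (rep_l2 f x)) \<le> n x * Re (rep_l2 f x * cnj (rep_l2 f x))"
    using le by eventually_elim (auto intro!: mult_right_mono)
qed

lemma inner_mult_mono:
  assumes "Linfty m" "Linfty n" and le: "\<And>x. -1 < x \<Longrightarrow> x < 1 \<Longrightarrow> m x \<le> n x"
  shows "wsq m f \<le> wsq n f"
  by (rule inner_mult_mono_AE[OF assms(1,2)], rule AE_I2) (use le in auto)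

lemma inner_mult_nonneg:
  assumes "Linfty m" "\<And>x. -1 < x \<Longrightarrow> x < 1 \<Longrightarrow> 0 \<le> m x"
  shows "0 \<le> wsq m f"
  using inner_mult_mono[OF Linfty_const[of 0] assms(1), of f] assms(2) by (simp add: mult_l2_zero)

lemma norm_mult_l2_sq:
  assumes "Linfty m" shows "(norm (mult_l2 m f))\<^sup>2 = wsq (\<lambda>x. (m x)\<^sup>2) f"
  unfolding power2_norm_eq_inner inner_mult_commute[OF assms, symmetric] mult_l2_mult[OF assms assms]
  by (simp add: power2_eq_square)

lemma bounded_linear_mult_l2:
  assumes m: "Linfty m" shows "bounded_linear (mult_l2 m)"
proof -
  obtain K where K: "AE x in I11. \<bar>m x\<bar> \<le> K" using m unfolding Linfty_def by blast
  show ?thesis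
  proof (rule bounded_linear_intro[where K = "\<bar>K\<bar>"])
    fix f
    have L2: "Linfty (\<lambda>x. (m x)\<^sup>2)" unfolding power2_eq_square by (intro Linfty_mult m)
    have "(norm (mult_l2 m f))\<^sup>2 = wsq (\<lambda>x. (m x)\<^sup>2) f" by (rule norm_mult_l2_sq[OF m])
    also have "\<dots> \<le> wsq (\<lambda>x. K\<^sup>2) f"
      unfolding integrable_inner_mult(2)[OF L2] integrable_inner_mult(2)[OF Linfty_const]
    proof (rule integral_mono_AE[OF integrable_inner_mult(1)[OF L2] integrable_inner_mult(1)[OF Linfty_const]])
      show "AE x in I11. (m x)\<^sup>2 * Re (rep_l2 f x * cnj (rep_l2 f x)) \<le> K\<^sup>2 * Re (rep_l2 f x * cnj (rep_l2 f x))"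
        using K
      proof eventually_elim
        case (elim x)
        then have "\<bar>m x\<bar>\<^sup>2 \<le> K\<^sup>2" by (intro power_mono) auto
        then show ?case by (intro mult_right_mono) auto
      qed
    qed
    also have "\<dots> = (norm f * \<bar>K\<bar>)\<^sup>2"
      by (simp add: mult_l2_const power_mult_distrib power2_norm_eq_inner)
    finally show "norm (mult_l2 m f) \<le> norm f * \<bar>K\<bar>" by (rule power2_le_imp_le) simp
  qed (auto simp: mult_l2_add_right mult_l2_scaleR_right m)
qed

text \<open>Pointwise Young inequality under the integral. The weight may change sign, as the
  multiplier q does later, and the price is |m| on the right.\<close>

lemma inner_mult_le_abs:
  assumes m: "Linfty m"
  shows "2 * inner (mult_l2 m f) g \<le> wsq (\<lambda>x. \<bar>m x\<bar>) f + wsq (\<lambda>x. \<bar>m x\<bar>) g"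
proof -
  have L: "Linfty (\<lambda>x. \<bar>m x\<bar>)" by (rule Linfty_abs[OF m])
  let ?n = "\<lambda>x. \<bar>m x\<bar>"
  have cm: "Re (z * cnj z) = (cmod z)\<^sup>2" for z by (simp add: cmod_power2) (simp add: power2_eq_square)
  have "2 * inner (mult_l2 m f) g = (\<integral>x. 2 * (m x * Re (rep_l2 f x * cnj (rep_l2 g x))) \<partial>I11)"
    unfolding integrable_inner_mult(2)[OF m] by (simp add: integrable_inner_mult(1)[OF m])
  also have "\<dots> \<le> (\<integral>x. ?n x * Re (rep_l2 f x * cnj (rep_l2 f x)) + ?n x * Re (rep_l2 g x * cnj (rep_l2 g x)) \<partial>I11)"
  proof (rule integral_mono)
    fix x
    let ?f = "rep_l2 f x" and ?g = "rep_l2 g x"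
    have "2 * (m x * Re (?f * cnj ?g)) \<le> 2 * (\<bar>m x\<bar> * (cmod ?f * cmod ?g))"
    proof -
      have "m x * Re (?f * cnj ?g) \<le> \<bar>m x * Re (?f * cnj ?g)\<bar>" by simp
      also have "\<dots> \<le> \<bar>m x\<bar> * (cmod ?f * cmod ?g)"
        unfolding abs_mult using abs_Re_le_cmod[of "?f * cnj ?g"]
        by (intro mult_left_mono) (auto simp: norm_mult)
      finally show ?thesis by simp
    qed
    also have "\<dots> \<le> \<bar>m x\<bar> * ((cmod ?f)\<^sup>2 + (cmod ?g)\<^sup>2)"
      using mult_left_mono[OF sum_squares_bound[of "cmod ?f" "cmod ?g"], of "\<bar>m x\<bar>"] by (simp add: algebra_simps)
    finally show "2 * (m x * Re (?f * cnj ?g)) \<le> ?n x * Re (?f * cnj ?f) + ?n x * Re (?g * cnj ?g)"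
      using cm[of ?f] cm[of ?g] by (simp only: distrib_left)
  qed (intro integrable_mult_right Bochner_Integration.integrable_add integrable_inner_mult m L)+
  also have "\<dots> = wsq ?n f + wsq ?n g"
    unfolding integrable_inner_mult(2)[OF L]
    by (rule Bochner_Integration.integral_add[OF integrable_inner_mult(1)[OF L] integrable_inner_mult(1)[OF L]])
  finally show ?thesis .
qed

lemma norm_sq_le_2: "(norm a)\<^sup>2 \<le> 2 * (norm b)\<^sup>2 + 2 * (norm (a - b))\<^sup>2" for a b :: "'a::real_inner"
proof -
  have "norm a \<le> norm b + norm (a - b)" using norm_triangle_ineq[of b "a - b"] by simp
  then have "(norm a)\<^sup>2 \<le> (norm b + norm (a - b))\<^sup>2" by (intro power_mono) auto
  also have "\<dots> \<le> 2 * (norm b)\<^sup>2 + 2 * (norm (a - b))\<^sup>2"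
    using sum_squares_bound[of "norm b" "norm (a - b)"] by (simp add: power2_sum)
  finally show ?thesis .
qed

lemma norm_mult_le:
  assumes m: "Linfty m" "Linfty n" and le: "\<And>x. -1 < x \<Longrightarrow> x < 1 \<Longrightarrow> (m x)\<^sup>2 \<le> C * n x"
  shows "(norm (mult_l2 m f))\<^sup>2 \<le> C * wsq n f"
proof -
  have "wsq (\<lambda>x. (m x)\<^sup>2) f \<le> wsq (\<lambda>x. C * n x) f"
    by (rule inner_mult_mono[OF _ _ le]) (use m in \<open>auto simp: power2_eq_square\<close>)
  then show ?thesis by (simp add: norm_mult_l2_sq m mult_l2_cmult)
qed

text \<open>Parallelogram law: the right side minus the left side is the form of m at f - g, which
  is nonnegative.\<close>

lemma inner_mult_add_le:
  assumes m: "Linfty m" and nn: "\<And>x. -1 < x \<Longrightarrow> x < 1 \<Longrightarrow> 0 \<le> m x"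
  shows "wsq m (f + g) \<le> 2 * wsq m f + 2 * wsq m g"
proof -
  interpret M: bounded_linear "mult_l2 m" by (rule bounded_linear_mult_l2[OF m])
  have "0 \<le> wsq m (f - g)" by (rule inner_mult_nonneg[OF m nn])
  then show ?thesis
    by (simp add: M.add M.diff inner_add_left inner_add_right inner_diff_left inner_diff_right)
qed

lemma norm_add_sq_le: "(norm (a + b))\<^sup>2 \<le> 2 * (norm a)\<^sup>2 + 2 * (norm b)\<^sup>2" for a b :: "'a::real_inner"
  using norm_sq_le_2[of "a + b" a] by simp

lemma bounded_linear_pair_sq:
  fixes L :: "l2 \<times> l2 \<Rightarrow> l2"
  assumes "bounded_linear L"
  obtains K where "K \<ge> 0" "\<And>f g. (norm (L (f, g)))\<^sup>2 \<le> K * ((norm f)\<^sup>2 + (norm g)\<^sup>2)"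
proof -
  obtain K where K: "K \<ge> 0" "\<And>x. norm (L x) \<le> norm x * K"
    using bounded_linear.nonneg_bounded[OF assms] by blast
  have "(norm (L (f, g)))\<^sup>2 \<le> K\<^sup>2 * ((norm f)\<^sup>2 + (norm g)\<^sup>2)" for f g
    using power_mono[OF K(2)[of "(f, g)"] norm_ge_zero, of 2]
    by (simp add: norm_Pair power_mult_distrib mult.commute)
  then show ?thesis using that[of "K\<^sup>2"] by simp
qed

lemma bounded_mult_sq:
  assumes "Linfty m" obtains K where "K \<ge> 0" "\<And>f. (norm (mult_l2 m f))\<^sup>2 \<le> K * (norm f)\<^sup>2"
proof -
  obtain K where K: "K \<ge> 0" "\<And>x. norm (mult_l2 m x) \<le> norm x * K"
    using bounded_linear.nonneg_bounded[OF bounded_linear_mult_l2[OF assms]] by blast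
  have "(norm (mult_l2 m f))\<^sup>2 \<le> K\<^sup>2 * (norm f)\<^sup>2" for f
    using power_mono[OF K(2)[of f] norm_ge_zero, of 2] by (simp add: power_mult_distrib mult.commute)
  then show ?thesis using that[of "K\<^sup>2"] by simp
qed

text \<open>For a bounded nonnegative D one has D^2 <= K D almost everywhere, so the damping force D
  f in L^2 is controlled by the dissipation.\<close>

lemma damping_sq:
  assumes D: "Linfty D" and nn: "\<And>x. -1 < x \<Longrightarrow> x < 1 \<Longrightarrow> 0 \<le> D x"
  obtains K where "K \<ge> 0" "\<And>f. (norm (mult_l2 D f))\<^sup>2 \<le> K * wsq D f"
proof -
  obtain K where K: "AE x in I11. \<bar>D x\<bar> \<le> K" using D unfolding Linfty_def by blast
  have "(norm (mult_l2 D f))\<^sup>2 \<le> \<bar>K\<bar> * wsq D f" for f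
  proof -
    have "AE x in I11. 0 \<le> D x" by (rule AE_I2) (use nn in auto)
    then have "AE x in I11. (D x)\<^sup>2 \<le> \<bar>K\<bar> * D x"
      using K by eventually_elim (simp add: power2_eq_square mult_right_mono)
    then have "wsq (\<lambda>x. (D x)\<^sup>2) f \<le> wsq (\<lambda>x. \<bar>K\<bar> * D x) f"
      by (rule inner_mult_mono_AE[rotated 2]) (use D in \<open>auto simp: power2_eq_square\<close>)
    then show ?thesis by (simp add: norm_mult_l2_sq D mult_l2_cmult)
  qed
  then show ?thesis using that[of "\<bar>K\<bar>"] by simp
qed

text \<open>The elastic part is immediate. For the damping part D (D g) the form carries D^3, and
  D^3 <= K^2 D.\<close>

lemma damping_stress:
  assumes D: "Linfty D" and nn: "\<And>x. -1 < x \<Longrightarrow> x < 1 \<Longrightarrow> 0 \<le> D x" and k: "k > 0"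
  obtains K where "K \<ge> 0" "\<And>f g. wsq D (k *\<^sub>R f + mult_l2 D g)
    \<le> K * (wsq D f + wsq D g)"
proof -
  interpret M: bounded_linear "mult_l2 D" by (rule bounded_linear_mult_l2[OF D])
  obtain K where K: "K \<ge> 0" "\<And>f. (norm (mult_l2 D f))\<^sup>2 \<le> K * wsq D f"
    using damping_sq[OF D nn] by blast
  have n: "0 \<le> wsq D f" for f by (rule inner_mult_nonneg[OF D nn])
  define L where "L = 2 * k\<^sup>2 + 2 * K\<^sup>2 + 2"
  have "wsq D (k *\<^sub>R f + mult_l2 D g)
    \<le> L * (wsq D f + wsq D g)" for f g
  proof -
    have "wsq D (mult_l2 D g) \<le> norm (mult_l2 D (mult_l2 D g)) * norm (mult_l2 D g)"
      by (rule norm_cauchy_schwarz)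
    also have "\<dots> \<le> ((norm (mult_l2 D (mult_l2 D g)))\<^sup>2 + (norm (mult_l2 D g))\<^sup>2) / 2"
      using sum_squares_bound[of "norm (mult_l2 D (mult_l2 D g))" "norm (mult_l2 D g)"] by simp
    finally have a: "2 * wsq D (mult_l2 D g) \<le>
      (norm (mult_l2 D (mult_l2 D g)))\<^sup>2 + (norm (mult_l2 D g))\<^sup>2" by simp
    have b: "(norm (mult_l2 D (mult_l2 D g)))\<^sup>2 \<le> K * wsq D (mult_l2 D g)" by (rule K(2))
    have c: "wsq D (mult_l2 D g) \<le> K * (K * wsq D g)"
    proof (cases "K = 0")
      case True
      then have "norm (mult_l2 D g) = 0" using K(2)[of g] by simp
      then show ?thesis using True by simp
    next
      case False
      define Y where "Y = norm (mult_l2 D (mult_l2 D g))"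
      define x where "x = wsq D (mult_l2 D g)"
      define y where "y = (norm (mult_l2 D g))\<^sup>2"
      have Kp: "K > 0" using K(1) False by simp
      \<comment> \<open>For h = D g, Cauchy-Schwarz and \<open>damping_sq\<close> give x^2 <= |D
        h|^2 |h|^2 <= (K x) y. Cancelling x yields x <= K y, and a second use of
        \<open>damping_sq\<close> bounds y.\<close>
      have "x\<^sup>2 \<le> Y\<^sup>2 * y"
        using Cauchy_Schwarz_ineq[of "mult_l2 D (mult_l2 D g)" "mult_l2 D g"]
        by (simp add: x_def Y_def y_def power2_norm_eq_inner)
      also have "\<dots> \<le> (K * x) * y" using b by (intro mult_right_mono) (auto simp: x_def Y_def y_def)
      finally have "x * x \<le> x * (K * y)" by (simp add: power2_eq_square mult_ac)
      moreover have "x \<ge> 0" unfolding x_def by (rule n)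
      moreover have "K * y \<ge> 0" using Kp by (simp add: y_def)
      ultimately have "x \<le> K * y" by (cases "x = 0") auto
      also have "\<dots> \<le> K * (K * wsq D g)" unfolding y_def by (intro mult_left_mono K)
      finally show ?thesis by (simp add: x_def)
    qed
    have "wsq D (k *\<^sub>R f + mult_l2 D g)
        \<le> 2 * wsq D (k *\<^sub>R f) + 2 * wsq D (mult_l2 D g)"
      by (rule inner_mult_add_le[OF D nn])
    also have "\<dots> \<le> (2 * k\<^sup>2) * wsq D f + (2 * K\<^sup>2) * wsq D g"
      using c by (simp add: M.scaleR power2_eq_square mult_ac)
    also have "\<dots> \<le> L * wsq D f + L * wsq D g"
      by (intro add_mono mult_right_mono n) (auto simp: L_def)
    finally show ?thesis by (simp add: algebra_simps)
  qed
  moreover have "L \<ge> 0" by (simp add: L_def)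
  ultimately show ?thesis using that by blast
qed

subsection \<open>Weak derivatives\<close>

lemma integral_vder:
  fixes u :: "real \<Rightarrow> complex"
  assumes "smooth u" shows "(\<integral>x. vder u x \<partial>I11) = u 1 - u (-1)"
proof -
  have "((vder u) has_integral (u 1 - u (-1))) {-1..1}"
    by (rule fundamental_theorem_of_calculus)
       (auto intro: has_vector_derivative_at_within smooth_deriv[OF assms])
  then have 1: "integral {-1<..<1} (vder u) = u 1 - u (-1)"
    using integral_open_interval_real[of "-1" 1 "vder u"] by (simp add: integral_unique)
  have "integrable I11 (vder u)"
    using sq_integrable_prod[OF smooth_sq[OF smooth_vder[OF assms]] sq_integrable_continuous[of "\<lambda>x. 1"]] by simp
  then show ?thesis using 1 lebesgue_integral_eq_integral[of "{-1<..<1}" "vder u"] by simp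
qed

lemma vder_mult:
  fixes f g :: "real \<Rightarrow> complex"
  assumes "smooth f" "smooth g"
  shows "vder (\<lambda>x. f x * g x) = (\<lambda>x. f x * vder g x + vder f x * g x)"
  by (rule vder_eq) (intro has_vector_derivative_mult smooth_deriv assms)

lemma vder_cnj: "smooth f \<Longrightarrow> vder (\<lambda>x. cnj (f x)) = (\<lambda>x. cnj (vder f x))"
  by (rule vder_eq) (intro bounded_linear.has_vector_derivative[OF bounded_linear_cnj] smooth_deriv)

lemma vder_of_real: "smooth f \<Longrightarrow> vder (\<lambda>x. complex_of_real (f x)) = (\<lambda>x. complex_of_real (vder f x))"
  by (rule vder_eq) (intro bounded_linear.has_vector_derivative[OF bounded_linear_of_real] smooth_deriv)

lemma integral_rep_mult:
  assumes "sq_integrable h"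
  shows "inner f (abs_l2 h) = Re (\<integral>x. rep_l2 f x * cnj (h x) \<partial>I11)"
  using inner_abs_l2[OF sq_integrable_rep[of f] assms]
    integral_Re[OF sq_integrable_prod[OF sq_integrable_rep[of f] assms]]
  by (simp add: abs_rep_l2)

text \<open>The definition pairs without conjugation and over the complex numbers, whereas
  \<open>inner\<close> is the real part of the sesquilinear product. Conjugating the test function
  fixes the first mismatch; testing also with i times the test function recovers the imaginary
  part.\<close>

lemma has_weak_derivative_iff:
  "has_weak_derivative f g \<longleftrightarrow>
    (\<forall>\<theta>. test_function \<theta> \<longrightarrow> inner f (abs_l2 (vder \<theta>)) = - inner g (abs_l2 \<theta>))"
  (is "?L \<longleftrightarrow> ?R")
proof
  assume L: ?L
  show ?R
  proof (intro allI impI)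
    fix \<theta> assume t: "test_function \<theta>"
    have "(\<integral>x. rep_l2 f x * vder (\<lambda>x. cnj (\<theta> x)) x \<partial>I11) = - (\<integral>x. rep_l2 g x * cnj (\<theta> x) \<partial>I11)"
      using L test_function_cnj[OF t] unfolding has_weak_derivative_def vder_def by blast
    then have "Re (\<integral>x. rep_l2 f x * cnj (vder \<theta> x) \<partial>I11) = - Re (\<integral>x. rep_l2 g x * cnj (\<theta> x) \<partial>I11)"
      by (simp add: vder_cnj[OF test_function_smooth[OF t]])
    then show "inner f (abs_l2 (vder \<theta>)) = - inner g (abs_l2 \<theta>)"
      using test_function_sq[OF t] test_function_sq[OF test_function_vder[OF t]]
      by (simp add: integral_rep_mult)
  qed
next
  assume R: ?R
  have re: "Re (\<integral>x. rep_l2 f x * vder \<theta> x \<partial>I11) = - Re (\<integral>x. rep_l2 g x * \<theta> x \<partial>I11)"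
    if t: "test_function \<theta>" for \<theta>
  proof -
    have t': "test_function (\<lambda>x. cnj (\<theta> x))" by (rule test_function_cnj[OF t])
    then have "inner f (abs_l2 (vder (\<lambda>x. cnj (\<theta> x)))) = - inner g (abs_l2 (\<lambda>x. cnj (\<theta> x)))"
      using R by blast
    then show ?thesis
      unfolding integral_rep_mult[OF test_function_sq[OF t']]
        integral_rep_mult[OF test_function_sq[OF test_function_vder[OF t']]]
      by (simp add: vder_cnj[OF test_function_smooth[OF t]])
  qed
  show ?L
    unfolding has_weak_derivative_def
  proof (intro allI impI)
    fix \<theta> assume t: "test_function \<theta>"
    have ti: "test_function (\<lambda>x. \<i> * \<theta> x)" by (rule test_function_mult[OF smooth_const t])
    have "vder (\<lambda>x. \<i> * \<theta> x) = (\<lambda>x. \<i> * vder \<theta> x)"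
      by (rule vder_eq) (intro bounded_linear.has_vector_derivative[OF bounded_linear_mult_right] smooth_deriv test_function_smooth t)
    then have "Re (\<integral>x. \<i> * (rep_l2 f x * vder \<theta> x) \<partial>I11) = - Re (\<integral>x. \<i> * (rep_l2 g x * \<theta> x) \<partial>I11)"
      using re[OF ti] by (simp add: mult.left_commute)
    then have "Im (\<integral>x. rep_l2 f x * vder \<theta> x \<partial>I11) = - Im (\<integral>x. rep_l2 g x * \<theta> x \<partial>I11)"
      by simp
    with re[OF t] have "(\<integral>x. rep_l2 f x * vder \<theta> x \<partial>I11) = - (\<integral>x. rep_l2 g x * \<theta> x \<partial>I11)"
      by (simp add: complex_eq_iff)
    then show "(\<integral>x. rep_l2 f x * vector_derivative \<theta> (at x) \<partial>I11) = - (\<integral>x. rep_l2 g x * \<theta> x \<partial>I11)"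
      by (simp add: vder_def)
  qed
qed

lemma orthogonal_test_imp_0:
  assumes "\<And>\<theta>. test_function \<theta> \<Longrightarrow> inner d (abs_l2 \<theta>) = 0" shows "d = 0"
proof -
  have "closed {t. inner d t = 0}" by (intro closed_Collect_eq continuous_intros)
  moreover have "test_l2 \<subseteq> {t. inner d t = 0}" using assms by (auto simp: test_l2_def)
  ultimately have "closure test_l2 \<subseteq> {t. inner d t = 0}" by (rule closure_minimal[rotated])
  then have "inner d d = 0" unfolding test_l2_dense by blast
  then show ?thesis by simp
qed

lemma has_weak_derivative_unique:
  assumes "has_weak_derivative f g" "has_weak_derivative f g'" shows "g = g'"
proof -
  have "g - g' = 0"
    by (rule orthogonal_test_imp_0) (use assms in \<open>simp add: has_weak_derivative_iff inner_diff_left\<close>)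
  then show ?thesis by simp
qed

lemma wderiv_eqI: "has_weak_derivative f g \<Longrightarrow> wderiv f = g"
  unfolding wderiv_def using has_weak_derivative_unique by blast

lemma H1I: "has_weak_derivative f g \<Longrightarrow> f \<in> H1"
  by (auto simp: H1_def)

lemma has_wderiv: "f \<in> H1 \<Longrightarrow> has_weak_derivative f (wderiv f)"
  using wderiv_eqI by (auto simp: H1_def)

lemma has_weak_derivative_add:
  "has_weak_derivative f f' \<Longrightarrow> has_weak_derivative g g' \<Longrightarrow> has_weak_derivative (f + g) (f' + g')"
  by (simp add: has_weak_derivative_iff inner_add_left)

lemma has_weak_derivative_scaleR:
  "has_weak_derivative f f' \<Longrightarrow> has_weak_derivative (r *\<^sub>R f) (r *\<^sub>R f')"
  by (simp add: has_weak_derivative_iff)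

lemma subspace_H1: "subspace H1"
  unfolding subspace_def
proof (intro conjI ballI allI)
  show "0 \<in> H1" by (rule H1I[of _ 0]) (simp add: has_weak_derivative_iff)
qed (auto intro: H1I[OF has_weak_derivative_add[OF has_wderiv has_wderiv]] H1I[OF has_weak_derivative_scaleR[OF has_wderiv]])

lemma wderiv_add: "f \<in> H1 \<Longrightarrow> g \<in> H1 \<Longrightarrow> wderiv (f + g) = wderiv f + wderiv g"
  by (intro wderiv_eqI has_weak_derivative_add has_wderiv)

lemma wderiv_scaleR: "f \<in> H1 \<Longrightarrow> wderiv (r *\<^sub>R f) = r *\<^sub>R wderiv f"
  by (intro wderiv_eqI has_weak_derivative_scaleR has_wderiv)

lemma wderiv_diff:
  assumes "f \<in> H1" "g \<in> H1" shows "wderiv (f - g) = wderiv f - wderiv g"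
proof -
  have "f - g \<in> H1" using assms by (rule subspace_diff[OF subspace_H1])
  from wderiv_add[OF this assms(2)] show ?thesis by (simp add: eq_diff_eq)
qed

lemma has_weak_derivative_smooth:
  assumes f: "smooth f" shows "has_weak_derivative (abs_l2 f) (abs_l2 (vder f))"
  unfolding has_weak_derivative_iff
proof (intro allI impI)
  fix \<theta> assume t: "test_function \<theta>"
  note st = test_function_smooth[OF t]
  have sf': "sq_integrable (vder f)" "sq_integrable f" using f by (auto intro: smooth_sq smooth_vder)
  have st': "sq_integrable (vder \<theta>)" "sq_integrable \<theta>" using st by (auto intro: smooth_sq smooth_vder)
  have z: "\<theta> 1 = 0" "\<theta> (-1) = 0" using t unfolding test_function_iff by force+
  have "(\<integral>x. vder (\<lambda>x. f x * cnj (\<theta> x)) x \<partial>I11) = 0"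
    by (subst integral_vder) (use z in \<open>auto intro!: smooth_mult smooth_cnj f st\<close>)
  then have "(\<integral>x. f x * cnj (vder \<theta> x) + vder f x * cnj (\<theta> x) \<partial>I11) = 0"
    by (simp add: vder_mult[OF f smooth_cnj[OF st]] vder_cnj[OF st])
  then have "(\<integral>x. f x * cnj (vder \<theta> x) \<partial>I11) + (\<integral>x. vder f x * cnj (\<theta> x) \<partial>I11) = 0"
    using sf' st' by (simp add: sq_integrable_prod)
  then have "Re (\<integral>x. f x * cnj (vder \<theta> x) \<partial>I11) = - Re (\<integral>x. vder f x * cnj (\<theta> x) \<partial>I11)"
    by (simp add: complex_eq_iff)
  then show "inner (abs_l2 f) (abs_l2 (vder \<theta>)) = - inner (abs_l2 (vder f)) (abs_l2 \<theta>)"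
    unfolding inner_abs_l2[OF sf'(2) st'(1)] inner_abs_l2[OF sf'(1) st'(2)]
      integral_Re[OF sq_integrable_prod[OF sf'(2) st'(1)]] integral_Re[OF sq_integrable_prod[OF sf'(1) st'(2)]] .
qed

lemma H10_H1: "f \<in> H10 \<Longrightarrow> f \<in> H1" by (simp add: H10_def)

text \<open>Weak differentiation is closed: the defining identity passes to the limit against a
  fixed test function, so the limit of the derivatives is the derivative of the limit.\<close>

lemma H10I:
  assumes t: "\<And>n. test_function (\<theta> n)" and f: "(\<lambda>n. abs_l2 (\<theta> n)) \<longlonglongrightarrow> f"
    and g: "(\<lambda>n. abs_l2 (vder (\<theta> n))) \<longlonglongrightarrow> g"
  shows "f \<in> H10" "wderiv f = g"
proof -
  have w: "has_weak_derivative f g"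
    unfolding has_weak_derivative_iff
  proof (intro allI impI)
    fix \<xi> assume c: "test_function \<xi>"
    have "(\<lambda>n. inner (abs_l2 (\<theta> n)) (abs_l2 (vder \<xi>))) \<longlonglongrightarrow> inner f (abs_l2 (vder \<xi>))"
      by (intro tendsto_intros f)
    moreover have "inner (abs_l2 (\<theta> n)) (abs_l2 (vder \<xi>)) = - inner (abs_l2 (vder (\<theta> n))) (abs_l2 \<xi>)" for n
      using has_weak_derivative_smooth[OF test_function_smooth[OF t]] c
      by (simp add: has_weak_derivative_iff)
    moreover have "(\<lambda>n. - inner (abs_l2 (vder (\<theta> n))) (abs_l2 \<xi>)) \<longlonglongrightarrow> - inner g (abs_l2 \<xi>)"
      by (intro tendsto_intros g)
    ultimately show "inner f (abs_l2 (vder \<xi>)) = - inner g (abs_l2 \<xi>)"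
      using LIMSEQ_unique by simp
  qed
  show w': "wderiv f = g" by (rule wderiv_eqI[OF w])
  show "f \<in> H10" unfolding H10_def using H1I[OF w] t f g w' unfolding vder_def by blast
qed

lemma H10E:
  assumes "f \<in> H10"
  obtains \<theta> where "\<And>n. test_function (\<theta> n)" "(\<lambda>n. abs_l2 (\<theta> n)) \<longlonglongrightarrow> f"
    "(\<lambda>n. abs_l2 (vder (\<theta> n))) \<longlonglongrightarrow> wderiv f"
  using assms unfolding H10_def vder_def by blast

text \<open>The defining identity of the weak derivative extends from test functions to their H^1
  limits. There is no boundary term because f lies in \<open>H10\<close>; T may have any boundary
  values.\<close>

lemma inner_wderiv:
  assumes T: "T \<in> H1" and f: "f \<in> H10"
  shows "inner (wderiv T) f = - inner T (wderiv f)"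
proof -
  obtain \<theta> where t: "\<And>n. test_function (\<theta> n)" "(\<lambda>n. abs_l2 (\<theta> n)) \<longlonglongrightarrow> f"
    "(\<lambda>n. abs_l2 (vder (\<theta> n))) \<longlonglongrightarrow> wderiv f" using H10E[OF f] by blast
  have "(\<lambda>n. inner (wderiv T) (abs_l2 (\<theta> n))) \<longlonglongrightarrow> inner (wderiv T) f"
    by (intro tendsto_intros t)
  moreover have "(\<lambda>n. - inner T (abs_l2 (vder (\<theta> n)))) \<longlonglongrightarrow> - inner T (wderiv f)"
    by (intro tendsto_intros t)
  moreover have "inner (wderiv T) (abs_l2 (\<theta> n)) = - inner T (abs_l2 (vder (\<theta> n)))" for n
    using has_wderiv[OF T] t(1) by (simp add: has_weak_derivative_iff)
  ultimately show ?thesis using LIMSEQ_unique by simp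
qed

lemma subspace_H10: "subspace H10"
  unfolding subspace_def
proof (intro conjI ballI allI)
  have "test_function (\<lambda>x. 0)" by (auto simp: test_function_iff intro!: exI[of _ "{}"])
  moreover have "vder (\<lambda>x. 0::complex) = (\<lambda>x. 0)" by (rule vder_eq) simp
  moreover have "abs_l2 (\<lambda>x. 0) = 0" by (simp add: zero_l2_def)
  ultimately show "0 \<in> H10" by (intro H10I(1)[of "\<lambda>n x. 0" 0 0]) auto
next
  fix f g assume f: "f \<in> H10" and g: "g \<in> H10"
  obtain \<theta> where t: "\<And>n. test_function (\<theta> n)" "(\<lambda>n. abs_l2 (\<theta> n)) \<longlonglongrightarrow> f"
    "(\<lambda>n. abs_l2 (vder (\<theta> n))) \<longlonglongrightarrow> wderiv f" using H10E[OF f] by blast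
  obtain \<xi> where c: "\<And>n. test_function (\<xi> n)" "(\<lambda>n. abs_l2 (\<xi> n)) \<longlonglongrightarrow> g"
    "(\<lambda>n. abs_l2 (vder (\<xi> n))) \<longlonglongrightarrow> wderiv g" using H10E[OF g] by blast
  note s = test_function_smooth[OF t(1)] test_function_smooth[OF c(1)]
  have v: "vder (\<lambda>x. \<theta> n x + \<xi> n x) = (\<lambda>x. vder (\<theta> n) x + vder (\<xi> n) x)" for n
    by (rule vder_eq) (intro has_vector_derivative_add smooth_deriv s)
  show "f + g \<in> H10"
  proof (rule H10I(1)[of "\<lambda>n x. \<theta> n x + \<xi> n x"])
    show "test_function (\<lambda>x. \<theta> n x + \<xi> n x)" for n by (rule test_function_add[OF t(1) c(1)])
    show "(\<lambda>n. abs_l2 (\<lambda>x. \<theta> n x + \<xi> n x)) \<longlonglongrightarrow> f + g"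
      using tendsto_add[OF t(2) c(2)] by (simp add: abs_l2_add smooth_sq s)
    show "(\<lambda>n. abs_l2 (vder (\<lambda>x. \<theta> n x + \<xi> n x))) \<longlonglongrightarrow> wderiv f + wderiv g"
      using tendsto_add[OF t(3) c(3)] by (simp add: v abs_l2_add smooth_sq smooth_vder s)
  qed
next
  fix r f assume f: "f \<in> H10"
  obtain \<theta> where t: "\<And>n. test_function (\<theta> n)" "(\<lambda>n. abs_l2 (\<theta> n)) \<longlonglongrightarrow> f"
    "(\<lambda>n. abs_l2 (vder (\<theta> n))) \<longlonglongrightarrow> wderiv f" using H10E[OF f] by blast
  note s = test_function_smooth[OF t(1)]
  have v: "vder (\<lambda>x. of_real r * \<theta> n x) = (\<lambda>x. of_real r * vder (\<theta> n) x)" for n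
    by (rule vder_eq) (intro bounded_linear.has_vector_derivative[OF bounded_linear_mult_right] smooth_deriv s)
  show "r *\<^sub>R f \<in> H10"
  proof (rule H10I(1)[of "\<lambda>n x. of_real r * \<theta> n x"])
    show "test_function (\<lambda>x. of_real r * \<theta> n x)" for n by (rule test_function_mult[OF smooth_const t(1)])
    show "(\<lambda>n. abs_l2 (\<lambda>x. of_real r * \<theta> n x)) \<longlonglongrightarrow> r *\<^sub>R f"
      using tendsto_scaleR[OF tendsto_const t(2)] by (simp add: abs_l2_scaleR smooth_sq s)
    show "(\<lambda>n. abs_l2 (vder (\<lambda>x. of_real r * \<theta> n x))) \<longlonglongrightarrow> r *\<^sub>R wderiv f"
      using tendsto_scaleR[OF tendsto_const t(3)] by (simp add: v abs_l2_scaleR smooth_sq smooth_vder s)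
  qed
qed

lemma mult_l2_smooth:
  assumes "smooth m" "smooth f"
  shows "mult_l2 m (abs_l2 f) = abs_l2 (\<lambda>x. of_real (m x) * f x)"
  by (rule mult_abs_l2[OF Linfty_smooth smooth_sq]) fact+

lemma vder_real_mult:
  assumes m: "smooth m" and f: "smooth f"
  shows "vder (\<lambda>x. complex_of_real (m x) * f x) = (\<lambda>x. of_real (m x) * vder f x + of_real (vder m x) * f x)"
  by (simp add: vder_mult[OF smooth_of_real[OF m] f] vder_of_real[OF m])

lemma mult_vder:
  assumes m: "smooth m" and f: "smooth f"
  shows "abs_l2 (vder (\<lambda>x. complex_of_real (m x) * f x)) = mult_l2 m (abs_l2 (vder f)) + mult_l2 (vder m) (abs_l2 f)"
  using assms
  by (simp add: vder_real_mult mult_l2_smooth smooth_vder abs_l2_add smooth_sq smooth_mult smooth_of_real)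

lemma H1_mult:
  assumes m: "smooth m" and f: "f \<in> H1"
  shows "mult_l2 m f \<in> H1" "wderiv (mult_l2 m f) = mult_l2 (vder m) f + mult_l2 m (wderiv f)"
proof -
  note L = Linfty_smooth[OF m] Linfty_smooth[OF smooth_vder[OF m]]
  have "has_weak_derivative (mult_l2 m f) (mult_l2 (vder m) f + mult_l2 m (wderiv f))"
    unfolding has_weak_derivative_iff
  proof (intro allI impI)
    fix \<theta> assume t: "test_function \<theta>"
    note s = test_function_smooth[OF t]
    have "test_function (\<lambda>x. of_real (m x) * \<theta> x)"
      by (rule test_function_mult[OF smooth_of_real[OF m] t])
    then have "inner f (abs_l2 (vder (\<lambda>x. of_real (m x) * \<theta> x))) = - inner (wderiv f) (abs_l2 (\<lambda>x. of_real (m x) * \<theta> x))"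
      using has_wderiv[OF f] unfolding has_weak_derivative_iff by blast
    then have "inner f (mult_l2 m (abs_l2 (vder \<theta>))) + inner f (mult_l2 (vder m) (abs_l2 \<theta>)) = - inner (wderiv f) (mult_l2 m (abs_l2 \<theta>))"
      by (simp add: mult_vder[OF m s] mult_l2_smooth[OF m s] inner_add_right)
    then show "inner (mult_l2 m f) (abs_l2 (vder \<theta>)) = - inner (mult_l2 (vder m) f + mult_l2 m (wderiv f)) (abs_l2 \<theta>)"
      by (simp add: inner_add_left inner_mult_commute L)
  qed
  then show "mult_l2 m f \<in> H1" "wderiv (mult_l2 m f) = mult_l2 (vder m) f + mult_l2 m (wderiv f)"
    by (rule H1I, rule wderiv_eqI)
qed

lemma H10_mult:
  assumes m: "smooth m" and f: "f \<in> H10"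
  shows "mult_l2 m f \<in> H10"
proof -
  obtain \<theta> where t: "\<And>n. test_function (\<theta> n)" "(\<lambda>n. abs_l2 (\<theta> n)) \<longlonglongrightarrow> f"
    "(\<lambda>n. abs_l2 (vder (\<theta> n))) \<longlonglongrightarrow> wderiv f" using H10E[OF f] by blast
  note L = bounded_linear_mult_l2[OF Linfty_smooth[OF m]] bounded_linear_mult_l2[OF Linfty_smooth[OF smooth_vder[OF m]]]
  note s = test_function_smooth[OF t(1)]
  show ?thesis
  proof (rule H10I(1)[of "\<lambda>n x. of_real (m x) * \<theta> n x"])
    show "test_function (\<lambda>x. of_real (m x) * \<theta> n x)" for n
      by (rule test_function_mult[OF smooth_of_real[OF m] t(1)])
    show "(\<lambda>n. abs_l2 (\<lambda>x. of_real (m x) * \<theta> n x)) \<longlonglongrightarrow> mult_l2 m f"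
      using bounded_linear.tendsto[OF L(1) t(2)] by (simp add: mult_l2_smooth[OF m s])
    show "(\<lambda>n. abs_l2 (vder (\<lambda>x. of_real (m x) * \<theta> n x))) \<longlonglongrightarrow> mult_l2 m (wderiv f) + mult_l2 (vder m) f"
      using tendsto_add[OF bounded_linear.tendsto[OF L(1) t(3)] bounded_linear.tendsto[OF L(2) t(2)]]
      by (simp add: mult_vder[OF m s])
  qed
qed

lemma vder_id: "vder (\<lambda>x. x) = (\<lambda>x. 1)"
  by (rule vder_eq) auto

text \<open>Multiplier x: integration by parts gives |f|^2 = -2 <x f, f'>, and |x| <= 1 on the
  interval. This is the origin of the constant 2.\<close>

lemma poincare:
  assumes f: "f \<in> H10" shows "norm f \<le> 2 * norm (wderiv f)"
proof -
  let ?X = "mult_l2 (\<lambda>x. x)"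
  have L: "Linfty (\<lambda>x. x)" by (rule Linfty_smooth[OF smooth_id])
  have "inner (wderiv (?X f)) f = - inner (?X f) (wderiv f)"
    by (rule inner_wderiv[OF H1_mult(1)[OF smooth_id H10_H1[OF f]] f])
  then have "inner f f = - 2 * inner (?X f) (wderiv f)"
    using inner_mult_commute[OF L, of "wderiv f" f]
    by (simp add: H1_mult(2)[OF smooth_id H10_H1[OF f]] vder_id mult_l2_const inner_add_left inner_add_right inner_commute)
  also have "\<dots> \<le> 2 * (norm (?X f) * norm (wderiv f))"
    using Cauchy_Schwarz_ineq2[of "?X f" "wderiv f"] by linarith
  also have "\<dots> \<le> 2 * (norm f * norm (wderiv f))"
  proof -
    have "(norm (?X f))\<^sup>2 \<le> wsq (\<lambda>x. 1) f"
      unfolding norm_mult_l2_sq[OF L]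
    proof (rule inner_mult_mono)
      show "Linfty (\<lambda>x. x\<^sup>2)" unfolding power2_eq_square by (rule Linfty_mult[OF L L])
      show "x\<^sup>2 \<le> 1" if "-1 < x" "x < 1" for x :: real
        using that by (simp add: abs_square_le_1)
    qed simp
    then have "(norm (?X f))\<^sup>2 \<le> (norm f)\<^sup>2"
      by (simp add: mult_l2_const power2_norm_eq_inner[of f])
    then have "norm (?X f) \<le> norm f" by (rule power2_le_imp_le) simp
    then show ?thesis by (simp add: mult_right_mono)
  qed
  finally have "norm f * norm f \<le> norm f * (2 * norm (wderiv f))"
    by (simp add: power2_norm_eq_inner[symmetric] power2_eq_square)
  then show ?thesis by (cases "norm f = 0") auto
qed

subsection \<open>Constants and means\<close>

definition cst :: "complex \<Rightarrow> l2" where "cst z = abs_l2 (\<lambda>x. z)"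

lemma integral_FTC_I11:
  fixes u g :: "real \<Rightarrow> complex"
  assumes "\<And>x. (u has_vector_derivative g x) (at x)" "smooth g"
  shows "(\<integral>x. g x \<partial>I11) = u 1 - u (-1)"
  using integral_vder[OF smoothI[OF assms]] vder_eq[of u g] assms(1) by simp

lemma measure_I11 [simp]: "measure I11 {-1<..<1} = 2"
  by (simp add: measure_restrict_space)

lemma integral_const_I11: "(\<integral>x. z \<partial>I11) = 2 * z" for z :: complex
  by (simp add: scaleR_conv_of_real)

lemma inner_cst:
  assumes f: "sq_integrable f"
  shows "inner (abs_l2 f) (cst z) = Re ((\<integral>x. f x \<partial>I11) * cnj z)"
proof -
  have z: "sq_integrable (\<lambda>x. z)" by (rule smooth_sq[OF smooth_const])
  show ?thesis
    unfolding cst_def inner_abs_l2[OF f z] integral_Re[OF sq_integrable_prod[OF f z]] by simp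
qed

lemma inner_cst_cst: "inner (cst y) (cst z) = 2 * Re (y * cnj z)"
  using inner_cst[OF smooth_sq[OF smooth_const], of y z] by (simp add: cst_def[symmetric] integral_const_I11)

lemma cst_add: "cst (y + z) = cst y + cst z"
  unfolding cst_def by (intro abs_l2_add smooth_sq smooth_const)

lemma cst_scaleR: "cst (of_real r * z) = r *\<^sub>R cst z"
  unfolding cst_def by (intro abs_l2_scaleR smooth_sq smooth_const)

lemma cst_0: "cst 0 = 0" using cst_scaleR[of 0 0] by simp

text \<open>The orthogonal projection onto the constants. \<open>cst 1\<close> and
  \<open>cst \<i>\<close> are orthogonal for the real inner product and have squared norm 2, whence
  the factor 1/2.\<close>

definition mean :: "l2 \<Rightarrow> l2" where
  "mean f = (1 / 2) *\<^sub>R (inner f (cst 1) *\<^sub>R cst 1 + inner f (cst \<i>) *\<^sub>R cst \<i>)"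

lemma bounded_linear_mean: "bounded_linear mean"
proof -
  have "bounded_linear (\<lambda>f. inner f e *\<^sub>R e)" for e :: l2
    by (rule bounded_linear_scaleR_left[THEN bounded_linear_compose, OF bounded_linear_inner_left])
  then show ?thesis unfolding mean_def
    by (intro bounded_linear_compose[OF bounded_linear_scaleR_right] bounded_linear_add)
qed

lemma inner_mean: "inner (mean f) g = inner f (mean g)"
  by (simp add: mean_def inner_add_left inner_add_right inner_commute)

lemma mean_abs_l2:
  assumes "sq_integrable f" shows "mean (abs_l2 f) = cst ((\<integral>x. f x \<partial>I11) / 2)"
proof -
  let ?c = "\<integral>x. f x \<partial>I11"
  have "cst (?c / 2) = cst (of_real (Re ?c / 2) * 1 + of_real (Im ?c / 2) * \<i>)"
    by (rule arg_cong[of _ _ cst]) (simp add: complex_eq_iff)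
  also have "\<dots> = (Re ?c / 2) *\<^sub>R cst 1 + (Im ?c / 2) *\<^sub>R cst \<i>"
    unfolding cst_add cst_scaleR ..
  finally show ?thesis using assms by (simp add: mean_def inner_cst scaleR_add_right)
qed

lemma mean_cst: "mean (cst z) = cst z"
  using mean_abs_l2[OF smooth_sq[OF smooth_const], of z]
  by (simp add: cst_def[symmetric] scaleR_conv_of_real)

lemma mean_is_cst: "\<exists>z. mean f = cst z"
  using mean_abs_l2[OF sq_integrable_rep, of f] by (auto simp: abs_rep_l2)

lemma cst_H1: "cst z \<in> H1" and wderiv_cst: "wderiv (cst z) = 0"
proof -
  have "vder (\<lambda>x. z) = (\<lambda>x. 0)" by (rule vder_eq) simp
  then have "has_weak_derivative (cst z) 0"
    using has_weak_derivative_smooth[OF smooth_const, of z] by (simp add: cst_def cst_0[unfolded cst_def])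
  then show "cst z \<in> H1" "wderiv (cst z) = 0" by (rule H1I, rule wderiv_eqI)
qed

lemma inner_wderiv_cst: "f \<in> H10 \<Longrightarrow> inner (wderiv f) (cst z) = 0"
  using inner_wderiv[OF cst_H1, of f z] by (simp add: wderiv_cst inner_commute)

lemma inner_wderiv_mean: "f \<in> H10 \<Longrightarrow> inner (wderiv f) (mean g) = 0"
  using mean_is_cst[of g] inner_wderiv_cst by auto

subsection \<open>Primitives\<close>

lemma integral_I11:
  fixes g :: "real \<Rightarrow> 'a::euclidean_space"
  assumes "continuous_on UNIV g"
  shows "(\<integral>x. g x \<partial>I11) = integral {-1..1} g"
proof -
  have "g absolutely_integrable_on {-1..1}"
    by (rule absolutely_integrable_continuous_real) (rule continuous_on_subset[OF assms], simp)
  then have "g absolutely_integrable_on {-1<..<1}"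
    by (rule set_integrable_subset) auto
  then have "integrable I11 g"
    by (simp add: integrable_restrict_space set_integrable_def)
  then show ?thesis
    using lebesgue_integral_eq_integral[of "{-1<..<1}" g] integral_open_interval_real[of "-1" 1 g] by simp
qed

lemma integral_norm_le:
  assumes "continuous_on UNIV (f :: real \<Rightarrow> complex)"
  shows "integral {-1..1} (\<lambda>x. cmod (f x)) \<le> 2 * norm (abs_l2 f)"
proof -
  let ?g = "\<lambda>x. complex_of_real (cmod (f x))"
  have c: "continuous_on UNIV ?g" using assms by (intro continuous_intros)
  have "integral {-1..1} (\<lambda>x. cmod (f x)) = (\<integral>x. cmod (f x) \<partial>I11)"
    by (rule integral_I11[symmetric]) (intro continuous_intros assms)
  also have "\<dots> = inner (abs_l2 ?g) (cst 1)"
    by (simp add: inner_cst[OF sq_integrable_continuous[OF c]])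
  also have "\<dots> \<le> norm (abs_l2 ?g) * norm (cst 1)" by (rule norm_cauchy_schwarz)
  also have "norm (abs_l2 ?g) = norm (abs_l2 f)"
    using norm_abs_l2[OF sq_integrable_continuous[OF c]] norm_abs_l2[OF sq_integrable_continuous[OF assms]]
    by simp
  also have "norm (abs_l2 f) * norm (cst 1) \<le> norm (abs_l2 f) * 2"
  proof (rule mult_left_mono)
    show "norm (cst 1) \<le> 2"
      unfolding norm_eq_sqrt_inner inner_cst_cst by (rule real_le_lsqrt) auto
  qed simp
  finally show ?thesis by simp
qed

definition prim0 :: "(real \<Rightarrow> complex) \<Rightarrow> real \<Rightarrow> complex" where
  "prim0 f x = integral {-1..x} f"

text \<open>The bound is uniform in x, so primitives of an L^2 convergent sequence converge
  pointwise with a constant majorant.\<close>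

lemma prim0_bound:
  assumes c: "continuous_on UNIV f" and x: "x \<in> {-1<..<1}"
  shows "cmod (prim0 f x) \<le> 2 * norm (abs_l2 f)"
proof -
  have i: "f integrable_on {a..b}" "(\<lambda>x. cmod (f x)) integrable_on {a..b}" for a b
    by (intro integrable_continuous_real continuous_on_subset[OF c] continuous_on_norm; simp)+
  have "cmod (integral {-1..x} f) \<le> integral {-1..x} (\<lambda>x. cmod (f x))"
    by (rule integral_norm_bound_integral[OF i]) simp
  also have "\<dots> \<le> integral {-1..1} (\<lambda>x. cmod (f x))"
    by (rule integral_subset_le[OF _ i(2) i(2)]) (use x in auto)
  also have "\<dots> \<le> 2 * norm (abs_l2 f)" by (rule integral_norm_le[OF c])
  finally show ?thesis by (simp add: prim0_def)
qed

text \<open>Vanishing of the total integral is exactly what makes the primitive vanish again to the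
  right of the support.\<close>

lemma test_function_prim0:
  assumes t: "test_function \<theta>" and z: "(\<integral>x. \<theta> x \<partial>I11) = 0"
  shows "test_function (prim0 \<theta>)" "vder (prim0 \<theta>) = \<theta>"
proof -
  note s = test_function_smooth[OF t]
  have c: "continuous_on A \<theta>" for A by (rule smooth_continuous[OF s])
  have i: "\<theta> integrable_on {a..b}" for a b by (rule integrable_continuous_real[OF c])
  obtain K where K: "compact K" "K \<subseteq> {-1<..<1}" "\<And>x. x \<notin> K \<Longrightarrow> \<theta> x = 0"
    using t unfolding test_function_iff by blast
  obtain a b where ab: "-1 < a" "b < 1" "\<And>x. x \<in> K \<Longrightarrow> a \<le> x \<and> x \<le> b" "a < 1"
  proof (cases "K = {}")
    case True
    then show ?thesis using that[of 0 0] by auto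
  next
    case False
    obtain l u where "l \<in> K" "u \<in> K" "\<forall>x\<in>K. l \<le> x" "\<forall>x\<in>K. x \<le> u"
      using compact_attains_inf[OF K(1) False] compact_attains_sup[OF K(1) False] by blast
    then show ?thesis using K(2) by (intro that[of l u]) force+
  qed
  have lo: "\<theta> x = 0" if "x < a" for x
    by (rule K(3)) (use ab(3)[of x] that in auto)
  have hi: "\<theta> x = 0" if "x > b" for x
    by (rule K(3)) (use ab(3)[of x] that in auto)
  \<comment> \<open>For x < -1 the interval of integration is empty and the integral is 0, which is
    the right value to the left of the support.\<close>
  have Plo: "prim0 \<theta> x = 0" if "x < a" for x
  proof -
    have "integral {-1..x} \<theta> = integral {-1..x} (\<lambda>x. 0)"
      by (rule integral_cong) (use lo that in auto)
    then show ?thesis by (simp add: prim0_def)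
  qed
  have tot: "integral {-1..1} \<theta> = 0" using z integral_I11[OF c] by simp
  have Phi: "prim0 \<theta> x = 0" if "x > b" for x
  proof (cases "x \<ge> 1")
    case True
    have "integral {1..x} \<theta> = 0" 
      using integral_cong[of "{1..x}" \<theta> "\<lambda>x. 0", OF hi] ab(2) by simp
    moreover have "integral {-1..1} \<theta> + integral {1..x} \<theta> = integral {-1..x} \<theta>"
      by (rule Henstock_Kurzweil_Integration.integral_combine) (use True i in auto)
    ultimately show ?thesis using tot by (simp add: prim0_def)
  next
    case False
    show ?thesis
    proof (cases "x < -1")
      case True then show ?thesis using Plo ab by auto
    next
      case F: False
      have "integral {x..1} \<theta> = 0" 
        using integral_cong[of "{x..1}" \<theta> "\<lambda>x. 0", OF hi] that by simp
      moreover have "integral {-1..x} \<theta> + integral {x..1} \<theta> = integral {-1..1} \<theta>"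
        by (rule Henstock_Kurzweil_Integration.integral_combine) (use False F i in auto)
      ultimately show ?thesis using tot by (simp add: prim0_def)
    qed
  qed
  have d: "(prim0 \<theta> has_vector_derivative \<theta> x) (at x)" for x
  proof (cases "x < a")
    case True
    have "((\<lambda>y. 0) has_vector_derivative \<theta> x) (at x)" using lo[OF True] by simp
    then show ?thesis
      by (rule has_vector_derivative_transform_within_open[of _ _ _ "{..<a}"]) (use True Plo in auto)
  next
    case False
    then have x: "x > -1" using ab by simp
    have "((\<lambda>y. integral {-1..y} \<theta>) has_vector_derivative \<theta> x) (at x within {-1..x+1})"
      by (rule integral_has_vector_derivative[OF c]) (use x in auto)
    moreover have "at x within {-1..x+1} = at x" by (rule at_within_interior) (use x in auto)
    ultimately show ?thesis by (simp add: prim0_def[abs_def])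
  qed
  show "vder (prim0 \<theta>) = \<theta>" by (rule vder_eq[OF d])
  have "\<forall>x. x \<notin> {a..b} \<longrightarrow> prim0 \<theta> x = 0"
  proof (intro allI impI)
    fix x assume "x \<notin> {a..b}"
    then have "x < a \<or> x > b" by auto
    then show "prim0 \<theta> x = 0" using Plo Phi by blast
  qed
  moreover have "{a..b} \<subseteq> {-1<..<1}" using ab by auto
  ultimately show "test_function (prim0 \<theta>)"
    unfolding test_function_iff using smoothI[OF d s] compact_Icc by blast
qed

text \<open>If all test functions had mean zero in both real components, density would force the
  constant 1 to vanish. Rescaling then normalises the integral.\<close>

lemma test_function_unit_integral: "\<exists>\<beta>. test_function \<beta> \<and> (\<integral>x. \<beta> x \<partial>I11) = 1"
proof -
  have "\<exists>\<theta>. test_function \<theta> \<and> inner (cst 1) (abs_l2 \<theta>) \<noteq> 0"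
  proof (rule ccontr)
    assume "\<not> ?thesis"
    then have "cst 1 = 0" by (intro orthogonal_test_imp_0) blast
    then show False using inner_cst_cst[of 1 1] by simp
  qed
  then obtain \<theta> where t: "test_function \<theta>" "inner (cst 1) (abs_l2 \<theta>) \<noteq> 0" by blast
  let ?c = "\<integral>x. \<theta> x \<partial>I11"
  have "?c \<noteq> 0" using t(2) inner_cst[OF test_function_sq[OF t(1)], of 1] by (auto simp: inner_commute)
  then have "(\<integral>x. inverse ?c * \<theta> x \<partial>I11) = 1" by simp
  then show ?thesis using test_function_mult[OF smooth_const t(1)] by blast
qed

text \<open>F is approximated by test functions, whose means tend to 0 and are removed by a fixed
  bump of unit integral. Their primitives are test functions converging pointwise under a constant
  majorant, so the limit is exhibited directly and completeness of \<open>l2\<close> is not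
  invoked.\<close>

lemma exists_prim:
  assumes F: "inner F (cst 1) = 0" "inner F (cst \<i>) = 0"
  shows "\<exists>p\<in>H10. wderiv p = F"
proof -
  have "F \<in> closure test_l2" by (simp add: test_l2_dense)
  then obtain t where t: "\<And>n. t n \<in> test_l2" "t \<longlonglongrightarrow> F" unfolding closure_sequential by blast
  then have "\<forall>n. \<exists>\<theta>. test_function \<theta> \<and> t n = abs_l2 \<theta>" unfolding test_l2_def by blast
  then obtain \<theta> where \<theta>: "\<And>n. test_function (\<theta> n)" "\<And>n. t n = abs_l2 (\<theta> n)" by metis
  obtain \<beta> where \<beta>: "test_function \<beta>" "(\<integral>x. \<beta> x \<partial>I11) = 1" using test_function_unit_integral by blast
  define c where "c n = (\<integral>x. \<theta> n x \<partial>I11)" for n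
  \<comment> \<open>The complex integral is rebuilt from two real inner products, which makes its
    convergence visible.\<close>
  have cn: "c n = of_real (inner (t n) (cst 1)) + of_real (inner (t n) (cst \<i>)) * \<i>" for n
    unfolding \<theta>(2) inner_cst[OF test_function_sq[OF \<theta>(1)]] c_def[symmetric] by (simp add: complex_eq_iff)
  have "(\<lambda>n. of_real (inner (t n) (cst 1)) + of_real (inner (t n) (cst \<i>)) * \<i>) \<longlonglongrightarrow>
      complex_of_real (inner F (cst 1)) + complex_of_real (inner F (cst \<i>)) * \<i>"
    by (intro tendsto_intros t)
  then have c0: "c \<longlonglongrightarrow> 0" using F by (simp flip: cn)
  define \<xi> where "\<xi> n = (\<lambda>x. \<theta> n x + (- c n) * \<beta> x)" for n
  have t\<beta>: "test_function (\<lambda>x. (- c n) * \<beta> x)" for n by (rule test_function_mult[OF smooth_const \<beta>(1)])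
  have t\<xi>: "test_function (\<xi> n)" for n unfolding \<xi>_def by (rule test_function_add[OF \<theta>(1) t\<beta>])
  have int: "integrable I11 f" if "test_function f" for f
    using sq_integrable_prod[OF test_function_sq[OF that] smooth_sq[OF smooth_const[of 1]]] by simp
  have z\<xi>: "(\<integral>x. \<xi> n x \<partial>I11) = 0" for n
    unfolding \<xi>_def using int[OF \<theta>(1)] int[OF t\<beta>] int[OF \<beta>(1)] \<beta>(2) c_def by simp
  have "(\<lambda>n. abs_l2 (\<lambda>x. (- c n) * \<beta> x)) \<longlonglongrightarrow> 0"
  proof (rule tendsto_norm_zero_cancel)
    have "norm (abs_l2 (\<lambda>x. (- c n) * \<beta> x)) = cmod (c n) * norm (abs_l2 \<beta>)" for n
      using norm_abs_l2[OF test_function_sq[OF t\<beta>], of n] norm_abs_l2[OF test_function_sq[OF \<beta>(1)]]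
      by (simp add: norm_mult power_mult_distrib real_sqrt_mult)
    moreover have "(\<lambda>n. cmod (c n) * norm (abs_l2 \<beta>)) \<longlonglongrightarrow> cmod 0 * norm (abs_l2 \<beta>)"
      by (intro tendsto_intros c0)
    ultimately show "(\<lambda>n. norm (abs_l2 (\<lambda>x. (- c n) * \<beta> x))) \<longlonglongrightarrow> 0" by simp
  qed
  from tendsto_add[OF t(2) this] have "(\<lambda>n. t n + abs_l2 (\<lambda>x. (- c n) * \<beta> x)) \<longlonglongrightarrow> F" by simp
  moreover have "abs_l2 (\<xi> n) = t n + abs_l2 (\<lambda>x. (- c n) * \<beta> x)" for n
    unfolding \<theta>(2) \<xi>_def by (rule abs_l2_add[OF test_function_sq[OF \<theta>(1)] test_function_sq[OF t\<beta>]])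
  ultimately have lim\<xi>: "(\<lambda>n. abs_l2 (\<xi> n)) \<longlonglongrightarrow> F" by (simp only:)
  have c\<xi>: "continuous_on A (\<xi> n)" for n A by (rule smooth_continuous[OF test_function_smooth[OF t\<xi>]])
  have conv: "convergent (\<lambda>n. prim0 (\<xi> n) x)" if x: "x \<in> {-1<..<1}" for x
  proof (rule Cauchy_convergent)
    have "Cauchy (\<lambda>n. abs_l2 (\<xi> n))" using lim\<xi> by (rule LIMSEQ_imp_Cauchy)
    show "Cauchy (\<lambda>n. prim0 (\<xi> n) x)"
    proof (rule metric_CauchyI)
      fix e :: real assume "e > 0"
      then obtain M where M: "\<And>m n. m \<ge> M \<Longrightarrow> n \<ge> M \<Longrightarrow> dist (abs_l2 (\<xi> m)) (abs_l2 (\<xi> n)) < e / 2"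
        using metric_CauchyD[OF \<open>Cauchy (\<lambda>n. abs_l2 (\<xi> n))\<close>, of "e / 2"] by auto
      have "dist (prim0 (\<xi> m) x) (prim0 (\<xi> n) x) < e" if "m \<ge> M" "n \<ge> M" for m n
      proof -
        have "prim0 (\<xi> m) x - prim0 (\<xi> n) x = prim0 (\<lambda>x. \<xi> m x - \<xi> n x) x"
          unfolding prim0_def
          by (rule integral_diff[symmetric]) (intro integrable_continuous_real c\<xi>)+
        moreover have "cmod (prim0 (\<lambda>x. \<xi> m x - \<xi> n x) x) \<le> 2 * norm (abs_l2 (\<lambda>x. \<xi> m x - \<xi> n x))"
          by (intro prim0_bound continuous_intros c\<xi> x)
        moreover have "abs_l2 (\<lambda>x. \<xi> m x - \<xi> n x) = abs_l2 (\<xi> m) - abs_l2 (\<xi> n)"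
          by (intro abs_l2_diff test_function_sq t\<xi>)
        ultimately show ?thesis using M[OF that] by (simp add: dist_norm)
      qed
      then show "\<exists>M. \<forall>m\<ge>M. \<forall>n\<ge>M. dist (prim0 (\<xi> m) x) (prim0 (\<xi> n) x) < e" by blast
    qed
  qed
  obtain B where B: "\<And>n. norm (abs_l2 (\<xi> n)) \<le> B"
    using convergent_imp_Bseq[OF convergentI[OF lim\<xi>]] unfolding Bseq_def by blast
  note tP = test_function_prim0[OF t\<xi> z\<xi>]
  define v where "v x = lim (\<lambda>n. prim0 (\<xi> n) x)" for x
  have mP: "prim0 (\<xi> n) \<in> borel_measurable I11" for n
    by (rule continuous_measurable_I11[OF smooth_continuous[OF test_function_smooth[OF tP(1)]]])
  have "(\<lambda>n. abs_l2 (prim0 (\<xi> n))) \<longlonglongrightarrow> abs_l2 v"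
  proof (rule l2_dominated(3)[where w = "\<lambda>x. 2 * B"])
    show "v \<in> borel_measurable I11" unfolding v_def[abs_def] by (rule borel_measurable_lim_metric[OF mP])
    show "AE x in I11. (\<lambda>n. prim0 (\<xi> n) x) \<longlonglongrightarrow> v x"
      by (rule AE_I2) (use conv in \<open>auto simp: v_def convergent_LIMSEQ_iff\<close>)
    show "AE x in I11. cmod (prim0 (\<xi> n) x) \<le> 2 * B" for n
    proof (rule AE_I2)
      fix x assume "x \<in> space I11"
      then show "cmod (prim0 (\<xi> n) x) \<le> 2 * B"
        using prim0_bound[OF c\<xi>, of x n] B[of n] by auto
    qed
  qed (auto simp: mP)
  from H10I[OF tP(1) this, of F] lim\<xi> show ?thesis unfolding tP(2) by blast
qed

text \<open>The primitive, vanishing at both ends, of the mean-free part of F. The choice is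
  harmless, since \<open>poincare\<close> makes the primitive unique.\<close>

definition prim :: "l2 \<Rightarrow> l2" where
  "prim F = (SOME p. p \<in> H10 \<and> wderiv p = F - mean F)"

lemma mean_diff_mean: "mean (F - mean F) = 0"
proof -
  interpret m: bounded_linear mean by (rule bounded_linear_mean)
  obtain z where "mean F = cst z" using mean_is_cst by blast
  then show ?thesis by (simp add: m.diff mean_cst)
qed

lemma prim_H10: "prim F \<in> H10" and wderiv_prim: "wderiv (prim F) = F - mean F"
proof -
  have "inner (F - mean F) (cst z) = 0" for z
  proof -
    have "inner (F - mean F) (cst z) = inner (F - mean F) (mean (cst z))" by (simp add: mean_cst)
    also have "\<dots> = 0" unfolding inner_mean[symmetric] mean_diff_mean by simp
    finally show ?thesis .
  qed
  then have "\<exists>p. p \<in> H10 \<and> wderiv p = F - mean F" using exists_prim[of "F - mean F"] by blast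
  from someI_ex[OF this] show "prim F \<in> H10" "wderiv (prim F) = F - mean F" unfolding prim_def by auto
qed

lemma H10_eqI:
  assumes "f \<in> H10" "g \<in> H10" "wderiv f = wderiv g" shows "f = g"
proof -
  have "f - g \<in> H10" using assms by (intro subspace_diff[OF subspace_H10])
  from poincare[OF this] have "norm (f - g) \<le> 0"
    using wderiv_diff[OF H10_H1[OF assms(1)] H10_H1[OF assms(2)]] assms(3) by simp
  then show ?thesis by simp
qed

lemma prim_unique: "p \<in> H10 \<Longrightarrow> wderiv p = F - mean F \<Longrightarrow> prim F = p"
  by (rule H10_eqI) (auto simp: prim_H10 wderiv_prim)

text \<open>Linearity follows from uniqueness, boundedness from the Poincare inequality.\<close>

lemma bounded_linear_prim: "bounded_linear prim"
proof -
  interpret m: bounded_linear mean by (rule bounded_linear_mean)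
  obtain K where K: "\<And>F. norm (mean F) \<le> norm F * K" using m.bounded by blast
  show ?thesis
  proof (rule bounded_linear_intro[where K = "2 * (1 + K)"])
    fix F G r
    show "prim (F + G) = prim F + prim G"
      by (rule prim_unique[OF subspace_add[OF subspace_H10 prim_H10 prim_H10]])
        (simp add: wderiv_add H10_H1 prim_H10 wderiv_prim m.add)
    show "prim (r *\<^sub>R F) = r *\<^sub>R prim F"
      by (rule prim_unique[OF subspace_scale[OF subspace_H10 prim_H10]])
        (simp add: wderiv_scaleR H10_H1 prim_H10 wderiv_prim m.scaleR scaleR_diff_right)
    have "norm (prim F) \<le> 2 * norm (F - mean F)"
      using poincare[OF prim_H10[of F]] by (simp add: wderiv_prim)
    also have "\<dots> \<le> norm F * (2 * (1 + K))"
      using norm_triangle_ineq4[of F "mean F"] K[of F] by (simp add: algebra_simps)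
    finally show "norm (prim F) \<le> norm F * (2 * (1 + K))" .
  qed
qed

text \<open>Testing f' = 0 against the primitive of f - \<open>mean f\<close> shows that f is
  orthogonal to f - \<open>mean f\<close>.\<close>

lemma wderiv_zero_imp_mean:
  assumes f: "f \<in> H1" "wderiv f = 0" shows "f = mean f"
proof -
  let ?F = "f - mean f"
  have "inner f (?F - mean ?F) = 0"
    using inner_wderiv[OF f(1) prim_H10, of ?F] f(2) by (simp add: wderiv_prim)
  then have "inner f ?F = 0" "inner (mean f) ?F = 0"
    by (simp_all add: mean_diff_mean inner_mean)
  then have "inner ?F ?F = 0" by (simp add: inner_diff_left)
  then show ?thesis by simp
qed

lemma cst_mult_id:
  shows "mult_l2 (\<lambda>x. x) (cst z) = abs_l2 (\<lambda>x. of_real x * z)"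
  unfolding cst_def by (rule mult_l2_smooth[OF smooth_id smooth_const])

text \<open>Testing against the affine functions detects the boundary values.\<close>

lemma H10_char:
  assumes f: "f \<in> H1" and c: "\<And>z. inner (wderiv f) (cst z) = 0"
    and x: "\<And>z. inner f (cst z) = - inner (wderiv f) (mult_l2 (\<lambda>x. x) (cst z))"
  shows "f \<in> H10"
proof -
  let ?p = "prim (wderiv f)"
  have w: "wderiv ?p = wderiv f" using c by (simp add: wderiv_prim mean_def)
  have fp: "f - ?p \<in> H1" by (intro subspace_diff[OF subspace_H1] f H10_H1[OF prim_H10])
  have "wderiv (f - ?p) = 0" using w by (simp add: wderiv_diff f H10_H1 prim_H10)
  then obtain z where z: "f - ?p = cst z" using wderiv_zero_imp_mean[OF fp] mean_is_cst[of "f - ?p"] by auto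
  have X: "wderiv (mult_l2 (\<lambda>x. x) (cst z)) = cst z"
    by (simp add: H1_mult(2)[OF smooth_id cst_H1] vder_id mult_l2_const wderiv_cst
        linear_simps(3)[OF bounded_linear_mult_l2[OF Linfty_smooth[OF smooth_id]]])
  have "inner ?p (cst z) = - inner (wderiv f) (mult_l2 (\<lambda>x. x) (cst z))"
    using inner_wderiv[OF H1_mult(1)[OF smooth_id cst_H1] prim_H10, of z "wderiv f"]
    by (simp add: X w inner_commute)
  with x[of z] have "inner (f - ?p) (cst z) = 0" by (simp add: inner_diff_left)
  then have "f - ?p = 0" unfolding z by simp
  then show ?thesis using prim_H10[of "wderiv f"] by simp
qed

text \<open>The fundamental theorem of calculus for u and for x u(x) gives the two moment conditions
  of \<open>H10_char\<close>, so no approximating sequence has to be built.\<close>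

lemma H10_smooth:
  assumes u: "smooth u" and b: "u 1 = 0" "u (-1) = 0"
  shows "abs_l2 u \<in> H10"
proof (rule H10_char)
  note w = has_weak_derivative_smooth[OF u]
  have wu: "wderiv (abs_l2 u) = abs_l2 (vder u)" by (rule wderiv_eqI[OF w])
  show "abs_l2 u \<in> H1" by (rule H1I[OF w])
  show "inner (wderiv (abs_l2 u)) (cst z) = 0" for z
    by (simp add: wu inner_cst smooth_sq smooth_vder u integral_vder b)
  show "inner (abs_l2 u) (cst z) = - inner (wderiv (abs_l2 u)) (mult_l2 (\<lambda>x. x) (cst z))" for z
  proof -
    have sx: "smooth (\<lambda>x. complex_of_real x)" by (rule smooth_of_real[OF smooth_id])
    have vx: "vder (\<lambda>x. complex_of_real x) = (\<lambda>x. 1)"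
      using vder_of_real[OF smooth_id] by (simp add: vder_id)
    have s1: "sq_integrable (\<lambda>x. of_real x * vder u x)"
      by (intro smooth_sq smooth_mult sx smooth_vder u)
    have "0 = (\<integral>x. vder (\<lambda>x. of_real x * u x) x \<partial>I11)"
      by (subst integral_vder) (auto intro!: smooth_mult sx u simp: b)
    also have "\<dots> = (\<integral>x. of_real x * vder u x + u x \<partial>I11)"
      by (simp add: vder_mult[OF sx u] vx)
    finally have "inner (abs_l2 (\<lambda>x. of_real x * vder u x + u x)) (cst z) = 0"
      by (simp add: inner_cst sq_integrable_add s1 smooth_sq u)
    then have "inner (abs_l2 (\<lambda>x. of_real x * vder u x)) (cst z) + inner (abs_l2 u) (cst z) = 0"
      by (simp add: abs_l2_add s1 smooth_sq u inner_add_left)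
    moreover have "inner (wderiv (abs_l2 u)) (mult_l2 (\<lambda>x. x) (cst z)) = inner (abs_l2 (\<lambda>x. of_real x * vder u x)) (cst z)"
      unfolding wu inner_mult_commute[OF Linfty_smooth[OF smooth_id], symmetric]
      by (simp add: mult_l2_smooth[OF smooth_id smooth_vder[OF u]])
    ultimately show ?thesis by linarith
  qed
qed

text \<open>T is only in \<open>H1\<close>, hence not a limit of test functions. The moment
  conditions of \<open>H10_char\<close> for q T are instead read off from T tested against smooth
  functions vanishing at the ends.\<close>

lemma H10_mult_boundary:
  assumes q: "smooth q" and b: "q 1 = 0" "q (-1) = 0" and T: "T \<in> H1"
  shows "mult_l2 q T \<in> H10"
proof -
  have key: "inner (wderiv T) (mult_l2 m (cst z)) = - inner T (mult_l2 (vder m) (cst z))"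
    if m: "smooth m" "m 1 = 0" "m (-1) = 0" for m z
  proof -
    have "mult_l2 m (cst z) \<in> H10"
      unfolding cst_def mult_l2_smooth[OF m(1) smooth_const]
      by (rule H10_smooth) (use m in \<open>auto intro!: smooth_mult smooth_of_real\<close>)
    from inner_wderiv[OF T this] show ?thesis
      by (simp add: H1_mult(2)[OF m(1) cst_H1] wderiv_cst
          linear_simps(3)[OF bounded_linear_mult_l2[OF Linfty_smooth[OF m(1)]]])
  qed
  note L = Linfty_smooth[OF q] Linfty_smooth[OF smooth_vder[OF q]] Linfty_smooth[OF smooth_id]
  show ?thesis
  proof (rule H10_char)
    show "mult_l2 q T \<in> H1" by (rule H1_mult(1)[OF q T])
    show "inner (wderiv (mult_l2 q T)) (cst z) = 0" for z
      using key[OF q b, of z] by (simp add: H1_mult(2)[OF q T] inner_add_left inner_mult_commute L)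
    show "inner (mult_l2 q T) (cst z) = - inner (wderiv (mult_l2 q T)) (mult_l2 (\<lambda>x. x) (cst z))" for z
    proof -
      \<comment> \<open>The second moment condition for q T is the identity for T tested with x q(x)
        times a constant.\<close>
      have sxq: "smooth (\<lambda>x. x * q x)" by (intro smooth_mult smooth_id q)
      have v: "vder (\<lambda>x. x * q x) = (\<lambda>x. x * vder q x + q x)"
        by (rule vder_eq) (use has_vector_derivative_mult[OF has_vector_derivative_id smooth_deriv[OF q]] in simp)
      have "inner (wderiv T) (mult_l2 (\<lambda>x. x * q x) (cst z)) = - inner T (mult_l2 (\<lambda>x. x * vder q x + q x) (cst z))"
        using key[OF sxq, of z] b by (simp add: v)
      then show ?thesis
        by (simp add: H1_mult(2)[OF q T] inner_add_left inner_add_right inner_mult_commute L mult_l2_mult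
            mult_l2_add_left Linfty_mult mult.commute)
    qed
  qed
qed

text \<open>This integrates q (|T|^2)' by parts. Here the boundary term is removed by q; in the
  following variant for \<open>H10\<close> it is removed by T, and q is free at the ends.\<close>

lemma inner_mult_wderiv:
  assumes q: "smooth q" and b: "q 1 = 0" "q (-1) = 0" and T: "T \<in> H1"
  shows "2 * inner (mult_l2 q (wderiv T)) T = - wsq (vder q) T"
proof -
  have "inner (wderiv T) (mult_l2 q T) = - inner T (mult_l2 (vder q) T + mult_l2 q (wderiv T))"
    using inner_wderiv[OF T H10_mult_boundary[OF q b T]] by (simp add: H1_mult(2)[OF q T])
  then show ?thesis
    using inner_mult_commute[OF Linfty_smooth[OF q], of "wderiv T" T]
      inner_commute[of T "mult_l2 (vder q) T"] inner_commute[of T "mult_l2 q (wderiv T)"]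
    unfolding inner_add_right by linarith
qed

lemma inner_mult_wderiv_H10:
  assumes q: "smooth q" and T: "T \<in> H10"
  shows "2 * inner (mult_l2 q (wderiv T)) T = - wsq (vder q) T"
proof -
  have "inner (wderiv T) (mult_l2 q T) = - inner T (mult_l2 (vder q) T + mult_l2 q (wderiv T))"
    using inner_wderiv[OF H10_H1[OF T] H10_mult[OF q T]] by (simp add: H1_mult(2)[OF q H10_H1[OF T]])
  then show ?thesis
    using inner_mult_commute[OF Linfty_smooth[OF q], of "wderiv T" T]
      inner_commute[of T "mult_l2 (vder q) T"] inner_commute[of T "mult_l2 q (wderiv T)"]
    unfolding inner_add_right by linarith
qed

subsection \<open>The static problem\<close>

text \<open>The primitive of x z vanishing at both ends is (x^2 - 1) z / 2, whose mean over the
  interval is -z/3.\<close>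

lemma mean_prim_id: "mean (prim (mult_l2 (\<lambda>x. x) (cst z))) = - (1 / 3) *\<^sub>R cst z"
proof -
  let ?u = "\<lambda>x. complex_of_real (x * x - 1) * (z / 2)"
  have d: "((\<lambda>x. complex_of_real (p x) * y) has_vector_derivative of_real p' * y) (at x)"
    if "(p has_real_derivative p') (at x)" for p p' y x
    using has_vector_derivative_mult_left[OF has_vector_derivative_of_real[OF that], of y] .
  have su: "smooth ?u" by (intro smooth_mult smooth_of_real smooth_diff smooth_const smooth_id)
  have sx: "smooth (\<lambda>x. complex_of_real x * z)" by (intro smooth_mult smooth_of_real smooth_const smooth_id)
  have vu: "vder ?u = (\<lambda>x. of_real x * z)"
  proof (rule vder_eq)
    fix x
    have "((\<lambda>x. x * x - 1) has_real_derivative 2 * x) (at x)" by (auto intro!: derivative_eq_intros)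
    from d[OF this, of "z / 2"] show "(?u has_vector_derivative of_real x * z) (at x)" by simp
  qed
  have iu: "(\<integral>x. ?u x \<partial>I11) = - 2 / 3 * z"
  proof -
    have "((\<lambda>x. x * x * x / 3 - x) has_real_derivative x * x - 1) (at x)" for x :: real
      by (auto intro!: derivative_eq_intros simp: algebra_simps)
    from integral_FTC_I11[OF d[OF this, of "z / 2"] su] show ?thesis by (simp add: field_simps)
  qed
  have ix: "(\<integral>x. of_real x * z \<partial>I11) = 0"
  proof -
    have "((\<lambda>x. x * x / 2) has_real_derivative x) (at x)" for x :: real
      by (auto intro!: derivative_eq_intros)
    from integral_FTC_I11[OF d[OF this, of z] sx] show ?thesis by simp
  qed
  have "prim (mult_l2 (\<lambda>x. x) (cst z)) = abs_l2 ?u"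
  proof (rule prim_unique)
    show "abs_l2 ?u \<in> H10" by (rule H10_smooth[OF su]) auto
    show "wderiv (abs_l2 ?u) = mult_l2 (\<lambda>x. x) (cst z) - mean (mult_l2 (\<lambda>x. x) (cst z))"
      using wderiv_eqI[OF has_weak_derivative_smooth[OF su]]
      unfolding vu cst_mult_id mean_abs_l2[OF smooth_sq[OF sx]] ix by (simp only: div_0 cst_0 diff_0_right)
  qed
  then have "mean (prim (mult_l2 (\<lambda>x. x) (cst z))) = cst ((- 2 / 3 * z) / 2)"
    by (simp only: mean_abs_l2[OF smooth_sq[OF su]] iu)
  also have "(- 2 / 3 * z) / 2 = of_real (- (1 / 3)) * z" by simp
  finally show ?thesis unfolding cst_scaleR by simp
qed

text \<open>The weak static system integrates explicitly. Varying w forces k1 (p' + r) - F1 to be a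
  constant C, and varying \<phi> forces k2 r' - F2 - x C to be constant. Conversely these two
  relations give the identity, since <\<phi>', x C> = -<\<phi>, C>. The maps Zp, Zr return the
  solution (p, r), while Wp, Wr return its strains p' + r and r'.\<close>

lemma static_problem:
  assumes k: "k1 > 0" "k2 > 0"
  obtains Zp Zr Wp Wr :: "l2 \<times> l2 \<Rightarrow> l2" where
    "bounded_linear Zp" "bounded_linear Zr" "bounded_linear Wp" "bounded_linear Wr"
    "\<And>F. Zp F \<in> H10" "\<And>F. Zr F \<in> H10" "\<And>F. wderiv (Zp F) + Zr F = Wp F" "\<And>F. wderiv (Zr F) = Wr F"
    "\<And>F1 F2 w \<phi>. w \<in> H10 \<Longrightarrow> \<phi> \<in> H10 \<Longrightarrow>
      k1 * inner (wderiv w + \<phi>) (Wp (F1, F2)) + k2 * inner (wderiv \<phi>) (Wr (F1, F2))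
      = inner (wderiv w + \<phi>) F1 + inner (wderiv \<phi>) F2"
proof -
  let ?X = "mult_l2 (\<lambda>x. x)"
  have LX: "Linfty (\<lambda>x. x)" by (rule Linfty_smooth[OF smooth_id])
  interpret m: bounded_linear mean by (rule bounded_linear_mean)
  interpret p: bounded_linear prim by (rule bounded_linear_prim)
  interpret x: bounded_linear ?X by (rule bounded_linear_mult_l2[OF LX])
  \<comment> \<open>C is fixed by the requirement that p vanish at both ends: C = k1 mean r - mean
    F1. Since r is the primitive of F2 + x C over k2 and the primitive of x C has mean -C/3, this
    reads (1 + k1/(3 k2)) C = (k1/k2) mean (prim F2) - mean F1.\<close>
  define c where "c = 1 / (1 + k1 / (3 * k2))"
  define C where "C F = c *\<^sub>R ((k1 / k2) *\<^sub>R mean (prim (snd F)) - mean (fst F))" for F :: "l2 \<times> l2"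
  define Zr where "Zr F = (1 / k2) *\<^sub>R prim (snd F + ?X (C F))" for F :: "l2 \<times> l2"
  define Zp where "Zp F = prim ((1 / k1) *\<^sub>R fst F - Zr F)" for F :: "l2 \<times> l2"
  define Wp where "Wp F = (1 / k1) *\<^sub>R (fst F + C F)" for F :: "l2 \<times> l2"
  define Wr where "Wr F = (1 / k2) *\<^sub>R (snd F + ?X (C F) - mean (snd F + ?X (C F)))" for F :: "l2 \<times> l2"
  note bl = bounded_linear_compose[OF bounded_linear_scaleR_right]
    bounded_linear_compose[OF m.bounded_linear_axioms] bounded_linear_compose[OF p.bounded_linear_axioms]
    bounded_linear_compose[OF x.bounded_linear_axioms] bounded_linear_add bounded_linear_sub
    bounded_linear_fst bounded_linear_snd
  have bC: "bounded_linear C" unfolding C_def[abs_def] by (intro bl)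
  have bZr: "bounded_linear Zr" unfolding Zr_def[abs_def] by (intro bl bC)
  have bZp: "bounded_linear Zp" unfolding Zp_def[abs_def] by (intro bl bC bZr)
  have bWp: "bounded_linear Wp" unfolding Wp_def[abs_def] by (intro bl bC)
  have bWr: "bounded_linear Wr" unfolding Wr_def[abs_def] by (intro bl bC)
  have zr: "Zr F \<in> H10" for F unfolding Zr_def by (intro subspace_scale[OF subspace_H10] prim_H10)
  have zp: "Zp F \<in> H10" for F unfolding Zp_def by (rule prim_H10)
  have wr: "wderiv (Zr F) = Wr F" for F
    unfolding Zr_def Wr_def by (simp add: wderiv_scaleR H10_H1 prim_H10 wderiv_prim)
  have Ccst: "\<exists>z. C F = cst z" for F
  proof -
    obtain y z where "mean (prim (snd F)) = cst y" "mean (fst F) = cst z"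
      using mean_is_cst[of "prim (snd F)"] mean_is_cst[of "fst F"] by blast
    then have "C F = cst (of_real c * (of_real (k1 / k2) * y + of_real (-1) * z))"
      unfolding C_def cst_scaleR cst_add by simp
    then show ?thesis by blast
  qed
  have mC: "mean (C F) = C F" for F using Ccst[of F] mean_cst by auto
  have eqC: "C F = k1 *\<^sub>R mean (Zr F) - mean (fst F)" for F
  proof -
    obtain z where z: "C F = cst z" using Ccst by blast
    define A where "A = (k1 / (3 * k2)) *\<^sub>R C F"
    have "k1 *\<^sub>R mean (Zr F) = (k1 / k2) *\<^sub>R (mean (prim (snd F)) - (1 / 3) *\<^sub>R C F)"
      unfolding Zr_def z by (simp add: m.scaleR m.add p.scaleR p.add mean_prim_id)
    then have 1: "k1 *\<^sub>R mean (Zr F) = (k1 / k2) *\<^sub>R mean (prim (snd F)) - A"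
      by (simp add: A_def scaleR_diff_right mult.commute)
    have "(1 + k1 / (3 * k2)) *\<^sub>R C F = (k1 / k2) *\<^sub>R mean (prim (snd F)) - mean (fst F)"
    proof -
      have "(1 + k1 / (3 * k2)) * c = 1" using k by (simp add: c_def add_pos_pos pos_add_strict divide_simps)
      then show ?thesis unfolding C_def by (simp del: times_divide_eq_right)
    qed
    then have "C F + A = (k1 / k2) *\<^sub>R mean (prim (snd F)) - mean (fst F)"
      by (simp add: A_def scaleR_add_left)
    then have "C F = (k1 / k2) *\<^sub>R mean (prim (snd F)) - mean (fst F) - A" by (simp add: eq_diff_eq)
    then show ?thesis unfolding 1 by (simp add: algebra_simps)
  qed
  have wp: "wderiv (Zp F) + Zr F = Wp F" for F
  proof -
    have "wderiv (Zp F) + Zr F = (1 / k1) *\<^sub>R fst F - mean ((1 / k1) *\<^sub>R fst F - Zr F)"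
      unfolding Zp_def wderiv_prim by simp
    also have "\<dots> = (1 / k1) *\<^sub>R (fst F + (k1 *\<^sub>R mean (Zr F) - mean (fst F)))"
      using k by (simp add: m.diff m.scaleR scaleR_add_right scaleR_diff_right)
    finally show ?thesis unfolding eqC[symmetric] Wp_def .
  qed
  have var: "k1 * inner (wderiv w + \<phi>) (Wp (F1, F2)) + k2 * inner (wderiv \<phi>) (Wr (F1, F2))
      = inner (wderiv w + \<phi>) F1 + inner (wderiv \<phi>) F2" if w: "w \<in> H10" and \<phi>: "\<phi> \<in> H10" for F1 F2 w \<phi>
  proof -
    obtain z where z: "C (F1, F2) = cst z" using Ccst by blast
    have X: "wderiv (?X (cst z)) = cst z"
      by (simp add: H1_mult(2)[OF smooth_id cst_H1] vder_id mult_l2_const wderiv_cst x.zero)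
    have "inner (wderiv \<phi>) (?X (cst z)) = - inner \<phi> (cst z)"
      using inner_wderiv[OF H1_mult(1)[OF smooth_id cst_H1] \<phi>, of z] by (simp add: X inner_commute)
    then show ?thesis
      using k unfolding Wp_def Wr_def
      by (simp add: z inner_add_left inner_add_right inner_diff_right inner_wderiv_cst inner_wderiv_mean w \<phi>)
  qed
  show ?thesis by (rule that[OF bZp bZr bWp bWr zp zr wp wr var])
qed

section \<open>Weights\<close>

definition eta :: "real \<Rightarrow> real" where "eta x = bump (1 * x + (- 1 / 8)) * bump ((- 1) * x + 7 / 8)"
text \<open>The square makes zeta'^2 <= const zeta, so terms with a differentiated weight are
  controlled by the same weight. It also lets zeta be split as eta times eta between two
  factors.\<close>

definition zeta :: "real \<Rightarrow> real" where "zeta x = eta x * eta x"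
text \<open>Built for a one-sided Poincare inequality up to the endpoint 1: it vanishes left of 1/8,
  dominates \<open>eta\<close>, and is at most its own derivative for x < 1, since exp(-1/y) <=
  exp(-1/y)/y^2 for 0 < y < 1.\<close>

definition rampw :: "real \<Rightarrow> real" where "rampw x = bump (1 * x + (- 1 / 8))"

lemma smooth_eta: "smooth eta" and smooth_zeta: "smooth zeta" and smooth_rampw: "smooth rampw"
proof -
  show e: "smooth eta" unfolding eta_def[abs_def] by (intro smooth_mult smooth_affine smooth_bump)
  show "smooth zeta" unfolding zeta_def[abs_def] by (intro smooth_mult e)
  show "smooth rampw" unfolding rampw_def[abs_def] by (intro smooth_affine smooth_bump)
qed

lemma bump_affine_deriv:
  "((\<lambda>x. bump (c * x + d)) has_vector_derivative c * vder bump (c * x + d)) (at x)"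
proof -
  have "((\<lambda>x. c * x + d) has_vector_derivative c) (at x)"
    by (auto simp flip: has_real_derivative_iff_has_vector_derivative intro!: derivative_eq_intros)
  from vector_diff_chain_at[OF this smooth_deriv[OF smooth_bump]] show ?thesis by (simp add: o_def)
qed

lemma eta_props:
  "0 \<le> eta x" "eta x \<le> 1" "x \<notin> {1 / 8<..<7 / 8} \<Longrightarrow> eta x = 0" "x \<notin> {1 / 8<..<7 / 8} \<Longrightarrow> vder eta x = 0"
  "vder zeta x = 2 * (eta x * vder eta x)"
proof -
  show "0 \<le> eta x" "eta x \<le> 1" using bump_nonneg bump_le_1 by (auto simp: eta_def mult_le_one)
  show "x \<notin> {1 / 8<..<7 / 8} \<Longrightarrow> eta x = 0" by (auto simp: eta_def bump_def)
  have "vder eta x = bump (1 * x + (- 1 / 8)) * ((-1) * vder bump ((-1) * x + 7 / 8))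
      + (1 * vder bump (1 * x + (- 1 / 8))) * bump ((-1) * x + 7 / 8)"
    unfolding eta_def[abs_def] vder_def
    by (rule vector_derivative_at[OF has_vector_derivative_mult[OF bump_affine_deriv bump_affine_deriv, unfolded vder_def]])
  then show "x \<notin> {1 / 8<..<7 / 8} \<Longrightarrow> vder eta x = 0" by (auto simp: vder_bump bump_def)
  show "vder zeta x = 2 * (eta x * vder eta x)"
    unfolding zeta_def[abs_def]
    using vder_eq[OF has_vector_derivative_mult[OF smooth_deriv[OF smooth_eta] smooth_deriv[OF smooth_eta]]]
    by (simp add: fun_eq_iff)
qed

lemma zeta_props: "0 \<le> zeta x" "zeta x \<le> eta x" "zeta x \<le> 1" "(zeta x)\<^sup>2 \<le> zeta x"
proof -
  show 0: "0 \<le> zeta x" by (simp add: zeta_def)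
  show 1: "zeta x \<le> eta x" unfolding zeta_def using eta_props(1,2)[of x] by (intro mult_left_le) auto
  then show 2: "zeta x \<le> 1" using eta_props(2)[of x] by linarith
  show "(zeta x)\<^sup>2 \<le> zeta x" unfolding power2_eq_square using 0 2 by (intro mult_left_le) auto
qed

lemma rampw_props:
  "0 \<le> rampw x" "rampw x \<le> 1" "x \<le> 1 / 8 \<Longrightarrow> rampw x = 0" "eta x \<le> rampw x" "x < 1 \<Longrightarrow> rampw x \<le> vder rampw x"
proof -
  show "0 \<le> rampw x" "rampw x \<le> 1" using bump_nonneg bump_le_1 by (auto simp: rampw_def)
  show "x \<le> 1 / 8 \<Longrightarrow> rampw x = 0" by (simp add: rampw_def bump_def)
  show "eta x \<le> rampw x"
    unfolding eta_def rampw_def using bump_nonneg bump_le_1 by (intro mult_left_le) auto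
  assume x: "x < 1"
  have v: "vder rampw x = vder bump (x - 1 / 8)"
    unfolding rampw_def[abs_def] using vder_eq[OF bump_affine_deriv, of 1 "- 1 / 8"] by (simp add: fun_eq_iff)
  show "rampw x \<le> vder rampw x"
  proof (cases "x > 1 / 8")
    case True
    define y where "y = x - 1 / 8"
    have y: "0 < y" "y < 1" using True x by (auto simp: y_def)
    then have "y\<^sup>2 \<le> 1" by (simp add: abs_square_le_1)
    then have "exp (- 1 / y) * y\<^sup>2 \<le> exp (- 1 / y) * 1" by (intro mult_left_mono) auto
    then have "exp (- 1 / y) \<le> exp (- 1 / y) / y\<^sup>2" using y by (simp add: pos_le_divide_eq)
    moreover have "rampw x = bump y" "vder rampw x = vder bump y" unfolding v by (simp_all add: rampw_def y_def)
    ultimately show ?thesis using y by (simp add: vder_bump bump_def)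
  next
    case False
    then show ?thesis unfolding v by (simp add: rampw_def bump_def vder_bump)
  qed
qed

lemma strip_bound:
  assumes c: "continuous_on UNIV (m :: real \<Rightarrow> real)" and z: "\<And>x. x \<notin> {1 / 8<..<7 / 8} \<Longrightarrow> m x = 0"
    and D: "\<And>x. -1 < x \<Longrightarrow> x < 1 \<Longrightarrow> 0 \<le> D x" and c0: "c0 > 0" and Dc: "\<And>x. 1 / 8 \<le> x \<Longrightarrow> x \<le> 7 / 8 \<Longrightarrow> c0 \<le> D x"
  obtains C where "C \<ge> 0" "\<And>x. -1 < x \<Longrightarrow> x < 1 \<Longrightarrow> (m x)\<^sup>2 \<le> C * D x"
proof -
  obtain K where K: "\<And>x. x \<in> {-1..1} \<Longrightarrow> norm (m x) \<le> K" using continuous_bounded_I11[OF c] by blast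
  have "(m x)\<^sup>2 \<le> (K\<^sup>2 / c0) * D x" if x: "-1 < x" "x < 1" for x
  proof (cases "x \<in> {1 / 8<..<7 / 8}")
    case True
    have "\<bar>m x\<bar>\<^sup>2 \<le> K\<^sup>2" using K[of x] x by (intro power_mono) auto
    also have "\<dots> \<le> K\<^sup>2 * (D x / c0)"
    proof -
      have "1 \<le> D x / c0" using Dc[of x] c0 True by (simp add: pos_le_divide_eq)
      then have "K\<^sup>2 * 1 \<le> K\<^sup>2 * (D x / c0)" by (intro mult_left_mono) auto
      then show ?thesis by simp
    qed
    finally show ?thesis by simp
  next
    case False
    then show ?thesis using z[OF False] D[OF x] c0 by simp
  qed
  then show ?thesis using that[of "K\<^sup>2 / c0"] c0 by simp
qed

lemma zeta_deriv_bound: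
  obtains C where "C \<ge> 0" "\<And>x. -1 < x \<Longrightarrow> x < 1 \<Longrightarrow> (vder zeta x)\<^sup>2 \<le> C * zeta x"
proof -
  obtain K where K: "\<And>x. x \<in> {-1..1} \<Longrightarrow> norm (vder eta x) \<le> K"
    using continuous_bounded_I11[OF smooth_continuous[OF smooth_vder[OF smooth_eta]]] by blast
  have "(vder zeta x)\<^sup>2 \<le> (4 * K\<^sup>2) * zeta x" if x: "-1 < x" "x < 1" for x
  proof -
    have "\<bar>vder eta x\<bar>\<^sup>2 \<le> K\<^sup>2" using K[of x] x by (intro power_mono) auto
    then have "zeta x * (vder eta x)\<^sup>2 \<le> zeta x * K\<^sup>2" by (intro mult_left_mono zeta_props) simp
    then show ?thesis by (simp add: eta_props(5) zeta_def power2_eq_square mult_ac)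
  qed
  then show ?thesis using that[of "4 * K\<^sup>2"] by simp
qed

text \<open>The factor \<open>exp (- M * (x - 1/2)\<^sup>2)\<close> makes \<open>q'\<close> dominate \<open>K * \<bar>q\<bar>\<close> away from the strip, so that the
  coupling terms of order zero are absorbed without a compactness argument.\<close>

lemma weight_exists:
  assumes K: "K \<ge> 0"
  obtains q c C where "smooth q" "q 1 = 0" "q (-1) = (0::real)" "c > 0" "C \<ge> 0"
    "\<And>x. -1 < x \<Longrightarrow> x < 1 \<Longrightarrow> c \<le> vder q x - K * \<bar>q x\<bar> + C * zeta x"
proof -
  \<comment> \<open>With d = |x - 1/2| between 1/4 and 3/2 off the strip, 2 M d^2 >= 2 + 3K/2 and K
    d <= 3K/2. Hence 2 M d^2 - K d - 1 >= 1, and the remaining terms add up to at least 1 - x + x^2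
    >= 3/4.\<close>
  define M where "M = 16 + 12 * K"
  define g where "g x = exp (- M * ((x - 1 / 2) * (x - 1 / 2)))" for x :: real
  define q where "q x = (1 - x * x) * (1 / 2 - x) * g x" for x :: real
  define b where "b x = - 2 * x * (1 / 2 - x) - (1 - x * x) + 2 * M * (1 - x * x) * (x - 1 / 2)\<^sup>2" for x :: real
  have M: "M > 0" using K by (simp add: M_def)
  have g0: "g x > 0" for x by (simp add: g_def)
  have sg: "smooth g"
    unfolding g_def[abs_def] by (intro smooth_exp_comp smooth_mult smooth_const smooth_diff smooth_id)
  have sq: "smooth q" unfolding q_def[abs_def] by (intro smooth_mult smooth_const smooth_diff smooth_id sg)
  have vq: "vder q x = b x * g x" for x
  proof -
    have "((\<lambda>x. - M * ((x - 1 / 2) * (x - 1 / 2))) has_real_derivative - M * (2 * (x - 1 / 2))) (at x)"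
      by (auto intro!: derivative_eq_intros)
    from DERIV_fun_exp[OF this] have dg: "(g has_real_derivative g x * (- M * (2 * (x - 1 / 2)))) (at x)"
      unfolding g_def[abs_def] .
    have "((\<lambda>x. (1 - x * x) * (1 / 2 - x)) has_real_derivative - 2 * x * (1 / 2 - x) - (1 - x * x)) (at x)"
      by (auto intro!: derivative_eq_intros simp: algebra_simps)
    from DERIV_mult[OF this dg] have "(q has_real_derivative b x * g x) (at x)"
      unfolding q_def[abs_def] b_def
      by (rule DERIV_cong) (simp add: field_simps power2_eq_square)
    then have "(q has_vector_derivative b x * g x) (at x)" by (simp add: has_real_derivative_iff_has_vector_derivative)
    then show ?thesis unfolding vder_def by (rule vector_derivative_at)
  qed
  \<comment> \<open>3/4 bounds the polynomial factor, and the exponential is the least possible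
    value of g, because |x - 1/2| <= 3/2.\<close>
  define c where "c = (3 / 4) * exp (- M * (9 / 4))"
  have c: "c > 0" by (simp add: c_def)
  have out: "c \<le> vder q x - K * \<bar>q x\<bar>" if x: "-1 < x" "x < 1" and d: "\<bar>x - 1 / 2\<bar> \<ge> 1 / 4" for x
  proof -
    define d where "d = \<bar>x - 1 / 2\<bar>"
    have d1: "1 / 4 \<le> d" "d \<le> 3 / 2" using x d unfolding d_def abs_le_iff by linarith+
    have dd: "(x - 1 / 2)\<^sup>2 = d\<^sup>2" by (simp add: d_def)
    have x2: "0 \<le> 1 - x * x" using x by (simp add: abs_square_le_1 flip: power2_eq_square)
    have "(1 / 4)\<^sup>2 \<le> d\<^sup>2" using d1 by (intro power_mono) auto
    then have "2 * M * (1 / 4)\<^sup>2 \<le> 2 * M * d\<^sup>2" using M by (intro mult_left_mono) auto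
    then have "2 + 3 / 2 * K \<le> 2 * M * d\<^sup>2" by (simp add: M_def power2_eq_square)
    moreover have "K * d \<le> K * (3 / 2)" using d1 K by (intro mult_left_mono) auto
    ultimately have "1 \<le> 2 * M * d\<^sup>2 - K * d - 1" by linarith
    from mult_left_mono[OF this x2]
    have "1 - x * x \<le> (1 - x * x) * (2 * M * d\<^sup>2 - K * d - 1)" by simp
    moreover have "x \<le> x * x + 1 / 4"
      using zero_le_power2[of "x - 1 / 2"] by (simp add: power2_eq_square algebra_simps)
    ultimately have "3 / 4 \<le> b x - K * ((1 - x * x) * d)"
      unfolding b_def dd by (simp add: power2_eq_square algebra_simps)
    moreover have "exp (- M * (9 / 4)) \<le> g x"
    proof -
      have "d\<^sup>2 \<le> (3 / 2)\<^sup>2" using d1 by (intro power_mono) auto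
      then have "(x - 1 / 2) * (x - 1 / 2) \<le> 9 / 4" by (simp add: dd[unfolded power2_eq_square] power2_eq_square)
      from mult_left_mono[OF this less_imp_le[OF M]] show ?thesis unfolding g_def by simp
    qed
    ultimately have "(3 / 4) * exp (- M * (9 / 4)) \<le> (b x - K * ((1 - x * x) * d)) * g x"
      by (intro mult_mono) auto
    moreover have "\<bar>q x\<bar> = (1 - x * x) * d * g x"
      using x2 g0[of x] by (simp add: q_def abs_mult d_def abs_minus_commute)
    ultimately show ?thesis unfolding c_def vq by (simp add: left_diff_distrib mult.assoc)
  qed
  have "continuous_on UNIV (\<lambda>x. vder q x - K * \<bar>q x\<bar>)"
    by (intro continuous_intros smooth_continuous smooth_vder sq)
  then obtain B where B: "\<And>x. x \<in> {-1..1} \<Longrightarrow> norm (vder q x - K * \<bar>q x\<bar>) \<le> B"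
    using continuous_bounded_I11 by blast
  \<comment> \<open>For |x - 1/2| < 1/4 both bump arguments exceed 1/8, so each bump is at least
    e^(-8); eta multiplies two of them and zeta four. On this middle part q' may be negative, and C
    zeta compensates.\<close>
  define z0 where "z0 = exp (- 32 :: real)"
  have z0: "z0 \<le> zeta x" if d: "\<bar>x - 1 / 2\<bar> < 1 / 4" for x
  proof -
    have "1 / 8 \<le> x - 1 / 8" "1 / 8 \<le> 7 / 8 - x" using d unfolding abs_less_iff by linarith+
    then have "exp (- 8) \<le> bump (x - 1 / 8)" "exp (- 8) \<le> bump (7 / 8 - x)"
      by (auto simp: bump_def field_simps)
    then have "exp (- 8) * exp (- 8) \<le> eta x"
      unfolding eta_def by (intro mult_mono) (auto simp: bump_nonneg)
    then have "(exp (- 8) * exp (- 8)) * (exp (- 8) * exp (- 8)) \<le> zeta x"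
      unfolding zeta_def by (intro mult_mono) (auto simp: eta_props)
    then show ?thesis by (simp add: z0_def flip: exp_add)
  qed
  define C where "C = (\<bar>B\<bar> + c) / z0"
  have "z0 > 0" by (simp add: z0_def)
  then have C: "C \<ge> 0" "C * z0 = \<bar>B\<bar> + c" using c by (auto simp: C_def)
  have "c \<le> vder q x - K * \<bar>q x\<bar> + C * zeta x" if x: "-1 < x" "x < 1" for x
  proof (cases "\<bar>x - 1 / 2\<bar> < 1 / 4")
    case True
    have "C * z0 \<le> C * zeta x" using z0[OF True] C(1) by (intro mult_left_mono) auto
    moreover have "norm (vder q x - K * \<bar>q x\<bar>) \<le> B" using B[of x] x by simp
    ultimately show ?thesis using C(2) unfolding real_norm_def by linarith
  next
    case False
    then have "\<bar>x - 1 / 2\<bar> \<ge> 1 / 4" by simp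
    from out[OF x this] mult_nonneg_nonneg[OF C(1) zeta_props(1)[of x]] show ?thesis by linarith
  qed
  from that[OF sq _ _ c C(1) this] show ?thesis by (simp add: q_def)
qed

section \<open>The semigroup and integrated estimates\<close>

lemma cscale_state_of_real: "cscale_state (of_real r) U = r *\<^sub>R U"
proof -
  have "cscale_l2 (of_real r) f = r *\<^sub>R f" for f
    by transfer (auto simp: l2_rel_def intro: sq_integrable_cmult)
  then show ?thesis by (simp add: cscale_state_def split: prod.split)
qed

abbreviation pos_w :: "state \<Rightarrow> l2" where "pos_w U \<equiv> fst U"
abbreviation pos_\<phi> :: "state \<Rightarrow> l2" where "pos_\<phi> U \<equiv> fst (snd U)"
abbreviation vel_v :: "state \<Rightarrow> l2" where "vel_v U \<equiv> fst (snd (snd U))"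
abbreviation vel_\<psi> :: "state \<Rightarrow> l2" where "vel_\<psi> U \<equiv> snd (snd (snd U))"

definition shear :: "state \<Rightarrow> l2" where "shear U = wderiv (pos_w U) + pos_\<phi> U"
definition bend :: "state \<Rightarrow> l2" where "bend U = wderiv (pos_\<phi> U)"

lemma energy_space_iff: "U \<in> energy_space \<longleftrightarrow> pos_w U \<in> H10 \<and> pos_\<phi> U \<in> H10"
  by (cases U) (simp add: energy_space_def)

lemma subspace_energy_space: "subspace energy_space"
  unfolding subspace_def
  by (simp add: energy_space_iff subspace_0 subspace_add subspace_scale subspace_H10)

text \<open>Both damping coefficients are kept general and nonnegative. Which one acts, and its
  lower bound near the strip, enter only in the two strip lemmas.\<close>

locale timoshenko =
  fixes r1 r2 k1 k2 :: real and D1 D2 :: "real \<Rightarrow> real" and S :: "real \<Rightarrow> state \<Rightarrow> state"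
  assumes r1: "r1 > 0" and r2: "r2 > 0" and k1: "k1 > 0" and k2: "k2 > 0"
    and LD1: "Linfty D1" and LD2: "Linfty D2"
    and D1_nonneg: "\<And>x. -1 < x \<Longrightarrow> x < 1 \<Longrightarrow> 0 \<le> D1 x"
    and D2_nonneg: "\<And>x. -1 < x \<Longrightarrow> x < 1 \<Longrightarrow> 0 \<le> D2 x"
    and semigroup: "timoshenko_semigroup r1 r2 k1 k2 D1 D2 S"
begin

abbreviation "N \<equiv> energy_norm r1 r2 k1 k2"
abbreviation "A \<equiv> timoshenko_op r1 r2 k1 k2 D1 D2"
abbreviation "DA \<equiv> timoshenko_domain k1 k2 D1 D2"
abbreviation "H \<equiv> energy_space"

definition E :: "state \<Rightarrow> real" where
  "E U = k1 * (norm (shear U))\<^sup>2 + k2 * (norm (bend U))\<^sup>2 + r1 * (norm (vel_v U))\<^sup>2 + r2 * (norm (vel_\<psi> U))\<^sup>2"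

text \<open>The first two components of A U are the velocities, so \<open>shear (A U)\<close> and
  \<open>bend (A U)\<close> are the strain rates v' + \<psi> and \<psi>'.\<close>

definition damp :: "state \<Rightarrow> real" where
  "damp U = wsq D1 (shear (A U)) + wsq D2 (bend (A U))"

definition data :: "state \<Rightarrow> real" where "data U = E U + E (A U)"

text \<open>Agrees with \<open>stress_T\<close> by \<open>stress_eq\<close>. This form displays the
  stress as a bounded map of U plus a bounded map of A U, which is what \<open>bl1\<close>
  abstracts.\<close>

definition stressT :: "state \<Rightarrow> l2" where "stressT U = k1 *\<^sub>R shear U + mult_l2 D1 (shear (A U))"
definition stressR :: "state \<Rightarrow> l2" where "stressR U = k2 *\<^sub>R bend U + mult_l2 D2 (bend (A U))"

lemma E_nonneg: "0 \<le> E U"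
  unfolding E_def using r1 r2 k1 k2 by simp

lemma N_E: "N U = sqrt (E U)"
  by (simp add: energy_norm_def E_def shear_def bend_def split: prod.split)

lemma E_N: "E U = (N U)\<^sup>2"
  using E_nonneg by (simp add: N_E)

lemma N_nonneg: "0 \<le> N U" by (simp add: N_E E_nonneg)

lemma damp_nonneg: "0 \<le> damp U"
  unfolding damp_def by (intro add_nonneg_nonneg inner_mult_nonneg LD1 LD2 D1_nonneg D2_nonneg)

lemma data_nonneg: "0 \<le> data U" by (simp add: data_def E_nonneg)

lemma E_le_data: "E U \<le> data U" "E (A U) \<le> data U" by (simp_all add: data_def E_nonneg)

lemma A_simps:
  "pos_w (A U) = vel_v U" "pos_\<phi> (A U) = vel_\<psi> U"
  "shear (A U) = wderiv (vel_v U) + vel_\<psi> U" "bend (A U) = wderiv (vel_\<psi> U)"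
  by (simp_all add: timoshenko_op_def Let_def shear_def bend_def split: prod.split)

lemma stress_eq: "stress_T k1 D1 U = stressT U" "stress_R k2 D2 U = stressR U"
  unfolding stressT_def stressR_def A_simps
  by (simp_all add: stress_T_def stress_R_def shear_def bend_def split: prod.split)

lemma A_vel: "vel_v (A U) = (1 / r1) *\<^sub>R wderiv (stressT U)"
  "vel_\<psi> (A U) = (1 / r2) *\<^sub>R (wderiv (stressR U) - stressT U)"
  unfolding stress_eq[symmetric] by (simp_all add: timoshenko_op_def Let_def split: prod.split)

lemma dom_iff: "U \<in> DA \<longleftrightarrow> U \<in> H \<and> A U \<in> H \<and> stressT U \<in> H1 \<and> stressR U \<in> H1"
  unfolding stress_eq[symmetric] energy_space_iff A_simps
  by (auto simp: timoshenko_domain_def energy_space_iff)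

lemma domD:
  assumes "U \<in> DA"
  shows "pos_w U \<in> H10" "pos_\<phi> U \<in> H10" "vel_v U \<in> H10" "vel_\<psi> U \<in> H10" "stressT U \<in> H1" "stressR U \<in> H1"
    "U \<in> H" "A U \<in> H"
  using assms unfolding dom_iff energy_space_iff A_simps by auto

lemma wderiv_stress: "wderiv (stressT U) = r1 *\<^sub>R vel_v (A U)"
  "wderiv (stressR U) = r2 *\<^sub>R vel_\<psi> (A U) + stressT U"
  using r1 r2 by (simp_all add: A_vel)

lemma wderiv_w: "wderiv (pos_w U) = shear U - pos_\<phi> U" "wderiv (pos_\<phi> U) = bend U"
  "wderiv (vel_v U) = shear (A U) - vel_\<psi> U" "wderiv (vel_\<psi> U) = bend (A U)"
  unfolding A_simps by (simp_all add: shear_def bend_def)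

subsection \<open>Bounded linear maps on the energy space\<close>

text \<open>A relative notion of bounded linearity is needed: the energy space is a proper subspace
  of the product type, and N is not the product norm.\<close>

definition bl :: "(state \<Rightarrow> l2) \<Rightarrow> bool" where
  "bl F \<longleftrightarrow> (\<forall>U\<in>H. \<forall>V\<in>H. F (U + V) = F U + F V) \<and> (\<forall>r. \<forall>U\<in>H. F (r *\<^sub>R U) = r *\<^sub>R F U)
     \<and> (\<exists>K\<ge>0. \<forall>U\<in>H. norm (F U) \<le> K * N U)"

lemma blI:
  assumes "\<And>U V. U \<in> H \<Longrightarrow> V \<in> H \<Longrightarrow> F (U + V) = F U + F V" "\<And>r U. U \<in> H \<Longrightarrow> F (r *\<^sub>R U) = r *\<^sub>R F U"
    and "\<And>U. U \<in> H \<Longrightarrow> norm (F U) \<le> K * N U"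
  shows "bl F"
proof -
  have "norm (F U) \<le> \<bar>K\<bar> * N U" if "U \<in> H" for U
    using assms(3)[OF that] mult_right_mono[OF abs_ge_self[of K] N_nonneg[of U]] by linarith
  then show ?thesis unfolding bl_def using assms(1,2) by (blast intro: abs_ge_zero)
qed

lemma bl_add_eq: "bl F \<Longrightarrow> U \<in> H \<Longrightarrow> V \<in> H \<Longrightarrow> F (U + V) = F U + F V" by (simp add: bl_def)
lemma bl_scaleR_eq: "bl F \<Longrightarrow> U \<in> H \<Longrightarrow> F (r *\<^sub>R U) = r *\<^sub>R F U" by (simp add: bl_def)
lemma bl_diff_eq:
  assumes "bl F" "U \<in> H" "V \<in> H" shows "F (U - V) = F U - F V"
proof -
  have "U - V \<in> H" using assms(2,3) by (rule subspace_diff[OF subspace_energy_space])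
  from bl_add_eq[OF assms(1) this assms(3)] show ?thesis by (simp add: eq_diff_eq)
qed

lemma bl_bound: assumes "bl F" obtains K where "K \<ge> 0" "\<And>U. U \<in> H \<Longrightarrow> norm (F U) \<le> K * N U"
  using assms by (auto simp: bl_def)

lemma bl_bound_sq:
  assumes "bl F" obtains K where "K \<ge> 0" "\<And>U. U \<in> H \<Longrightarrow> (norm (F U))\<^sup>2 \<le> K * E U"
proof -
  obtain K where K: "K \<ge> 0" "\<And>U. U \<in> H \<Longrightarrow> norm (F U) \<le> K * N U" using bl_bound[OF assms] by blast
  have "(norm (F U))\<^sup>2 \<le> K\<^sup>2 * E U" if "U \<in> H" for U
    using power_mono[OF K(2)[OF that] norm_ge_zero, of 2] by (simp add: power_mult_distrib E_N)
  then show ?thesis using that[of "K\<^sup>2"] by simp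
qed

lemma bl_bounded_linear:
  assumes L: "bounded_linear L" and F: "bl F" shows "bl (\<lambda>U. L (F U))"
proof -
  interpret L: bounded_linear L by fact
  obtain K where K: "K \<ge> 0" "\<And>U. U \<in> H \<Longrightarrow> norm (F U) \<le> K * N U" using bl_bound[OF F] by blast
  obtain M where M: "M \<ge> 0" "\<And>x. norm (L x) \<le> norm x * M" using L.nonneg_bounded by blast
  show ?thesis
  proof (rule blI[where K = "K * M"])
    fix U assume U: "U \<in> H"
    show "norm (L (F U)) \<le> K * M * N U"
      using M(2)[of "F U"] mult_right_mono[OF K(2)[OF U] M(1)] by (simp add: mult_ac)
  qed (simp_all add: bl_add_eq[OF F] bl_scaleR_eq[OF F] L.add L.scaleR)
qed

lemma bl_add: assumes F: "bl F" and G: "bl G" shows "bl (\<lambda>U. F U + G U)"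
proof -
  obtain K where K: "K \<ge> 0" "\<And>U. U \<in> H \<Longrightarrow> norm (F U) \<le> K * N U" using bl_bound[OF F] by blast
  obtain M where M: "M \<ge> 0" "\<And>U. U \<in> H \<Longrightarrow> norm (G U) \<le> M * N U" using bl_bound[OF G] by blast
  show ?thesis
  proof (rule blI[where K = "K + M"])
    fix U assume U: "U \<in> H"
    show "norm (F U + G U) \<le> (K + M) * N U"
      using norm_triangle_ineq[of "F U" "G U"] K(2)[OF U] M(2)[OF U] by (simp add: algebra_simps)
  qed (simp_all add: bl_add_eq[OF F] bl_scaleR_eq[OF F] bl_add_eq[OF G] bl_scaleR_eq[OF G] scaleR_add_right)
qed

lemma bl_scaleR: "bl F \<Longrightarrow> bl (\<lambda>U. r *\<^sub>R F U)"
  by (rule bl_bounded_linear[OF bounded_linear_scaleR_right])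

lemma bl_zero: "bl (\<lambda>U. 0)"
  by (rule blI[where K = 0]) auto

lemma bl_diff: "bl F \<Longrightarrow> bl G \<Longrightarrow> bl (\<lambda>U. F U - G U)"
  using bl_add[OF _ bl_scaleR[of G "-1"], of F] by simp

lemma bl_mult: "Linfty m \<Longrightarrow> bl F \<Longrightarrow> bl (\<lambda>U. mult_l2 m (F U))"
  by (rule bl_bounded_linear[OF bounded_linear_mult_l2])

lemma bl_pair:
  assumes L: "bounded_linear L" and F: "bl F" and G: "bl G" shows "bl (\<lambda>U. L (F U, G U))"
proof -
  interpret L: bounded_linear L by fact
  have "bounded_linear (\<lambda>f. L (f, 0))" "bounded_linear (\<lambda>f. L (0, f))"
    by (intro bounded_linear_compose[OF L] bounded_linear_Pair bounded_linear_ident bounded_linear_zero)+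
  from bl_add[OF bl_bounded_linear[OF this(1) F] bl_bounded_linear[OF this(2) G]]
  show ?thesis by (simp add: L.add[symmetric])
qed

lemma component_bounds:
  "norm (shear U) \<le> (1 / sqrt k1) * N U" "norm (bend U) \<le> (1 / sqrt k2) * N U"
  "norm (vel_v U) \<le> (1 / sqrt r1) * N U" "norm (vel_\<psi> U) \<le> (1 / sqrt r2) * N U"
proof -
  have a: "x \<le> (1 / sqrt c) * N U" if "c > 0" "x \<ge> 0" "c * x\<^sup>2 \<le> E U" for c x
  proof -
    have "sqrt c * x \<le> N U"
      unfolding N_E using that by (intro real_le_rsqrt) (simp add: power_mult_distrib)
    then show ?thesis using that(1) by (simp add: field_simps)
  qed
  show "norm (shear U) \<le> (1 / sqrt k1) * N U" "norm (bend U) \<le> (1 / sqrt k2) * N U"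
    "norm (vel_v U) \<le> (1 / sqrt r1) * N U" "norm (vel_\<psi> U) \<le> (1 / sqrt r2) * N U"
    by (rule a; use r1 r2 k1 k2 in \<open>simp add: E_def\<close>)+
qed

lemma H_D: "U \<in> H \<Longrightarrow> pos_w U \<in> H1" "U \<in> H \<Longrightarrow> pos_\<phi> U \<in> H1"
  by (auto simp: energy_space_iff H10_H1)

lemma bl_shear: "bl shear"
  by (rule blI[OF _ _ component_bounds(1)])
     (auto simp: shear_def wderiv_add wderiv_scaleR H_D scaleR_add_right)

lemma bl_bend: "bl bend"
  by (rule blI[OF _ _ component_bounds(2)])
     (auto simp: bend_def wderiv_add wderiv_scaleR H_D)

lemma bl_v: "bl vel_v" by (rule blI[OF _ _ component_bounds(3)]) auto
lemma bl_\<psi>: "bl vel_\<psi>" by (rule blI[OF _ _ component_bounds(4)]) auto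

lemma bl_\<phi>: "bl pos_\<phi>"
proof (rule blI)
  fix U assume "U \<in> H"
  then have "norm (pos_\<phi> U) \<le> 2 * norm (bend U)" by (simp add: energy_space_iff poincare bend_def)
  then show "norm (pos_\<phi> U) \<le> (2 * (1 / sqrt k2)) * N U" using component_bounds(2)[of U] by simp
qed auto

lemma bl_w: "bl pos_w"
proof -
  obtain K where K: "K \<ge> 0" "\<And>U. U \<in> H \<Longrightarrow> norm (shear U - pos_\<phi> U) \<le> K * N U"
    using bl_bound[OF bl_diff[OF bl_shear bl_\<phi>]] by blast
  show ?thesis
  proof (rule blI)
    fix U assume U: "U \<in> H"
    then have "norm (pos_w U) \<le> 2 * norm (shear U - pos_\<phi> U)" by (simp add: energy_space_iff poincare shear_def)
    then show "norm (pos_w U) \<le> (2 * K) * N U" using K(2)[OF U] by simp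
  qed auto
qed

lemma E_le_2:
  assumes "U \<in> H" "V \<in> H" shows "E U \<le> 2 * E V + 2 * E (U - V)"
proof -
  have e: "k * (norm a)\<^sup>2 \<le> k * (2 * (norm b)\<^sup>2 + 2 * (norm (a - b))\<^sup>2)" if "k > 0" for k and a b :: l2
    using that by (intro mult_left_mono norm_sq_le_2) auto
  show ?thesis
    using e[OF k1, of "shear U" "shear V"] e[OF k2, of "bend U" "bend V"]
      e[OF r1, of "vel_v U" "vel_v V"] e[OF r2, of "vel_\<psi> U" "vel_\<psi> V"]
    by (simp add: E_def bl_diff_eq[OF bl_shear assms] bl_diff_eq[OF bl_bend assms] algebra_simps)
qed

subsection \<open>Orbits\<close>

lemma S_props:
  shows S_H: "t \<ge> 0 \<Longrightarrow> U \<in> H \<Longrightarrow> S t U \<in> H"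
    and S_add: "t \<ge> 0 \<Longrightarrow> U \<in> H \<Longrightarrow> V \<in> H \<Longrightarrow> S t (U + V) = S t U + S t V"
    and S_scaleR: "t \<ge> 0 \<Longrightarrow> U \<in> H \<Longrightarrow> S t (r *\<^sub>R U) = r *\<^sub>R S t U"
    and S_0: "U \<in> H \<Longrightarrow> S 0 U = U"
    and S_S: "s \<ge> 0 \<Longrightarrow> t \<ge> 0 \<Longrightarrow> U \<in> H \<Longrightarrow> S (s + t) U = S s (S t U)"
    and S_cont: "U \<in> H \<Longrightarrow> ((\<lambda>t. N (S t U - U)) \<longlongrightarrow> 0) (at_right 0)"
    and S_contr: "t \<ge> 0 \<Longrightarrow> U \<in> H \<Longrightarrow> N (S t U) \<le> N U"
proof -
  have c: "C0_contraction_semigroup H N cscale_state S"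
    using semigroup by (simp add: timoshenko_semigroup_def)
  note c' = c[unfolded C0_contraction_semigroup_def]
  show "S t U \<in> H" if "t \<ge> 0" "U \<in> H" using c' that by blast
  show "S t (U + V) = S t U + S t V" if "t \<ge> 0" "U \<in> H" "V \<in> H" using c' that by blast
  show "S 0 U = U" if "U \<in> H" using c' that by blast
  show "S (s + t) U = S s (S t U)" if "s \<ge> 0" "t \<ge> 0" "U \<in> H" using c' that by blast
  show "((\<lambda>t. N (S t U - U)) \<longlongrightarrow> 0) (at_right 0)" if "U \<in> H" using c' that by blast
  show "N (S t U) \<le> N U" if "t \<ge> 0" "U \<in> H" using c' that by blast
  show "S t (r *\<^sub>R U) = r *\<^sub>R S t U" if "t \<ge> 0" "U \<in> H"
  proof -
    have "S t (cscale_state (of_real r) U) = cscale_state (of_real r) (S t U)"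
      using c that unfolding C0_contraction_semigroup_def by blast
    then show ?thesis by (simp only: cscale_state_of_real)
  qed
qed

lemma S_diff: assumes "t \<ge> 0" "U \<in> H" "V \<in> H" shows "S t (U - V) = S t U - S t V"
proof -
  have "U - V \<in> H" using assms(2,3) by (rule subspace_diff[OF subspace_energy_space])
  from S_add[OF assms(1) this assms(3)] show ?thesis by (simp add: eq_diff_eq)
qed

lemma E_S_le: "t \<ge> 0 \<Longrightarrow> U \<in> H \<Longrightarrow> E (S t U) \<le> E U"
  unfolding E_N using S_contr N_nonneg by (simp add: power_mono)

definition dq :: "real \<Rightarrow> state \<Rightarrow> state" where "dq h U = (1 / h) *\<^sub>R (S h U - U)"

definition err :: "state \<Rightarrow> real \<Rightarrow> real" where "err U h = N (dq h U - A U)"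

lemma generator: "generator_graph H N S = {(U, A U) | U. U \<in> DA}"
  using semigroup by (simp add: timoshenko_semigroup_def timoshenko_graph_def)

lemma err_tendsto:
  assumes "U \<in> DA" shows "((\<lambda>h. err U h) \<longlongrightarrow> 0) (at_right 0)"
proof -
  have "(U, A U) \<in> generator_graph H N S" unfolding generator using assms by blast
  then show ?thesis by (simp add: generator_graph_def err_def dq_def)
qed

lemma dq_H: "h > 0 \<Longrightarrow> U \<in> H \<Longrightarrow> dq h U \<in> H"
  unfolding dq_def by (intro subspace_scale[OF subspace_energy_space] subspace_diff[OF subspace_energy_space] S_H) auto

lemma dq_S:
  assumes "h > 0" "t \<ge> 0" "U \<in> H" shows "dq h (S t U) = S t (dq h U)"
proof -
  have "S h (S t U) = S t (S h U)" using S_S[of h t U] S_S[of t h U] assms by (simp add: add.commute)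
  moreover have "S h U - U \<in> H" using assms by (intro subspace_diff[OF subspace_energy_space] S_H) auto
  ultimately show ?thesis
    unfolding dq_def using assms by (simp add: S_scaleR S_diff S_H)
qed

text \<open>The difference quotient commutes with S t, and S t is a contraction, so the quotient at
  S t U converges to S t (A U). The identification of the generator graph then gives membership in
  the domain and the value of A.\<close>

lemma S_dom:
  assumes U: "U \<in> DA" and t: "t \<ge> 0" shows "S t U \<in> DA" "A (S t U) = S t (A U)"
proof -
  note H = domD(7,8)[OF U]
  have "((\<lambda>h. N (dq h (S t U) - S t (A U))) \<longlongrightarrow> 0) (at_right 0)"
  proof (rule tendsto_sandwich[OF _ _ tendsto_const err_tendsto[OF U]])
    show "\<forall>\<^sub>F h in at_right 0. 0 \<le> N (dq h (S t U) - S t (A U))" by (simp add: N_nonneg)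
    show "\<forall>\<^sub>F h in at_right 0. N (dq h (S t U) - S t (A U)) \<le> err U h"
    proof (rule eventually_at_rightI[of 0 1])
      fix h :: real assume h: "h \<in> {0<..<1}"
      then have d: "dq h U \<in> H" using dq_H H by simp
      then have "dq h (S t U) - S t (A U) = S t (dq h U - A U)"
        using dq_S[of h t U] S_diff[OF t d H(2)] h t H by simp
      then show "N (dq h (S t U) - S t (A U)) \<le> err U h"
        unfolding err_def using S_contr[OF t subspace_diff[OF subspace_energy_space d H(2)]] by simp
    qed simp
  qed
  then have "(S t U, S t (A U)) \<in> generator_graph H N S"
    using S_H[OF t] H by (simp add: generator_graph_def dq_def)
  then show "S t U \<in> DA" "A (S t U) = S t (A U)" unfolding generator by auto
qed

text \<open>The error of the difference quotient does not grow along the orbit. Its smallness at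
  time 0 is therefore smallness uniform in time, which every limit h -> 0 below relies on.\<close>

lemma err_S:
  assumes "U \<in> DA" "t \<ge> 0" "h > 0" shows "err (S t U) h \<le> err U h"
proof -
  note H = domD(7,8)[OF assms(1)]
  have d: "dq h U \<in> H" using dq_H H assms by simp
  then have "dq h (S t U) - A (S t U) = S t (dq h U - A U)"
    using dq_S[of h t U] S_diff[OF assms(2) d H(2)] S_dom(2)[OF assms(1,2)] assms H by simp
  then show ?thesis
    unfolding err_def using S_contr[OF assms(2) subspace_diff[OF subspace_energy_space d H(2)]] by simp
qed

lemma A_add_scaleR:
  assumes "U \<in> DA" "V \<in> DA"
  shows "U + V \<in> DA \<and> A (U + V) = A U + A V" and "r *\<^sub>R U \<in> DA \<and> A (r *\<^sub>R U) = r *\<^sub>R A U"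
proof -
  note U = domD[OF assms(1)] and V = domD[OF assms(2)]
  note H1 = H10_H1[OF U(3)] H10_H1[OF U(4)] H10_H1[OF V(3)] H10_H1[OF V(4)]
  interpret M1: bounded_linear "mult_l2 D1" by (rule bounded_linear_mult_l2[OF LD1])
  interpret M2: bounded_linear "mult_l2 D2" by (rule bounded_linear_mult_l2[OF LD2])
  have Ts: "stressT (U + V) = stressT U + stressT V" "stressR (U + V) = stressR U + stressR V"
    unfolding stressT_def stressR_def A_simps bl_add_eq[OF bl_shear U(7) V(7)] bl_add_eq[OF bl_bend U(7) V(7)]
    by (simp_all add: wderiv_add H1 M1.add M2.add scaleR_add_right)
  have Tr: "stressT (r *\<^sub>R U) = r *\<^sub>R stressT U" "stressR (r *\<^sub>R U) = r *\<^sub>R stressR U"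
    unfolding stressT_def stressR_def A_simps bl_scaleR_eq[OF bl_shear U(7)] bl_scaleR_eq[OF bl_bend U(7)]
    by (simp_all add: wderiv_scaleR H1 M1.scaleR M2.scaleR M1.add M2.add scaleR_add_right)
  have eq: "X = Y" if "pos_w X = pos_w Y" "pos_\<phi> X = pos_\<phi> Y" "vel_v X = vel_v Y" "vel_\<psi> X = vel_\<psi> Y" for X Y :: state
    using that by (simp add: prod_eq_iff)
  have a: "A (U + V) = A U + A V"
    by (rule eq) (simp_all add: A_simps A_vel Ts wderiv_add U V algebra_simps)
  have b: "A (r *\<^sub>R U) = r *\<^sub>R A U"
    by (rule eq) (simp_all add: A_simps A_vel Tr wderiv_scaleR U V algebra_simps)
  show "U + V \<in> DA \<and> A (U + V) = A U + A V"
    using a unfolding dom_iff by (simp add: Ts a U V subspace_add subspace_H1 subspace_energy_space)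
  show "r *\<^sub>R U \<in> DA \<and> A (r *\<^sub>R U) = r *\<^sub>R A U"
    using b unfolding dom_iff by (simp add: Tr b U V subspace_scale subspace_H1 subspace_energy_space)
qed

lemma dq_dom:
  assumes U: "U \<in> DA" and h: "h > 0" shows "dq h U \<in> DA" "A (dq h U) = dq h (A U)"
proof -
  have S: "S h U \<in> DA" "A (S h U) = S h (A U)" using S_dom[OF U] h by auto
  have m: "(-1) *\<^sub>R U \<in> DA" "A ((-1) *\<^sub>R U) = (-1) *\<^sub>R A U" using A_add_scaleR(2)[OF U U] by blast+
  have d: "S h U + (-1) *\<^sub>R U \<in> DA" "A (S h U + (-1) *\<^sub>R U) = S h (A U) + (-1) *\<^sub>R A U"
    using A_add_scaleR(1)[OF S(1) m(1)] S m by auto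
  show "dq h U \<in> DA" "A (dq h U) = dq h (A U)"
    using A_add_scaleR(2)[OF d(1) d(1), of "1 / h"] d unfolding dq_def by auto
qed

text \<open>Factoring S s out of the increment and using contractivity leaves a bound that depends
  on t - s only.\<close>

lemma bl_S_diff:
  assumes F: "bl F" and K: "\<And>U. U \<in> H \<Longrightarrow> norm (F U) \<le> K * N U" and K0: "K \<ge> 0" and U: "U \<in> H"
    and s: "0 \<le> s" "s \<le> t"
  shows "norm (F (S t U) - F (S s U)) \<le> K * N (S (t - s) U - U)"
proof -
  have d: "S (t - s) U - U \<in> H" using U s by (intro subspace_diff[OF subspace_energy_space] S_H) auto
  have "S t U = S s (S (t - s) U)" using S_S[of s "t - s" U] s U by simp
  then have "F (S t U) - F (S s U) = F (S s (S (t - s) U - U))"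
    using s U by (simp add: S_diff S_H bl_diff_eq[OF F])
  also have "norm \<dots> \<le> K * N (S s (S (t - s) U - U))" using K S_H[OF s(1) d] by blast
  also have "\<dots> \<le> K * N (S (t - s) U - U)" by (intro mult_left_mono S_contr s d K0)
  finally show ?thesis .
qed

text \<open>Strong continuity is assumed only from the right at 0; the uniform modulus of
  \<open>bl_S_diff\<close> turns it into two-sided continuity at every time.\<close>

lemma bl_continuous:
  assumes F: "bl F" and U: "U \<in> H" shows "continuous_on {0..} (\<lambda>t. F (S t U))"
proof -
  obtain K where K: "K \<ge> 0" "\<And>U. U \<in> H \<Longrightarrow> norm (F U) \<le> K * N U" using bl_bound[OF F] by blast
  show ?thesis
    unfolding continuous_on_iff
  proof (intro ballI allI impI)
    fix t e :: real assume t: "t \<in> {0..}" and e: "0 < e"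
    have "\<forall>\<^sub>F h in at_right 0. N (S h U - U) < e / (K + 1)"
      using S_cont[OF U] e K(1) by (intro order_tendstoD) auto
    then obtain d where d: "d > 0" "\<And>h. 0 < h \<Longrightarrow> h < d \<Longrightarrow> N (S h U - U) < e / (K + 1)"
      unfolding eventually_at_right_field by auto
    have small: "K * N (S h U - U) < e" if "0 < h" "h < d" for h
    proof -
      have "K * N (S h U - U) \<le> K * (e / (K + 1))"
        using d(2)[OF that] K(1) by (intro mult_left_mono) auto
      also have "\<dots> < e" using K(1) e by (simp add: field_simps)
      finally show ?thesis .
    qed
    show "\<exists>d>0. \<forall>x'\<in>{0..}. dist x' t < d \<longrightarrow> dist (F (S x' U)) (F (S t U)) < e"
    proof (intro exI[of _ d] conjI ballI impI d(1))
      fix s assume s: "s \<in> {0..}" "dist s t < d"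
      consider "s = t" | "s < t" | "t < s" by linarith
      then show "dist (F (S s U)) (F (S t U)) < e"
      proof cases
        case 2
        then show ?thesis
          using bl_S_diff[OF F K(2,1) U, of s t] small[of "t - s"] s t by (simp add: dist_norm norm_minus_commute)
      next
        case 3
        then show ?thesis
          using bl_S_diff[OF F K(2,1) U, of t s] small[of "s - t"] s t by (simp add: dist_norm)
      qed (use e in auto)
    qed
  qed
qed

text \<open>The generator supplies right derivatives only. The left derivative at t comes from the
  expansion at the earlier time s, whose error is uniform in s, followed by moving F (A (S s U)) to
  time t by continuity of the orbit of A U.\<close>

lemma bl_deriv:
  assumes F: "bl F" and U: "U \<in> DA" and t: "t \<ge> 0"
  shows "((\<lambda>t. F (S t U)) has_vector_derivative F (A (S t U))) (at t within {0..})"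
proof -
  note H = domD(7,8)[OF U]
  obtain K where K: "K \<ge> 0" "\<And>U. U \<in> H \<Longrightarrow> norm (F U) \<le> K * N U" using bl_bound[OF F] by blast
  \<comment> \<open>First-order expansion with an error independent of the base point s.\<close>
  have step: "norm (F (S (s + h) U) - F (S s U) - h *\<^sub>R F (S s (A U))) \<le> K * (h * err U h)"
    if "s \<ge> 0" "h > 0" for s h
  proof -
    have d: "dq h U \<in> H" using dq_H H that by simp
    then have d': "dq h U - A U \<in> H" using H by (intro subspace_diff[OF subspace_energy_space])
    have "S (s + h) U - S s U = S s (h *\<^sub>R dq h U)"
      using that H by (simp add: dq_def S_S S_diff S_H)
    also have "\<dots> = h *\<^sub>R S s (dq h U)" using that d by (simp add: S_scaleR)
    finally have "F (S (s + h) U) - F (S s U) = h *\<^sub>R F (S s (dq h U))"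
      using that H d bl_diff_eq[OF F, of "S (s + h) U" "S s U"] bl_scaleR_eq[OF F, of "S s (dq h U)" h] S_H
      by simp
    then have "F (S (s + h) U) - F (S s U) - h *\<^sub>R F (S s (A U)) = h *\<^sub>R F (S s (dq h U - A U))"
      using that H d by (simp add: S_diff bl_diff_eq[OF F] S_H scaleR_diff_right)
    then have "norm (F (S (s + h) U) - F (S s U) - h *\<^sub>R F (S s (A U))) = h * norm (F (S s (dq h U - A U)))"
      using that by simp
    also have "\<dots> \<le> h * (K * N (S s (dq h U - A U)))"
      using that d' by (intro mult_left_mono K(2) S_H) auto
    also have "\<dots> \<le> h * (K * N (dq h U - A U))"
      using that d' K(1) by (intro mult_left_mono S_contr) auto
    finally show ?thesis by (simp add: err_def mult_ac)
  qed
  show ?thesis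
    unfolding has_vector_derivative_def has_derivative_within_alt
  proof (intro conjI allI impI)
    show "bounded_linear (\<lambda>x. x *\<^sub>R F (A (S t U)))" by (rule bounded_linear_scaleR_left)
    fix e :: real assume e: "e > 0"
    have "\<forall>\<^sub>F h in at_right 0. err U h < e / (2 * (K + 1))"
      using err_tendsto[OF U] e K(1) by (intro order_tendstoD) auto
    moreover have "\<forall>\<^sub>F h in at_right 0. N (S h (A U) - A U) < e / (2 * (K + 1))"
      using S_cont[OF H(2)] e K(1) by (intro order_tendstoD) auto
    ultimately have "\<forall>\<^sub>F h in at_right 0. err U h < e / (2 * (K + 1)) \<and> N (S h (A U) - A U) < e / (2 * (K + 1))"
      by (rule eventually_conj)
    then obtain d where d: "d > 0" "\<And>h. 0 < h \<Longrightarrow> h < d \<Longrightarrow> err U h < e / (2 * (K + 1))"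
       "\<And>h. 0 < h \<Longrightarrow> h < d \<Longrightarrow> N (S h (A U) - A U) < e / (2 * (K + 1))"
      unfolding eventually_at_right_field by auto
    have half: "K * x \<le> e / 2" if "x < e / (2 * (K + 1))" for x
    proof -
      have "K * x \<le> K * (e / (2 * (K + 1)))" using that K(1) by (intro mult_left_mono) auto
      also have "\<dots> \<le> e / 2" using K(1) e by (simp add: field_simps)
      finally show ?thesis .
    qed
    show "\<exists>d>0. \<forall>y\<in>{0..}. norm (y - t) < d \<longrightarrow>
        norm (F (S y U) - F (S t U) - (y - t) *\<^sub>R F (A (S t U))) \<le> e * norm (y - t)"
    proof (intro exI[of _ d] conjI ballI impI d(1))
      fix s assume s: "s \<in> {0..}" "norm (s - t) < d"
      have AS: "A (S t U) = S t (A U)" by (rule S_dom(2)[OF U t])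
      consider "s = t" | "s < t" | "t < s" by linarith
      then show "norm (F (S s U) - F (S t U) - (s - t) *\<^sub>R F (A (S t U))) \<le> e * norm (s - t)"
      proof cases
        case 3
        define h where "h = s - t"
        have h: "0 < h" "h < d" "s = t + h" using 3 s by (auto simp: h_def)
        have "norm (F (S s U) - F (S t U) - (s - t) *\<^sub>R F (A (S t U))) \<le> K * (h * err U h)"
          using step[OF t h(1)] h AS by simp
        also have "\<dots> = h * (K * err U h)" by simp
        also have "\<dots> \<le> h * (e / 2)" using h half[OF d(2)[OF h(1,2)]] by (intro mult_left_mono) auto
        also have "\<dots> \<le> e * norm (s - t)" using h e by simp
        finally show ?thesis .
      next
        case 2
        define h where "h = t - s"
        have h: "0 < h" "h < d" "t = s + h" and s0: "0 \<le> s" using 2 s by (auto simp: h_def)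
        \<comment> \<open>X is the expansion error at the earlier time s, and Y corrects for
          evaluating the derivative at t instead of s.\<close>
        define X Y where "X = F (S (s + h) U) - F (S s U) - h *\<^sub>R F (S s (A U))"
          and "Y = h *\<^sub>R (F (S t (A U)) - F (S s (A U)))"
        have "F (S s U) - F (S t U) - (s - t) *\<^sub>R F (A (S t U)) = - X + Y"
          unfolding X_def Y_def AS using h(3) by (simp add: algebra_simps)
        then have "norm (F (S s U) - F (S t U) - (s - t) *\<^sub>R F (A (S t U))) = norm (- X + Y)" by simp
        also have "\<dots> \<le> K * (h * err U h) + h * (K * N (S h (A U) - A U))"
        proof (rule norm_triangle_le, rule add_mono)
          show "norm (- X) \<le> K * (h * err U h)"
            unfolding norm_minus_cancel X_def by (rule step[OF s0 h(1)])
          have "norm (F (S t (A U)) - F (S s (A U))) \<le> K * N (S (t - s) (A U) - A U)"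
            by (rule bl_S_diff[OF F K(2,1) H(2)]) (use s0 h in auto)
          then have "h * norm (F (S t (A U)) - F (S s (A U))) \<le> h * (K * N (S h (A U) - A U))"
            using h(1) by (intro mult_left_mono) (simp_all add: h_def)
          then show "norm Y \<le> h * (K * N (S h (A U) - A U))"
            unfolding Y_def using h(1) by simp
        qed
        also have "\<dots> = h * (K * err U h) + h * (K * N (S h (A U) - A U))" by simp
        also have "\<dots> \<le> h * (e / 2) + h * (e / 2)"
          using h half[OF d(2)[OF h(1,2)]] half[OF d(3)[OF h(1,2)]]
          by (intro add_mono mult_left_mono) auto
        also have "\<dots> = e * norm (s - t)" using h by simp
        finally show ?thesis .
      qed simp
    qed
  qed
qed

subsection \<open>Absorbable functionals\<close>

definition contS :: "(state \<Rightarrow> 'b::topological_space) \<Rightarrow> bool" where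
  "contS X \<longleftrightarrow> (\<forall>U\<in>DA. continuous_on {0..} (\<lambda>t. X (S t U)))"

text \<open>The constant C depends on e but neither on U nor on the time horizon. Only an upper
  bound is asked, so X may change sign; \<open>absorbable_cmult\<close> accordingly requires c >= 0,
  and the lemmas about signed expressions carry their own coefficient c.\<close>

definition absorbable :: "(state \<Rightarrow> real) \<Rightarrow> bool" where
  "absorbable X \<longleftrightarrow> contS X \<and> (\<forall>e>0. \<exists>C\<ge>0. \<forall>U\<in>DA. \<forall>\<tau>\<ge>0.
     integral {0..\<tau>} (\<lambda>t. X (S t U)) \<le> e * integral {0..\<tau>} (\<lambda>t. E (S t U)) + C * data U)"

lemma contS_bl: "bl F \<Longrightarrow> contS F"
  unfolding contS_def using bl_continuous domD(7) by blast

lemma contS_bl_A: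
  assumes F: "bl F" shows "contS (\<lambda>U. F (A U))"
  unfolding contS_def
proof
  fix U assume U: "U \<in> DA"
  show "continuous_on {0..} (\<lambda>t. F (A (S t U)))"
    using bl_continuous[OF F domD(8)[OF U]] by (rule continuous_on_eq) (simp add: S_dom(2)[OF U])
qed

lemma contS_inner: "contS F \<Longrightarrow> contS G \<Longrightarrow> contS (\<lambda>U. inner (F U) (G U))" for F G :: "state \<Rightarrow> l2"
  unfolding contS_def by (auto intro: continuous_on_inner)
lemma contS_add: "contS F \<Longrightarrow> contS G \<Longrightarrow> contS (\<lambda>U. F U + G U)" for F G :: "state \<Rightarrow> 'b::real_normed_vector"
  unfolding contS_def by (auto intro: continuous_on_add)
lemma contS_scaleR: "contS F \<Longrightarrow> contS (\<lambda>U. c *\<^sub>R F U)" for F :: "state \<Rightarrow> 'b::real_normed_vector"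
  unfolding contS_def by (auto intro: continuous_on_scaleR continuous_on_const)
lemma contS_cmult: "contS X \<Longrightarrow> contS (\<lambda>U. c * X U)" for X :: "state \<Rightarrow> real"
  using contS_scaleR[of X c] by simp
lemma contS_bounded_linear: "bounded_linear L \<Longrightarrow> contS F \<Longrightarrow> contS (\<lambda>U. L (F U))"
  unfolding contS_def by (auto intro: bounded_linear.continuous_on)
lemma contS_mult: "Linfty m \<Longrightarrow> contS F \<Longrightarrow> contS (\<lambda>U. mult_l2 m (F U))"
  by (rule contS_bounded_linear[OF bounded_linear_mult_l2])
lemma contS_norm_sq: "contS F \<Longrightarrow> contS (\<lambda>U. (norm (F U))\<^sup>2)" for F :: "state \<Rightarrow> l2"
  unfolding contS_def by (intro ballI continuous_on_power continuous_on_norm) blast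

lemmas contS_comp = contS_bl[OF bl_shear] contS_bl[OF bl_bend] contS_bl[OF bl_v] contS_bl[OF bl_\<psi>]
  contS_bl[OF bl_w] contS_bl[OF bl_\<phi>] contS_bl_A[OF bl_shear] contS_bl_A[OF bl_bend]
  contS_bl_A[OF bl_v] contS_bl_A[OF bl_\<psi>]

lemma contS_T: "contS stressT" and contS_R: "contS stressR"
  unfolding stressT_def[abs_def] stressR_def[abs_def]
  by (intro contS_add contS_scaleR contS_mult contS_comp LD1 LD2)+

lemma contS_E: "contS E"
  unfolding E_def[abs_def] by (intro contS_add contS_cmult contS_norm_sq contS_comp)

lemma contS_damp: "contS damp"
  unfolding damp_def[abs_def] by (intro contS_add contS_inner contS_mult contS_comp LD1 LD2)

lemma contS_integrable:
  fixes X :: "state \<Rightarrow> real"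
  assumes "contS X" "U \<in> DA" "a \<ge> 0" shows "(\<lambda>t. X (S t U)) integrable_on {a..b}"
  by (rule integrable_continuous_real, rule continuous_on_subset[of "{0..}"]) (use assms in \<open>auto simp: contS_def\<close>)

lemma integral_mono_S:
  fixes X Y :: "state \<Rightarrow> real"
  assumes "contS X" "contS Y" "U \<in> DA" "\<And>V. V \<in> DA \<Longrightarrow> X V \<le> Y V"
  shows "integral {0..\<tau>} (\<lambda>t. X (S t U)) \<le> integral {0..\<tau>} (\<lambda>t. Y (S t U))"
  by (rule integral_le) (use assms contS_integrable S_dom(1) in auto)

lemma integral_E_nonneg: "0 \<le> integral {0..\<tau>} (\<lambda>t. E (S t U))"
proof (cases "(\<lambda>t. E (S t U)) integrable_on {0..\<tau>}")
  case True then show ?thesis by (rule Henstock_Kurzweil_Integration.integral_nonneg) (simp add: E_nonneg)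
qed (simp add: not_integrable_integral)

lemma data_S: "U \<in> DA \<Longrightarrow> t \<ge> 0 \<Longrightarrow> data (S t U) \<le> data U"
  unfolding data_def using E_S_le[of t U] E_S_le[of t "A U"] S_dom(2)[of U t] domD(7,8)[of U] by simp

lemma absorbableI:
  assumes "contS X" "\<And>e. e > 0 \<Longrightarrow> \<exists>C. \<forall>U\<in>DA. \<forall>\<tau>\<ge>0.
     integral {0..\<tau>} (\<lambda>t. X (S t U)) \<le> e * integral {0..\<tau>} (\<lambda>t. E (S t U)) + C * data U"
  shows "absorbable X"
  unfolding absorbable_def
proof (intro conjI allI impI assms(1))
  fix e :: real assume "e > 0"
  from assms(2)[OF this] obtain C where C: "\<And>U \<tau>. U \<in> DA \<Longrightarrow> \<tau> \<ge> 0 \<Longrightarrow>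
     integral {0..\<tau>} (\<lambda>t. X (S t U)) \<le> e * integral {0..\<tau>} (\<lambda>t. E (S t U)) + C * data U" by blast
  show "\<exists>C\<ge>0. \<forall>U\<in>DA. \<forall>\<tau>\<ge>0.
     integral {0..\<tau>} (\<lambda>t. X (S t U)) \<le> e * integral {0..\<tau>} (\<lambda>t. E (S t U)) + C * data U"
  proof (intro exI[of _ "\<bar>C\<bar>"] conjI ballI allI impI)
    fix U and \<tau> :: real assume "U \<in> DA" "\<tau> \<ge> 0"
    from C[OF this] mult_right_mono[OF abs_ge_self[of C] data_nonneg[of U]]
    show "integral {0..\<tau>} (\<lambda>t. X (S t U)) \<le> e * integral {0..\<tau>} (\<lambda>t. E (S t U)) + \<bar>C\<bar> * data U" by linarith
  qed simp
qed

lemma absorbable_bound: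
  "absorbable X \<Longrightarrow> e > 0 \<Longrightarrow> \<exists>C\<ge>0. \<forall>U\<in>DA. \<forall>\<tau>\<ge>0.
     integral {0..\<tau>} (\<lambda>t. X (S t U)) \<le> e * integral {0..\<tau>} (\<lambda>t. E (S t U)) + C * data U"
  by (simp add: absorbable_def)

lemma absorbable_contS: "absorbable X \<Longrightarrow> contS X" by (simp add: absorbable_def)

lemma absorbable_mono:
  assumes X: "absorbable X" and Y: "contS Y" and le: "\<And>U. U \<in> DA \<Longrightarrow> Y U \<le> X U" shows "absorbable Y"
proof (rule absorbableI[OF Y])
  fix e :: real assume e: "e > 0"
  obtain C where "C \<ge> 0" and C': "\<forall>U\<in>DA. \<forall>\<tau>\<ge>0.
     integral {0..\<tau>} (\<lambda>t. X (S t U)) \<le> e * integral {0..\<tau>} (\<lambda>t. E (S t U)) + C * data U"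
    using absorbable_bound[OF X e] by blast
  note C = C'[rule_format]
  have "integral {0..\<tau>} (\<lambda>t. Y (S t U)) \<le> e * integral {0..\<tau>} (\<lambda>t. E (S t U)) + C * data U"
    if "U \<in> DA" "\<tau> \<ge> 0" for U \<tau>
    using C[OF that] integral_mono_S[OF Y absorbable_contS[OF X] that(1) le, of \<tau>] by simp
  then show "\<exists>C. \<forall>U\<in>DA. \<forall>\<tau>\<ge>0.
     integral {0..\<tau>} (\<lambda>t. Y (S t U)) \<le> e * integral {0..\<tau>} (\<lambda>t. E (S t U)) + C * data U" by blast
qed

lemma absorbable_add:
  assumes X: "absorbable X" and Y: "absorbable Y" shows "absorbable (\<lambda>U. X U + Y U)"
proof (rule absorbableI)
  note c = absorbable_contS[OF X] absorbable_contS[OF Y]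
  show "contS (\<lambda>U. X U + Y U)" by (intro contS_add c)
  fix e :: real assume "e > 0"
  then have e: "e / 2 > 0" by simp
  obtain C where "C \<ge> 0" and C': "\<forall>U\<in>DA. \<forall>\<tau>\<ge>0.
     integral {0..\<tau>} (\<lambda>t. X (S t U)) \<le> e / 2 * integral {0..\<tau>} (\<lambda>t. E (S t U)) + C * data U"
    using absorbable_bound[OF X e] by blast
  note C = C'[rule_format]
  obtain B where "B \<ge> 0" and B': "\<forall>U\<in>DA. \<forall>\<tau>\<ge>0.
     integral {0..\<tau>} (\<lambda>t. Y (S t U)) \<le> e / 2 * integral {0..\<tau>} (\<lambda>t. E (S t U)) + B * data U"
    using absorbable_bound[OF Y e] by blast
  note B = B'[rule_format]
  have "integral {0..\<tau>} (\<lambda>t. X (S t U) + Y (S t U)) \<le> e * integral {0..\<tau>} (\<lambda>t. E (S t U)) + (C + B) * data U"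
    if "U \<in> DA" "\<tau> \<ge> 0" for U \<tau>
    using B[OF that] C[OF that]
    by (simp add: Henstock_Kurzweil_Integration.integral_add contS_integrable c that algebra_simps)
  then show "\<exists>C. \<forall>U\<in>DA. \<forall>\<tau>\<ge>0. integral {0..\<tau>} (\<lambda>t. X (S t U) + Y (S t U))
      \<le> e * integral {0..\<tau>} (\<lambda>t. E (S t U)) + C * data U" by blast
qed

lemma absorbable_cmult:
  assumes X: "absorbable X" and c: "c \<ge> 0" shows "absorbable (\<lambda>U. c * X U)"
proof (cases "c = 0")
  case True
  have "contS (\<lambda>U. 0::real)" by (simp add: contS_def)
  then have "absorbable (\<lambda>U. 0)"
    by (rule absorbableI) (auto intro!: exI[of _ 0] mult_nonneg_nonneg integral_E_nonneg)
  then show ?thesis using True by simp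
next
  case False
  show ?thesis
  proof (rule absorbableI)
    show "contS (\<lambda>U. c * X U)" by (rule contS_cmult[OF absorbable_contS[OF X]])
    fix e :: real assume "e > 0"
    then have e: "e / c > 0" using False c by simp
    obtain C where "C \<ge> 0" and C': "\<forall>U\<in>DA. \<forall>\<tau>\<ge>0.
       integral {0..\<tau>} (\<lambda>t. X (S t U)) \<le> e / c * integral {0..\<tau>} (\<lambda>t. E (S t U)) + C * data U"
    using absorbable_bound[OF X e] by blast
  note C = C'[rule_format]
    have "integral {0..\<tau>} (\<lambda>t. c * X (S t U)) \<le> e * integral {0..\<tau>} (\<lambda>t. E (S t U)) + (c * C) * data U"
      if "U \<in> DA" "\<tau> \<ge> 0" for U \<tau>
      using mult_left_mono[OF C[OF that] c] False by (simp add: algebra_simps)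
    then show "\<exists>C. \<forall>U\<in>DA. \<forall>\<tau>\<ge>0. integral {0..\<tau>} (\<lambda>t. c * X (S t U))
        \<le> e * integral {0..\<tau>} (\<lambda>t. E (S t U)) + C * data U" by blast
  qed
qed

subsection \<open>Dissipation\<close>

text \<open>The two momentum equations are tested with the velocities. The stresses are then paired
  with the strain rates; their elastic parts cancel and the damping parts form
  \<open>damp\<close>.\<close>

lemma dissipation_identity:
  assumes "U \<in> DA"
  shows "k1 * inner (shear (A U)) (shear U) + k2 * inner (bend (A U)) (bend U)
    + r1 * inner (vel_v (A U)) (vel_v U) + r2 * inner (vel_\<psi> (A U)) (vel_\<psi> U) = - damp U"
proof -
  note d = domD[OF assms]
  have "r1 * inner (vel_v (A U)) (vel_v U) = - inner (stressT U) (shear (A U) - vel_\<psi> U)"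
    using inner_wderiv[OF d(5,3)] by (simp add: wderiv_stress wderiv_w)
  moreover have "r2 * inner (vel_\<psi> (A U)) (vel_\<psi> U) = - inner (stressT U) (vel_\<psi> U) - inner (stressR U) (bend (A U))"
    using inner_wderiv[OF d(6,4)] by (simp add: wderiv_stress wderiv_w inner_add_left)
  moreover have "inner (stressT U) (shear (A U)) = k1 * inner (shear (A U)) (shear U) + wsq D1 (shear (A U))"
    by (simp add: stressT_def inner_add_left inner_commute[of "shear U"])
  moreover have "inner (stressR U) (bend (A U)) = k2 * inner (bend (A U)) (bend U) + wsq D2 (bend (A U))"
    by (simp add: stressR_def inner_add_left inner_commute[of "bend U"])
  ultimately show ?thesis by (simp add: damp_def inner_diff_right)
qed

lemma inner_deriv:
  assumes F: "bl F" and G: "bl G" and U: "U \<in> DA" and t: "t \<ge> 0"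
  shows "((\<lambda>t. inner (F (S t U)) (G (S t U))) has_vector_derivative
    inner (F (A (S t U))) (G (S t U)) + inner (F (S t U)) (G (A (S t U)))) (at t within {0..})"
  using bounded_bilinear.has_vector_derivative[OF bounded_bilinear_inner bl_deriv[OF F U t] bl_deriv[OF G U t]]
  by (simp add: add.commute)

lemma integral_deriv_S:
  fixes P :: "real \<Rightarrow> real"
  assumes "\<And>t. t \<ge> 0 \<Longrightarrow> (P has_vector_derivative X (S t U)) (at t within {0..})" "\<tau> \<ge> 0"
  shows "integral {0..\<tau>} (\<lambda>t. X (S t U)) = P \<tau> - P 0"
proof -
  have "((\<lambda>t. X (S t U)) has_integral (P \<tau> - P 0)) {0..\<tau>}"
    by (rule fundamental_theorem_of_calculus[OF assms(2)])
       (rule has_vector_derivative_within_subset[OF assms(1)], auto)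
  then show ?thesis by (rule integral_unique)
qed

lemma integral_damp:
  assumes U: "U \<in> DA" and \<tau>: "\<tau> \<ge> 0"
  shows "integral {0..\<tau>} (\<lambda>t. damp (S t U)) \<le> E U / 2"
proof -
  have d: "((\<lambda>t. E (S t U)) has_vector_derivative - 2 * damp (S t U)) (at t within {0..})" if t: "t \<ge> 0" for t
  proof -
    let ?V = "S t U"
    have V: "?V \<in> DA" by (rule S_dom(1)[OF U t])
    have c: "((\<lambda>t. c * (norm (F (S t U)))\<^sup>2) has_vector_derivative 2 * (c * inner (F (A ?V)) (F ?V))) (at t within {0..})"
      if F: "bl F" for F c
    proof -
      have "((\<lambda>t. c * inner (F (S t U)) (F (S t U))) has_vector_derivative
          c * (inner (F (A ?V)) (F ?V) + inner (F ?V) (F (A ?V)))) (at t within {0..})"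
        by (rule bounded_linear.has_vector_derivative[OF bounded_linear_mult_right inner_deriv[OF F F U t]])
      then show ?thesis by (simp add: power2_norm_eq_inner inner_commute[of "F ?V" "F (A ?V)"] algebra_simps)
    qed
    have "((\<lambda>t. E (S t U)) has_vector_derivative 2 * (k1 * inner (shear (A ?V)) (shear ?V))
        + 2 * (k2 * inner (bend (A ?V)) (bend ?V)) + 2 * (r1 * inner (vel_v (A ?V)) (vel_v ?V))
        + 2 * (r2 * inner (vel_\<psi> (A ?V)) (vel_\<psi> ?V))) (at t within {0..})"
      unfolding E_def by (intro has_vector_derivative_add c bl_shear bl_bend bl_v bl_\<psi>)
    moreover have "2 * (k1 * inner (shear (A ?V)) (shear ?V))
        + 2 * (k2 * inner (bend (A ?V)) (bend ?V)) + 2 * (r1 * inner (vel_v (A ?V)) (vel_v ?V))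
        + 2 * (r2 * inner (vel_\<psi> (A ?V)) (vel_\<psi> ?V)) = - 2 * damp ?V"
      using dissipation_identity[OF V] by (simp add: algebra_simps)
    ultimately show ?thesis by simp
  qed
  have "integral {0..\<tau>} (\<lambda>t. - 2 * damp (S t U)) = E (S \<tau> U) - E (S 0 U)"
    by (rule integral_deriv_S[OF d \<tau>])
  then have "- 2 * integral {0..\<tau>} (\<lambda>t. damp (S t U)) = E (S \<tau> U) - E U"
    using S_0[OF domD(7)[OF U]] by simp
  then show ?thesis using E_nonneg[of "S \<tau> U"] by linarith
qed

lemma absorbable_damp: "absorbable damp"
proof (rule absorbableI[OF contS_damp])
  fix e :: real assume e: "e > 0"
  have "integral {0..\<tau>} (\<lambda>t. damp (S t U)) \<le> e * integral {0..\<tau>} (\<lambda>t. E (S t U)) + 1 * data U"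
    if "U \<in> DA" "\<tau> \<ge> 0" for U \<tau>
    using integral_damp[OF that] E_nonneg[of U] E_le_data(1)[of U]
      mult_nonneg_nonneg[OF less_imp_le[OF e] integral_E_nonneg[of \<tau> U]] by linarith
  then show "\<exists>C. \<forall>U\<in>DA. \<forall>\<tau>\<ge>0. integral {0..\<tau>} (\<lambda>t. damp (S t U))
      \<le> e * integral {0..\<tau>} (\<lambda>t. E (S t U)) + C * data U" by blast
qed

text \<open>Young's inequality puts a small coefficient on the factor bounded by E and a large one
  on the factor bounded by X. The large coefficient is harmless because X is absorbable with an
  arbitrarily small share of the energy.\<close>

lemma absorbable_inner:
  fixes F G :: "state \<Rightarrow> l2"
  assumes X: "absorbable X" and F: "contS F" and G: "contS G"
    and FX: "\<And>U. U \<in> DA \<Longrightarrow> (norm (F U))\<^sup>2 \<le> X U"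
    and GE: "\<And>U. U \<in> DA \<Longrightarrow> (norm (G U))\<^sup>2 \<le> K * E U"
  shows "absorbable (\<lambda>U. c * inner (F U) (G U))"
proof (rule absorbableI)
  show c: "contS (\<lambda>U. c * inner (F U) (G U))" by (intro contS_cmult contS_inner F G)
  fix e :: real assume e: "e > 0"
  define M where "M = \<bar>K\<bar> + 1"
  define \<eta> where "\<eta> = e / (2 * M)"
  have M: "M > 0" "K \<le> M" by (auto simp: M_def)
  have \<eta>: "\<eta> > 0" using e M by (simp add: \<eta>_def)
  define Q where "Q = c\<^sup>2 / (4 * \<eta>)"
  have Q: "Q \<ge> 0" using \<eta> by (simp add: Q_def)
  have pt: "c * inner (F U) (G U) \<le> e / 2 * E U + Q * X U" if U: "U \<in> DA" for U
  proof -
    have "c * inner (F U) (G U) \<le> \<bar>c\<bar> * (norm (F U) * norm (G U))"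
      using mult_left_mono[OF Cauchy_Schwarz_ineq2[of "F U" "G U"], of "\<bar>c\<bar>"]
        abs_ge_self[of "c * inner (F U) (G U)"] by (simp add: abs_mult)
    also have "\<dots> \<le> \<eta> * (norm (G U))\<^sup>2 + Q * (norm (F U))\<^sup>2"
    proof -
      have "0 \<le> (2 * \<eta> * norm (G U) - \<bar>c\<bar> * norm (F U))\<^sup>2 / (4 * \<eta>)" using \<eta> by simp
      also have "\<dots> = \<eta> * (norm (G U))\<^sup>2 + Q * (norm (F U))\<^sup>2 - \<bar>c\<bar> * (norm (F U) * norm (G U))"
        using \<eta> by (simp add: Q_def power2_eq_square field_simps)
      finally show ?thesis by simp
    qed
    also have "\<dots> \<le> \<eta> * (M * E U) + Q * X U"
    proof (rule add_mono[OF mult_left_mono mult_left_mono])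
      show "(norm (G U))\<^sup>2 \<le> M * E U"
        using GE[OF U] mult_right_mono[OF M(2) E_nonneg[of U]] by linarith
    qed (use \<eta> Q FX[OF U] in auto)
    also have "\<eta> * (M * E U) = e / 2 * E U" using M by (simp add: \<eta>_def)
    finally show ?thesis .
  qed
  \<comment> \<open>Half of e is spent on G; e' is chosen so that the Young coefficient Q times e'
    costs at most the other half. The summand 1 avoids division by zero when Q = 0.\<close>
  define e' where "e' = e / (2 * (Q + 1))"
  have e': "e' > 0" "Q * e' \<le> e / 2" using e Q by (auto simp: e'_def field_simps)
  obtain C where "C \<ge> 0" and C': "\<forall>U\<in>DA. \<forall>\<tau>\<ge>0.
     integral {0..\<tau>} (\<lambda>t. X (S t U)) \<le> e' * integral {0..\<tau>} (\<lambda>t. E (S t U)) + C * data U"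
    using absorbable_bound[OF X e'(1)] by blast
  note C = C'[rule_format]
  have "integral {0..\<tau>} (\<lambda>t. c * inner (F (S t U)) (G (S t U)))
      \<le> e * integral {0..\<tau>} (\<lambda>t. E (S t U)) + (Q * C) * data U" if U: "U \<in> DA" and \<tau>: "\<tau> \<ge> 0" for U \<tau>
  proof -
    let ?I = "integral {0..\<tau>} (\<lambda>t. E (S t U))"
    have cX: "contS X" by (rule absorbable_contS[OF X])
    have "integral {0..\<tau>} (\<lambda>t. c * inner (F (S t U)) (G (S t U)))
        \<le> integral {0..\<tau>} (\<lambda>t. e / 2 * E (S t U) + Q * X (S t U))"
      by (rule integral_mono_S[OF c _ U pt]) (intro contS_add contS_cmult contS_E cX)
    also have "\<dots> = integral {0..\<tau>} (\<lambda>t. e / 2 * E (S t U)) + integral {0..\<tau>} (\<lambda>t. Q * X (S t U))"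
      by (rule Henstock_Kurzweil_Integration.integral_add)
         (rule contS_integrable[OF contS_cmult U], rule contS_E cX, simp)+
    also have "\<dots> = e / 2 * ?I + Q * integral {0..\<tau>} (\<lambda>t. X (S t U))" by simp
    also have "\<dots> \<le> e / 2 * ?I + Q * (e' * ?I + C * data U)"
      using mult_left_mono[OF C[OF U \<tau>] Q] by simp
    also have "\<dots> = e / 2 * ?I + (Q * e') * ?I + (Q * C) * data U" by (simp add: algebra_simps)
    also have "\<dots> \<le> e / 2 * ?I + e / 2 * ?I + (Q * C) * data U"
      using mult_right_mono[OF e'(2) integral_E_nonneg[of \<tau> U]] by simp
    finally show ?thesis by simp
  qed
  then show "\<exists>C. \<forall>U\<in>DA. \<forall>\<tau>\<ge>0. integral {0..\<tau>} (\<lambda>t. c * inner (F (S t U)) (G (S t U)))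
      \<le> e * integral {0..\<tau>} (\<lambda>t. E (S t U)) + C * data U" by blast
qed

text \<open>The expression is the time derivative of <F U, G U>. Its integral is a difference of two
  boundary values, each bounded by the energy at that time and hence by the data.\<close>

lemma absorbable_total_derivative:
  assumes F: "bl F" and G: "bl G"
  shows "absorbable (\<lambda>U. c * (inner (F (A U)) (G U) + inner (F U) (G (A U))))"
proof (rule absorbableI)
  let ?X = "\<lambda>U. inner (F (A U)) (G U) + inner (F U) (G (A U))"
  show "contS (\<lambda>U. c * ?X U)"
    by (intro contS_cmult contS_add contS_inner contS_bl contS_bl_A F G)
  obtain K where K: "K \<ge> 0" "\<And>U. U \<in> H \<Longrightarrow> norm (F U) \<le> K * N U" using bl_bound[OF F] by blast
  obtain M where M: "M \<ge> 0" "\<And>U. U \<in> H \<Longrightarrow> norm (G U) \<le> M * N U" using bl_bound[OF G] by blast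
  fix e :: real assume e: "e > 0"
  have "integral {0..\<tau>} (\<lambda>t. c * ?X (S t U)) \<le> e * integral {0..\<tau>} (\<lambda>t. E (S t U)) + (2 * \<bar>c\<bar> * K * M) * data U"
    if U: "U \<in> DA" and \<tau>: "\<tau> \<ge> 0" for U \<tau>
  proof -
    let ?P = "\<lambda>t. inner (F (S t U)) (G (S t U))"
    have b: "\<bar>?P t\<bar> \<le> K * M * data U" if t: "t \<ge> 0" for t
    proof -
      have V: "S t U \<in> H" using S_H t domD(7)[OF U] by blast
      have "\<bar>?P t\<bar> \<le> norm (F (S t U)) * norm (G (S t U))" by (rule Cauchy_Schwarz_ineq2)
      also have "\<dots> \<le> (K * N (S t U)) * (M * N (S t U))"
        by (intro mult_mono K M V mult_nonneg_nonneg N_nonneg norm_ge_zero)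
      also have "\<dots> = K * M * E (S t U)" by (simp add: E_N power2_eq_square)
      also have "\<dots> \<le> K * M * data U"
        using E_S_le[OF t domD(7)[OF U]] E_le_data(1)[of U] K(1) M(1) by (intro mult_left_mono) auto
      finally show ?thesis .
    qed
    have "integral {0..\<tau>} (\<lambda>t. ?X (S t U)) = ?P \<tau> - ?P 0"
      by (rule integral_deriv_S[OF inner_deriv[OF F G U] \<tau>])
    then have "integral {0..\<tau>} (\<lambda>t. c * ?X (S t U)) = c * (?P \<tau> - ?P 0)" by simp
    also have "\<dots> \<le> \<bar>c\<bar> * \<bar>?P \<tau> - ?P 0\<bar>" using abs_ge_self[of "c * (?P \<tau> - ?P 0)"] by (simp add: abs_mult)
    also have "\<dots> \<le> \<bar>c\<bar> * (2 * (K * M * data U))"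
      using b[OF \<tau>] b[of 0] by (intro mult_left_mono) auto
    finally show ?thesis
      using mult_nonneg_nonneg[OF less_imp_le[OF e] integral_E_nonneg[of \<tau> U]] by simp
  qed
  then show "\<exists>C. \<forall>U\<in>DA. \<forall>\<tau>\<ge>0. integral {0..\<tau>} (\<lambda>t. c * ?X (S t U))
      \<le> e * integral {0..\<tau>} (\<lambda>t. E (S t U)) + C * data U" by blast
qed

subsection \<open>Difference quotients\<close>

text \<open>Stresses and strain rates involve A U and are not bounded by the energy. They are still
  linear on the domain, bounded by \<open>data\<close>, and compatible with difference
  quotients.\<close>

definition bl1 :: "(state \<Rightarrow> l2) \<Rightarrow> bool" where
  "bl1 F \<longleftrightarrow> (\<exists>G G'. bl G \<and> bl G' \<and> (\<forall>U. F U = G U + G' (A U)))"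

lemma bl1I: "bl G \<Longrightarrow> bl G' \<Longrightarrow> (\<And>U. F U = G U + G' (A U)) \<Longrightarrow> bl1 F"
  unfolding bl1_def by blast

lemma bl1_bl: "bl F \<Longrightarrow> bl1 F" by (rule bl1I[OF _ bl_zero]) auto
lemma bl1_A: "bl F \<Longrightarrow> bl1 (\<lambda>U. F (A U))" by (rule bl1I[OF bl_zero]) auto

lemma bl1_add:
  assumes "bl1 F" "bl1 G" shows "bl1 (\<lambda>U. F U + G U)"
proof -
  obtain F0 F1 G0 G1 where "bl F0" "bl F1" "bl G0" "bl G1"
    "\<And>U. F U = F0 U + F1 (A U)" "\<And>U. G U = G0 U + G1 (A U)"
    using assms unfolding bl1_def by blast
  then show ?thesis by (intro bl1I[OF bl_add bl_add, of F0 G0 F1 G1]) auto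
qed

lemma bl1_mult:
  assumes "Linfty m" "bl1 F" shows "bl1 (\<lambda>U. mult_l2 m (F U))"
proof -
  obtain F0 F1 where "bl F0" "bl F1" "\<And>U. F U = F0 U + F1 (A U)"
    using assms unfolding bl1_def by blast
  then show ?thesis using assms(1)
    by (intro bl1I[OF bl_mult bl_mult, of m F0 m F1]) (auto simp: mult_l2_add_right)
qed

lemma bl1_T: "bl1 stressT" and bl1_R: "bl1 stressR"
  unfolding stressT_def[abs_def] stressR_def[abs_def]
  by (intro bl1_add bl1_bl bl1_A bl_scaleR bl_mult bl_shear bl_bend LD1 LD2
      bl1_A[of "\<lambda>U. mult_l2 D1 (shear U)"] bl1_A[of "\<lambda>U. mult_l2 D2 (bend U)"])+

lemma bl1_contS: "bl1 F \<Longrightarrow> contS F"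
  unfolding bl1_def using contS_add[OF contS_bl contS_bl_A] by (metis (no_types, lifting) ext)

lemma bl1_bound:
  assumes "bl1 F" obtains K where "K \<ge> 0" "\<And>U. U \<in> DA \<Longrightarrow> (norm (F U))\<^sup>2 \<le> K * data U"
proof -
  obtain F0 F1 where F: "bl F0" "bl F1" "\<And>U. F U = F0 U + F1 (A U)"
    using assms unfolding bl1_def by blast
  obtain K where K: "K \<ge> 0" "\<And>U. U \<in> H \<Longrightarrow> (norm (F0 U))\<^sup>2 \<le> K * E U" using bl_bound_sq[OF F(1)] by blast
  obtain M where M: "M \<ge> 0" "\<And>U. U \<in> H \<Longrightarrow> (norm (F1 U))\<^sup>2 \<le> M * E U" using bl_bound_sq[OF F(2)] by blast
  have "(norm (F U))\<^sup>2 \<le> (2 * K + 2 * M) * data U" if U: "U \<in> DA" for U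
  proof -
    have "(norm (F U))\<^sup>2 \<le> 2 * (norm (F0 U))\<^sup>2 + 2 * (norm (F1 (A U)))\<^sup>2"
      using norm_sq_le_2[of "F U" "F0 U"] by (simp add: F(3))
    also have "\<dots> \<le> 2 * (K * data U) + 2 * (M * data U)"
      using K(2)[OF domD(7)[OF U]] M(2)[OF domD(8)[OF U]]
        mult_left_mono[OF E_le_data(1)[of U] K(1)] mult_left_mono[OF E_le_data(2)[of U] M(1)] by linarith
    finally show ?thesis by (simp add: algebra_simps)
  qed
  then show ?thesis using that[of "2 * K + 2 * M"] K(1) M(1) by auto
qed

lemma bl1_dq:
  assumes F: "bl1 F" and U: "U \<in> DA" and h: "h > 0"
  shows "F (dq h U) = (1 / h) *\<^sub>R (F (S h U) - F U)"
proof -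
  obtain F0 F1 where F: "bl F0" "bl F1" "\<And>U. F U = F0 U + F1 (A U)"
    using F unfolding bl1_def by blast
  note H = domD(7,8)[OF U]
  have e: "G (dq h V) = (1 / h) *\<^sub>R (G (S h V) - G V)" if "bl G" "V \<in> H" for G V
    unfolding dq_def using that h
    by (simp add: bl_scaleR_eq bl_diff_eq subspace_diff subspace_energy_space S_H)
  show ?thesis
    using h unfolding F(3) dq_dom(2)[OF U h] e[OF F(1) H(1)] e[OF F(2) H(2)] S_dom(2)[OF U less_imp_le[OF h]]
    by (simp add: algebra_simps)
qed

text \<open>The two integrals differ only over two windows of length h. After division by h this is
  the boundary contribution 2 B of the summation by parts.\<close>

lemma integral_shift_S:
  fixes k :: "real \<Rightarrow> real"
  assumes k: "continuous_on {0..} k" and B: "\<And>t. t \<ge> 0 \<Longrightarrow> \<bar>k t\<bar> \<le> B" and h: "h > 0" and \<tau>: "\<tau> \<ge> 0"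
  shows "\<bar>integral {0..\<tau>} (\<lambda>t. k (t + h)) - integral {0..\<tau>} k\<bar> \<le> 2 * h * B"
proof -
  have i: "k integrable_on {a..b}" if "a \<ge> 0" for a b
    by (rule integrable_continuous_real, rule continuous_on_subset[OF k]) (use that in auto)
  have s: "integral {0..\<tau>} (\<lambda>t. k (t + h)) = integral {h..\<tau> + h} k"
  proof (rule integral_unique)
    have "(k has_integral integral {h..\<tau> + h} k) (cbox h (\<tau> + h))"
      using i h by (simp add: integrable_integral)
    from has_integral_affinity'[OF this, of 1 h]
    show "((\<lambda>t. k (t + h)) has_integral integral {h..\<tau> + h} k) {0..\<tau>}" by simp
  qed
  have b: "\<bar>integral {a..a + h} k\<bar> \<le> h * B" if a: "a \<ge> 0" for a
  proof -
    have "norm (integral {a..a + h} k) \<le> B * (a + h - a)"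
      by (rule integral_bound) (use a h B continuous_on_subset[OF k] in auto)
    then show ?thesis by (simp add: mult.commute)
  qed
  have 1: "integral {0..h} k + integral {h..\<tau> + h} k = integral {0..\<tau> + h} k"
    by (rule Henstock_Kurzweil_Integration.integral_combine) (use h \<tau> i in auto)
  have 2: "integral {0..\<tau>} k + integral {\<tau>..\<tau> + h} k = integral {0..\<tau> + h} k"
    by (rule Henstock_Kurzweil_Integration.integral_combine) (use h \<tau> i in auto)
  show ?thesis using s 1 2 b[of 0] b[OF \<tau>] by (simp add: algebra_simps abs_le_iff)
qed

lemma dq_estimates:
  assumes U: "U \<in> DA" and h: "h > 0"
  shows "E (dq h U) \<le> 2 * E (A U) + 2 * (err U h)\<^sup>2"
    and "t \<ge> 0 \<Longrightarrow> E (dq h (S t U) - A (S t U)) \<le> (err U h)\<^sup>2"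
    and "t \<ge> 0 \<Longrightarrow> dq h (S t U) = S t (dq h U)"
proof -
  note H = domD(7,8)[OF U]
  show "E (dq h U) \<le> 2 * E (A U) + 2 * (err U h)\<^sup>2"
    using E_le_2[OF dq_H[OF h H(1)] H(2)] by (simp add: err_def E_N)
  show "E (dq h (S t U) - A (S t U)) \<le> (err U h)\<^sup>2" if "t \<ge> 0"
    using power_mono[OF err_S[OF U that h], of 2] by (simp add: err_def E_N N_nonneg)
  show "dq h (S t U) = S t (dq h U)" if "t \<ge> 0" by (rule dq_S[OF h that H(1)])
qed

text \<open>The coefficients p and q may depend on the orbit and on the time horizon; only the
  surviving bound b has to be uniform.\<close>

lemma limit_err:
  assumes U: "U \<in> DA" and le: "\<And>h. h > 0 \<Longrightarrow> a \<le> b + p * err U h + q * (err U h)\<^sup>2"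
  shows "a \<le> b"
proof -
  have "((\<lambda>h. b + p * err U h + q * (err U h)\<^sup>2) \<longlongrightarrow> b + p * 0 + q * 0\<^sup>2) (at_right 0)"
    by (intro tendsto_intros err_tendsto[OF U])
  moreover have "\<forall>\<^sub>F h in at_right 0. a \<le> b + p * err U h + q * (err U h)\<^sup>2"
    using le by (auto simp: eventually_at_right_field intro!: exI[of _ 1])
  ultimately have "a \<le> b + p * 0 + q * 0\<^sup>2"
    by (rule tendsto_lowerbound) simp
  then show ?thesis by simp
qed

lemma contS_dq:
  fixes F :: "state \<Rightarrow> 'b::topological_space"
  assumes "contS F" "U \<in> DA" "h > 0" shows "continuous_on {0..} (\<lambda>t. F (dq h (S t U)))"
proof -
  have "continuous_on {0..} (\<lambda>t. F (S t (dq h U)))"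
    using assms dq_dom(1)[OF assms(2,3)] by (simp add: contS_def)
  then show ?thesis by (rule continuous_on_eq) (simp add: dq_estimates(3)[OF assms(2,3)])
qed

text \<open>The quotient \<open>dq h U\<close> starts an orbit in the domain, so the ordinary
  dissipation estimate applies to it, with initial energy at most 2 E (A U) plus twice the squared
  error.\<close>

lemma integral_damp_dq:
  assumes U: "U \<in> DA" and h: "h > 0" and \<tau>: "\<tau> \<ge> 0"
  shows "integral {0..\<tau>} (\<lambda>t. damp (dq h (S t U))) \<le> E (A U) + (err U h)\<^sup>2"
proof -
  have "integral {0..\<tau>} (\<lambda>t. damp (dq h (S t U))) = integral {0..\<tau>} (\<lambda>t. damp (S t (dq h U)))"
    by (rule integral_cong) (simp add: dq_estimates(3)[OF U h])
  also have "\<dots> \<le> E (dq h U) / 2" by (rule integral_damp[OF dq_dom(1)[OF U h] \<tau>])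
  finally show ?thesis using dq_estimates(1)[OF U h] by linarith
qed

text \<open>The hypothesis is used with V = \<open>dq h (S t U)\<close>: the dissipations of both
  orbits are integrable with data bounds, and E (V - A U) is the squared error, which disappears as
  h tends to 0.\<close>

lemma absorbable_dq:
  assumes X: "contS X"
    and le: "\<And>U V. U \<in> DA \<Longrightarrow> V \<in> DA \<Longrightarrow> X U \<le> K * (damp V + damp U + E (V - A U))" and K: "K \<ge> 0"
  shows "absorbable X"
proof (rule absorbableI[OF X])
  fix e :: real assume e: "e > 0"
  have "integral {0..\<tau>} (\<lambda>t. X (S t U)) \<le> e * integral {0..\<tau>} (\<lambda>t. E (S t U)) + K * data U"
    if U: "U \<in> DA" and \<tau>: "\<tau> \<ge> 0" for U \<tau>
  proof -
    have "integral {0..\<tau>} (\<lambda>t. X (S t U)) \<le> K * data U"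
    proof (rule limit_err[OF U, where p = 0 and q = "K * (1 + \<tau>)"])
      fix h :: real assume h: "h > 0"
      have ci: "(\<lambda>t. damp (dq h (S t U))) integrable_on {0..\<tau>}"
        by (rule integrable_continuous_real, rule continuous_on_subset[OF contS_dq[OF contS_damp U h]]) auto
      have cd: "(\<lambda>t. damp (S t U)) integrable_on {0..\<tau>}" by (rule contS_integrable[OF contS_damp U]) simp
      let ?R = "\<lambda>t. K * (damp (dq h (S t U)) + damp (S t U) + (err U h)\<^sup>2)"
      have "integral {0..\<tau>} (\<lambda>t. X (S t U)) \<le> integral {0..\<tau>} ?R"
      proof (rule integral_le)
        show "(\<lambda>t. X (S t U)) integrable_on {0..\<tau>}" by (rule contS_integrable[OF X U]) simp
        show "?R integrable_on {0..\<tau>}"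
          by (intro integrable_on_mult_right Henstock_Kurzweil_Integration.integrable_add ci cd integrable_const_ivl)
        fix t assume t: "t \<in> {0..\<tau>}"
        have "X (S t U) \<le> K * (damp (dq h (S t U)) + damp (S t U) + E (dq h (S t U) - A (S t U)))"
          using t by (intro le S_dom(1)[OF U] dq_dom(1)[OF _ h]) auto
        also have "\<dots> \<le> ?R t"
          using t by (intro mult_left_mono add_left_mono K dq_estimates(2)[OF U h]) auto
        finally show "X (S t U) \<le> ?R t" .
      qed
      also have "integral {0..\<tau>} ?R = K * (integral {0..\<tau>} (\<lambda>t. damp (dq h (S t U)))
          + integral {0..\<tau>} (\<lambda>t. damp (S t U)) + \<tau> * (err U h)\<^sup>2)"
        using \<tau> by (simp add: Henstock_Kurzweil_Integration.integral_add ci cd integrable_const_ivl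
            Henstock_Kurzweil_Integration.integrable_add)
      also have "\<dots> \<le> K * (E (A U) + (err U h)\<^sup>2 + E U + \<tau> * (err U h)\<^sup>2)"
        using integral_damp[OF U \<tau>] integral_damp_dq[OF U h \<tau>] E_nonneg[of U]
        by (intro mult_left_mono K) linarith
      finally show "integral {0..\<tau>} (\<lambda>t. X (S t U)) \<le> K * data U + 0 * err U h + K * (1 + \<tau>) * (err U h)\<^sup>2"
        by (simp add: data_def algebra_simps)
    qed
    then show ?thesis
      using mult_nonneg_nonneg[OF less_imp_le[OF e] integral_E_nonneg[of \<tau> U]] by linarith
  qed
  then show "\<exists>C. \<forall>U\<in>DA. \<forall>\<tau>\<ge>0. integral {0..\<tau>} (\<lambda>t. X (S t U))
      \<le> e * integral {0..\<tau>} (\<lambda>t. E (S t U)) + C * data U" by blast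
qed

text \<open>Summation by parts in the time shift moves the time derivative in \<open>\<langle>G U, \<partial>\<^sub>t F U\<rangle>\<close> onto \<open>G\<close>; neither
  factor need be differentiable, since the difference quotients are themselves orbits in the domain.\<close>

lemma absorbable_shift:
  assumes F: "bl1 F" and G: "bl1 G" and X: "contS X"
    and FE: "\<And>U. U \<in> DA \<Longrightarrow> (norm (F U))\<^sup>2 \<le> K * (E U + damp U)"
    and GV: "\<And>U V. U \<in> DA \<Longrightarrow> V \<in> DA \<Longrightarrow> (norm (G V))\<^sup>2 \<le> K * (damp V + damp U + E (V - A U))"
    and GF: "\<And>U V. U \<in> DA \<Longrightarrow> V \<in> DA \<Longrightarrow> \<bar>inner (G U) (F V) - X U\<bar> \<le> K * sqrt (data U) * N (V - A U)"
    and K: "K \<ge> 0"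
  shows "absorbable (\<lambda>U. c * X U)"
proof (rule absorbableI)
  show "contS (\<lambda>U. c * X U)" by (rule contS_cmult[OF X])
  obtain KF where KF: "KF \<ge> 0" "\<And>U. U \<in> DA \<Longrightarrow> (norm (F U))\<^sup>2 \<le> KF * data U" using bl1_bound[OF F] by blast
  obtain KG where KG: "KG \<ge> 0" "\<And>U. U \<in> DA \<Longrightarrow> (norm (G U))\<^sup>2 \<le> KG * data U" using bl1_bound[OF G] by blast
  define B where "B = (KF + KG) / 2"
  have FG: "\<bar>inner (G U) (F U)\<bar> \<le> B * data U" if "U \<in> DA" for U
  proof -
    have "\<bar>inner (G U) (F U)\<bar> \<le> norm (G U) * norm (F U)" by (rule Cauchy_Schwarz_ineq2)
    also have "\<dots> \<le> ((norm (F U))\<^sup>2 + (norm (G U))\<^sup>2) / 2"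
      using sum_squares_bound[of "norm (G U)" "norm (F U)"] by simp
    also have "\<dots> \<le> B * data U" using KF(2)[OF that] KG(2)[OF that] by (simp add: B_def algebra_simps)
    finally show ?thesis .
  qed
  have B0: "B \<ge> 0" using KF KG by (simp add: B_def)
  fix e :: real assume e: "e > 0"
  \<comment> \<open>The Young parameter is chosen so that |c| \<eta> K <= e; Q below is the
    coefficient of the companion term in a b <= \<eta> a^2 + b^2/(4 \<eta>).\<close>
  define \<eta> where "\<eta> = e / ((\<bar>c\<bar> + 1) * (K + 1))"
  have \<eta>: "\<eta> > 0" using e K by (simp add: \<eta>_def add_pos_nonneg add_nonneg_pos)
  have \<eta>K: "\<bar>c\<bar> * (\<eta> * K) \<le> e"
  proof -
    have "\<bar>c\<bar> * K \<le> (\<bar>c\<bar> + 1) * (K + 1)" using K by (intro mult_mono) auto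
    then have "e * (\<bar>c\<bar> * K) \<le> e * ((\<bar>c\<bar> + 1) * (K + 1))" using e by (intro mult_left_mono) auto
    moreover have "(\<bar>c\<bar> + 1) * (K + 1) > 0" using K by (intro mult_pos_pos) auto
    ultimately show ?thesis unfolding \<eta>_def by (simp add: pos_divide_le_eq mult_ac)
  qed
  define Q where "Q = K / (4 * \<eta>)"
  have Q: "Q \<ge> 0" using K \<eta> by (simp add: Q_def)
  define C where "C = \<bar>c\<bar> * (\<eta> * K + 2 * Q + 2 * B)"
  have "integral {0..\<tau>} (\<lambda>t. c * X (S t U)) \<le> e * integral {0..\<tau>} (\<lambda>t. E (S t U)) + C * data U"
    if U: "U \<in> DA" and \<tau>: "\<tau> \<ge> 0" for U \<tau>
  proof -
    let ?I = "integral {0..\<tau>} (\<lambda>t. E (S t U))"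
    have main: "\<bar>integral {0..\<tau>} (\<lambda>t. X (S t U))\<bar> \<le> \<eta> * K * ?I + (\<eta> * K + 2 * Q + 2 * B) * data U"
    \<comment> \<open>The error terms grow with the horizon \<tau>, but the horizon is fixed while h
      tends to 0.\<close>
    proof (rule limit_err[OF U, where p = "\<tau> * (K * sqrt (data U))" and q = "Q * (1 + \<tau>)"])
      fix h :: real assume h: "h > 0"
      define \<epsilon> where "\<epsilon> = err U h"
      have \<epsilon>0: "\<epsilon> \<ge> 0" by (simp add: \<epsilon>_def err_def N_nonneg)
      define f g where "f = (\<lambda>t. F (S t U))" and "g = (\<lambda>t. G (S t U))"
      define gq fq where "gq = (\<lambda>t. G (dq h (S t U)))" and "fq = (\<lambda>t. F (dq h (S t U)))"
      have D: "S t U \<in> DA" "dq h (S t U) \<in> DA" if "t \<ge> 0" for t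
        using S_dom(1)[OF U that] dq_dom(1)[OF _ h] by auto
      have Sth: "S h (S t U) = S (t + h) U" if "t \<ge> 0" for t
        using S_S[of h t U] h that domD(7)[OF U] by (simp add: add.commute)
      have fq: "fq t = (1 / h) *\<^sub>R (f (t + h) - f t)" if "t \<ge> 0" for t
        unfolding fq_def f_def bl1_dq[OF F D(1)[OF that] h] Sth[OF that] ..
      have gq: "gq t = (1 / h) *\<^sub>R (g (t + h) - g t)" if "t \<ge> 0" for t
        unfolding gq_def g_def bl1_dq[OF G D(1)[OF that] h] Sth[OF that] ..
      have cont: "continuous_on {0..} f" "continuous_on {0..} g"
        using bl1_contS[OF F] bl1_contS[OF G] U by (auto simp: contS_def f_def g_def)
      have contq: "continuous_on {0..} fq" "continuous_on {0..} gq"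
        unfolding fq_def gq_def by (intro contS_dq bl1_contS F G U h)+
      have shift: "continuous_on {0..} (\<lambda>t. u (t + h))" if "continuous_on {0..} u" for u :: "real \<Rightarrow> 'z::topological_space"
        by (rule continuous_on_compose2[OF that]) (use h in \<open>auto intro!: continuous_intros\<close>)
      note int = integrable_continuous_real[OF continuous_on_subset[where s = "{0..}" and t = "{0..\<tau>}"]]
      have sub: "{0..\<tau>} \<subseteq> {0..}" by auto
      let ?k = "\<lambda>t. inner (g t) (f t)"
      have ck: "continuous_on {0..} ?k" by (intro continuous_on_inner cont)
      \<comment> \<open>Discrete product rule. The first factor is unshifted and f is evaluated at t
        + h, so the quotient of <g, f> is exact with no remainder.\<close>
      have parts: "inner (g t) (fq t) = (1 / h) * (?k (t + h) - ?k t) - inner (gq t) (f (t + h))" if "t \<ge> 0" for t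
        unfolding fq[OF that] gq[OF that] by (simp add: inner_diff_left inner_diff_right algebra_simps)
      have i1: "(\<lambda>t. ?k (t + h)) integrable_on {0..\<tau>}" by (rule int[OF shift[OF ck] sub])
      have i2: "?k integrable_on {0..\<tau>}" by (rule int[OF ck sub])
      have i3: "(\<lambda>t. inner (gq t) (f (t + h))) integrable_on {0..\<tau>}"
        by (rule int[OF _ sub]) (intro continuous_on_inner contq shift cont)
      have i4: "(\<lambda>t. inner (g t) (fq t)) integrable_on {0..\<tau>}"
        by (rule int[OF _ sub]) (intro continuous_on_inner contq cont)
      have "integral {0..\<tau>} (\<lambda>t. inner (g t) (fq t)) =
          integral {0..\<tau>} (\<lambda>t. (1 / h) * (?k (t + h) - ?k t) - inner (gq t) (f (t + h)))"
        by (rule integral_cong) (simp add: parts)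
      also have "\<dots> = (1 / h) * (integral {0..\<tau>} (\<lambda>t. ?k (t + h)) - integral {0..\<tau>} ?k)
          - integral {0..\<tau>} (\<lambda>t. inner (gq t) (f (t + h)))"
        using i1 i2 i3 by (simp add: Henstock_Kurzweil_Integration.integral_diff
            Henstock_Kurzweil_Integration.integrable_diff integrable_on_mult_right divide_inverse)
      finally have e1: "integral {0..\<tau>} (\<lambda>t. inner (g t) (fq t)) =
          (1 / h) * (integral {0..\<tau>} (\<lambda>t. ?k (t + h)) - integral {0..\<tau>} ?k)
          - integral {0..\<tau>} (\<lambda>t. inner (gq t) (f (t + h)))" .
      have b1: "\<bar>(1 / h) * (integral {0..\<tau>} (\<lambda>t. ?k (t + h)) - integral {0..\<tau>} ?k)\<bar> \<le> 2 * B * data U"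
      proof -
        have "\<bar>?k t\<bar> \<le> B * data U" if "t \<ge> 0" for t
          using FG[OF D(1)[OF that]] mult_left_mono[OF data_S[OF U that] B0] by (simp add: f_def g_def)
        from integral_shift_S[OF ck this h \<tau>] show ?thesis
          using h by (simp add: abs_mult divide_simps) (simp add: mult_ac)
      qed
      \<comment> \<open>The quotient of G is paid by the two dissipations through \<open>GV\<close>,
        and the shifted f by a small multiple of the energy through \<open>FE\<close>.\<close>
      have b2: "\<bar>integral {0..\<tau>} (\<lambda>t. inner (gq t) (f (t + h)))\<bar>
          \<le> \<eta> * K * ?I + \<eta> * K * E U + Q * (E (A U) + \<epsilon>\<^sup>2 + E U + \<tau> * \<epsilon>\<^sup>2)"
      proof -
        have iE: "(\<lambda>t. E (S t U)) integrable_on {0..\<tau>}" by (rule contS_integrable[OF contS_E U]) simp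
        have id: "(\<lambda>t. damp (S t U)) integrable_on {0..\<tau>}" by (rule contS_integrable[OF contS_damp U]) simp
        have idh: "(\<lambda>t. damp (S (t + h) U)) integrable_on {0..\<tau>}"
          by (rule int[OF shift sub]) (use contS_damp U in \<open>auto simp: contS_def\<close>)
        have idq: "(\<lambda>t. damp (dq h (S t U))) integrable_on {0..\<tau>}"
          by (rule int[OF contS_dq[OF contS_damp U h] sub])
        let ?R = "\<lambda>t. \<eta> * K * (E (S t U) + damp (S (t + h) U)) + Q * (damp (dq h (S t U)) + damp (S t U) + \<epsilon>\<^sup>2)"
        have "\<bar>integral {0..\<tau>} (\<lambda>t. inner (gq t) (f (t + h)))\<bar> \<le> integral {0..\<tau>} ?R"
          unfolding real_norm_def[symmetric]
        proof (rule integral_norm_bound_integral[OF i3])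
          show "?R integrable_on {0..\<tau>}"
            by (intro Henstock_Kurzweil_Integration.integrable_add integrable_on_mult_right iE id idh idq integrable_const_ivl)
          fix t assume "t \<in> {0..\<tau>}"
          then have t: "t \<ge> 0" "t + h \<ge> 0" using h by auto
          have "norm (inner (gq t) (f (t + h))) \<le> norm (gq t) * norm (f (t + h))"
            using Cauchy_Schwarz_ineq2[of "gq t" "f (t + h)"] by simp
          also have "\<dots> \<le> \<eta> * (norm (f (t + h)))\<^sup>2 + (norm (gq t))\<^sup>2 / (4 * \<eta>)"
          proof -
            have "0 \<le> (2 * \<eta> * norm (f (t + h)) - norm (gq t))\<^sup>2 / (4 * \<eta>)" using \<eta> by simp
            also have "\<dots> = \<eta> * (norm (f (t + h)))\<^sup>2 + (norm (gq t))\<^sup>2 / (4 * \<eta>) - norm (gq t) * norm (f (t + h))"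
              using \<eta> by (simp add: power2_eq_square field_simps)
            finally show ?thesis by simp
          qed
          also have "\<dots> \<le> \<eta> * (K * (E (S t U) + damp (S (t + h) U)))
              + (K * (damp (dq h (S t U)) + damp (S t U) + \<epsilon>\<^sup>2)) / (4 * \<eta>)"
          proof (rule add_mono[OF mult_left_mono divide_right_mono])
            have "(norm (f (t + h)))\<^sup>2 \<le> K * (E (S (t + h) U) + damp (S (t + h) U))"
              unfolding f_def by (rule FE[OF D(1)[OF t(2)]])
            also have "\<dots> \<le> K * (E (S t U) + damp (S (t + h) U))"
              using E_S_le[of h "S t U"] h Sth[OF t(1)] domD(7)[OF D(1)[OF t(1)]]
              by (intro mult_left_mono add_right_mono K) auto
            finally show "(norm (f (t + h)))\<^sup>2 \<le> K * (E (S t U) + damp (S (t + h) U))" .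
            have "(norm (gq t))\<^sup>2 \<le> K * (damp (dq h (S t U)) + damp (S t U) + E (dq h (S t U) - A (S t U)))"
              unfolding gq_def by (rule GV[OF D(1,2)[OF t(1)]])
            also have "\<dots> \<le> K * (damp (dq h (S t U)) + damp (S t U) + \<epsilon>\<^sup>2)"
              unfolding \<epsilon>_def by (intro mult_left_mono add_left_mono K dq_estimates(2)[OF U h t(1)])
            finally show "(norm (gq t))\<^sup>2 \<le> K * (damp (dq h (S t U)) + damp (S t U) + \<epsilon>\<^sup>2)" .
          qed (use \<eta> in auto)
          also have "\<dots> = ?R t" by (simp add: Q_def)
          finally show "norm (inner (gq t) (f (t + h))) \<le> ?R t" .
        qed
        also have "integral {0..\<tau>} ?R = \<eta> * K * (?I + integral {0..\<tau>} (\<lambda>t. damp (S (t + h) U)))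
            + Q * (integral {0..\<tau>} (\<lambda>t. damp (dq h (S t U))) + integral {0..\<tau>} (\<lambda>t. damp (S t U)) + \<tau> * \<epsilon>\<^sup>2)"
          using \<tau> iE id idh idq
          by (simp add: Henstock_Kurzweil_Integration.integral_add integrable_const_ivl
              Henstock_Kurzweil_Integration.integrable_add integrable_on_mult_right)
        also have "\<dots> \<le> \<eta> * K * (?I + E U) + Q * (E (A U) + \<epsilon>\<^sup>2 + E U + \<tau> * \<epsilon>\<^sup>2)"
        proof (intro add_mono mult_left_mono)
          \<comment> \<open>The shifted dissipation is the dissipation of the orbit issued from S h
            U, whose energy is at most E U.\<close>
          have "integral {0..\<tau>} (\<lambda>t. damp (S (t + h) U)) = integral {0..\<tau>} (\<lambda>t. damp (S t (S h U)))"
            using S_S[of _ h U] h domD(7)[OF U] by (intro integral_cong) auto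
          also have "\<dots> \<le> E (S h U) / 2" by (rule integral_damp[OF S_dom(1)[OF U] \<tau>]) (use h in simp)
          also have "\<dots> \<le> E U" using E_S_le[of h U] h domD(7)[OF U] E_nonneg[of "S h U"] by simp
          finally show "integral {0..\<tau>} (\<lambda>t. damp (S (t + h) U)) \<le> E U" .
          show "integral {0..\<tau>} (\<lambda>t. damp (dq h (S t U))) \<le> E (A U) + \<epsilon>\<^sup>2"
            unfolding \<epsilon>_def by (rule integral_damp_dq[OF U h \<tau>])
          show "integral {0..\<tau>} (\<lambda>t. damp (S t U)) \<le> E U" using integral_damp[OF U \<tau>] E_nonneg[of U] by simp
        qed (use K Q \<eta> \<tau> in auto)
        finally show ?thesis by (simp add: algebra_simps)
      qed
      \<comment> \<open>The hypothesis \<open>GF\<close> replaces the quotient of F by the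
        functional X that stands for its time derivative.\<close>
      have b3: "\<bar>integral {0..\<tau>} (\<lambda>t. inner (g t) (fq t)) - integral {0..\<tau>} (\<lambda>t. X (S t U))\<bar> \<le> \<tau> * (K * sqrt (data U) * \<epsilon>)"
      proof -
        have iX: "(\<lambda>t. X (S t U)) integrable_on {0..\<tau>}" by (rule contS_integrable[OF X U]) simp
        have "\<bar>integral {0..\<tau>} (\<lambda>t. inner (g t) (fq t) - X (S t U))\<bar> \<le> integral {0..\<tau>} (\<lambda>t. K * sqrt (data U) * \<epsilon>)"
          unfolding real_norm_def[symmetric]
        proof (rule integral_norm_bound_integral[OF Henstock_Kurzweil_Integration.integrable_diff[OF i4 iX] integrable_const_ivl])
          fix t assume "t \<in> {0..\<tau>}"
          then have t: "t \<ge> 0" by simp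
          have "\<bar>inner (g t) (fq t) - X (S t U)\<bar> \<le> K * sqrt (data (S t U)) * N (dq h (S t U) - A (S t U))"
            unfolding g_def fq_def by (rule GF[OF D[OF t]])
          also have "\<dots> \<le> K * sqrt (data U) * \<epsilon>"
            using err_S[OF U t h] data_S[OF U t] K data_nonneg N_nonneg
            by (intro mult_mono) (auto simp: err_def \<epsilon>_def)
          finally show "norm (inner (g t) (fq t) - X (S t U)) \<le> K * sqrt (data U) * \<epsilon>" by simp
        qed
        then show ?thesis using \<tau> by (simp add: Henstock_Kurzweil_Integration.integral_diff[OF i4 iX] mult_ac)
      qed
      have "\<bar>integral {0..\<tau>} (\<lambda>t. X (S t U))\<bar> \<le> 2 * B * data U
          + (\<eta> * K * ?I + \<eta> * K * E U + Q * (E (A U) + \<epsilon>\<^sup>2 + E U + \<tau> * \<epsilon>\<^sup>2)) + \<tau> * (K * sqrt (data U) * \<epsilon>)"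
        using b1 b2 b3 e1 by linarith
      also have "\<dots> \<le> \<eta> * K * ?I + (\<eta> * K + 2 * Q + 2 * B) * data U + \<tau> * (K * sqrt (data U)) * \<epsilon> + Q * (1 + \<tau>) * \<epsilon>\<^sup>2"
      proof -
        have "\<eta> * K * E U \<le> \<eta> * K * data U" using \<eta> K by (intro mult_left_mono E_le_data) auto
        moreover have "Q * (E (A U) + \<epsilon>\<^sup>2 + E U + \<tau> * \<epsilon>\<^sup>2) \<le> 2 * Q * data U + Q * (1 + \<tau>) * \<epsilon>\<^sup>2"
          using mult_nonneg_nonneg[OF Q data_nonneg[of U]] by (simp add: data_def algebra_simps)
        ultimately show ?thesis by (simp add: algebra_simps)
      qed
      finally show "\<bar>integral {0..\<tau>} (\<lambda>t. X (S t U))\<bar> \<le> \<eta> * K * ?I + (\<eta> * K + 2 * Q + 2 * B) * data U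
          + \<tau> * (K * sqrt (data U)) * err U h + Q * (1 + \<tau>) * (err U h)\<^sup>2" by (simp add: \<epsilon>_def)
    qed
    have "integral {0..\<tau>} (\<lambda>t. c * X (S t U)) = c * integral {0..\<tau>} (\<lambda>t. X (S t U))" by simp
    also have "\<dots> \<le> \<bar>c\<bar> * \<bar>integral {0..\<tau>} (\<lambda>t. X (S t U))\<bar>"
      unfolding abs_mult[symmetric] by (rule abs_ge_self)
    also have "\<dots> \<le> \<bar>c\<bar> * (\<eta> * K * ?I + (\<eta> * K + 2 * Q + 2 * B) * data U)"
      by (rule mult_left_mono[OF main]) simp
    also have "\<dots> = (\<bar>c\<bar> * (\<eta> * K)) * ?I + C * data U" by (simp add: C_def algebra_simps)
    also have "\<dots> \<le> e * ?I + C * data U" using mult_right_mono[OF \<eta>K integral_E_nonneg[of \<tau> U]] by simp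
    finally show ?thesis .
  qed
  then show "\<exists>C. \<forall>U\<in>DA. \<forall>\<tau>\<ge>0. integral {0..\<tau>} (\<lambda>t. c * X (S t U))
      \<le> e * integral {0..\<tau>} (\<lambda>t. E (S t U)) + C * data U" by blast
qed

text \<open>With e = 1/2 the energy integral is absorbed on the left, leaving twice C times
  \<open>data\<close>. Monotonicity of E bounds t E (S t U) by this integral, and
  \<open>data U\<close> is at most the squared graph norm.\<close>

lemma absorbable_E_imp_decay:
  assumes "absorbable E"
  shows "\<exists>C>0. \<forall>t>0. \<forall>U\<in>DA. N (S t U) \<le> C / sqrt t * graph_norm r1 r2 k1 k2 D1 D2 U"
proof -
  obtain C where C0: "C \<ge> 0" "\<forall>U\<in>DA. \<forall>\<tau>\<ge>0.
     integral {0..\<tau>} (\<lambda>t. E (S t U)) \<le> (1 / 2) * integral {0..\<tau>} (\<lambda>t. E (S t U)) + C * data U"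
    using absorbable_bound[OF assms, of "1 / 2"] by auto
  note C = C0(1) C0(2)[rule_format]
  have "N (S t U) \<le> sqrt (2 * C + 1) / sqrt t * graph_norm r1 r2 k1 k2 D1 D2 U" if t: "t > 0" and U: "U \<in> DA" for t U
  proof -
    have "t * E (S t U) = integral {0..t} (\<lambda>s. E (S t U))" using t by simp
    also have "\<dots> \<le> integral {0..t} (\<lambda>s. E (S s U))"
    proof (rule integral_le)
      show "(\<lambda>s. E (S s U)) integrable_on {0..t}" by (rule contS_integrable[OF contS_E U]) simp
      fix s assume s: "s \<in> {0..t}"
      have "S t U = S (t - s) (S s U)" using S_S[of "t - s" s U] s domD(7)[OF U] by simp
      then show "E (S t U) \<le> E (S s U)" using E_S_le[of "t - s" "S s U"] S_H[of s U] s domD(7)[OF U] by simp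
    qed (rule integrable_const_ivl)
    also have "\<dots> \<le> 2 * C * data U" using C(2)[OF U less_imp_le[OF t]] by simp
    also have "\<dots> \<le> (2 * C + 1) * (graph_norm r1 r2 k1 k2 D1 D2 U)\<^sup>2"
    proof (rule mult_mono)
      have "data U \<le> (N U + N (A U))\<^sup>2"
        unfolding data_def E_N using mult_nonneg_nonneg[OF N_nonneg[of U] N_nonneg[of "A U"]] by (simp add: power2_sum)
      then show "data U \<le> (graph_norm r1 r2 k1 k2 D1 D2 U)\<^sup>2" by (simp add: graph_norm_def)
    qed (use C(1) data_nonneg in auto)
    finally have "E (S t U) \<le> (2 * C + 1) / t * (graph_norm r1 r2 k1 k2 D1 D2 U)\<^sup>2"
      using t by (simp add: field_simps)
    then have "sqrt (E (S t U)) \<le> sqrt ((2 * C + 1) / t * (graph_norm r1 r2 k1 k2 D1 D2 U)\<^sup>2)" by simp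
    also have "\<dots> = sqrt (2 * C + 1) / sqrt t * graph_norm r1 r2 k1 k2 D1 D2 U"
      using N_nonneg[of U] N_nonneg[of "A U"] by (simp add: real_sqrt_mult real_sqrt_divide graph_norm_def)
    finally show ?thesis by (simp add: N_E)
  qed
  then show ?thesis using C(1) by (intro exI[of _ "sqrt (2 * C + 1)"]) auto
qed

section \<open>Multiplier estimates\<close>

lemma damping_shear_le: "wsq D1 (shear (A U)) \<le> damp U"
  and damping_bend_le: "wsq D2 (bend (A U)) \<le> damp U"
  unfolding damp_def using inner_mult_nonneg[OF LD1 D1_nonneg] inner_mult_nonneg[OF LD2 D2_nonneg] by simp_all

lemma damping_forces:
  obtains K where "K \<ge> 0" "\<And>U. (norm (mult_l2 D1 (shear (A U))))\<^sup>2 \<le> K * damp U"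
    "\<And>U. (norm (mult_l2 D2 (bend (A U))))\<^sup>2 \<le> K * damp U"
proof -
  obtain K1 where K1: "K1 \<ge> 0" "\<And>f. (norm (mult_l2 D1 f))\<^sup>2 \<le> K1 * wsq D1 f"
    using damping_sq[OF LD1 D1_nonneg] by blast
  obtain K2 where K2: "K2 \<ge> 0" "\<And>f. (norm (mult_l2 D2 f))\<^sup>2 \<le> K2 * wsq D2 f"
    using damping_sq[OF LD2 D2_nonneg] by blast
  have a: "(norm (mult_l2 D1 (shear (A U))))\<^sup>2 \<le> (K1 + K2) * damp U"
    "(norm (mult_l2 D2 (bend (A U))))\<^sup>2 \<le> (K1 + K2) * damp U" for U
  proof -
    have "(norm (mult_l2 D1 (shear (A U))))\<^sup>2 \<le> K1 * damp U"
      by (rule order_trans[OF K1(2) mult_left_mono[OF damping_shear_le K1(1)]])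
    then show "(norm (mult_l2 D1 (shear (A U))))\<^sup>2 \<le> (K1 + K2) * damp U"
      using mult_nonneg_nonneg[OF K2(1) damp_nonneg[of U]] by (simp add: algebra_simps)
    have "(norm (mult_l2 D2 (bend (A U))))\<^sup>2 \<le> K2 * damp U"
      by (rule order_trans[OF K2(2) mult_left_mono[OF damping_bend_le K2(1)]])
    then show "(norm (mult_l2 D2 (bend (A U))))\<^sup>2 \<le> (K1 + K2) * damp U"
      using mult_nonneg_nonneg[OF K1(1) damp_nonneg[of U]] by (simp add: algebra_simps)
  qed
  show ?thesis using that[OF _ a] K1(1) K2(1) by simp
qed

lemma bl_E: assumes "bl F" obtains K where "K \<ge> 0" "\<And>U. U \<in> DA \<Longrightarrow> (norm (F U))\<^sup>2 \<le> K * E U"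
  using bl_bound_sq[OF assms] domD(7) by metis

lemma absorbable_inner_bl:
  assumes X: "absorbable X" and F: "contS F" and FX: "\<And>U. U \<in> DA \<Longrightarrow> (norm (F U))\<^sup>2 \<le> X U" and G: "bl G"
  shows "absorbable (\<lambda>U. c * inner (F U) (G U))"
proof -
  obtain K where "K \<ge> 0" "\<And>U. U \<in> DA \<Longrightarrow> (norm (G U))\<^sup>2 \<le> K * E U" using bl_E[OF G] by blast
  then show ?thesis by (intro absorbable_inner[OF X F contS_bl[OF G] FX])
qed

lemma absorbable_cong: "absorbable X \<Longrightarrow> contS Y \<Longrightarrow> (\<And>U. U \<in> DA \<Longrightarrow> Y U = X U) \<Longrightarrow> absorbable Y"
  by (rule absorbable_mono) auto

text \<open>For a multiplier \<open>(p, r)\<close> depending linearly on the state the form below is a total derivative, up to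
  the damping forces and the terms in which \<open>p\<close> and \<open>r\<close> are differentiated in time.\<close>

lemma absorbable_multiplier:
  assumes p: "bl p" "\<And>U. U \<in> H \<Longrightarrow> p U \<in> H10" and r: "bl r" "\<And>U. U \<in> H \<Longrightarrow> r U \<in> H10"
    and P: "bl P" "\<And>U. U \<in> DA \<Longrightarrow> wderiv (p U) + r U = P U"
    and R: "bl R" "\<And>U. U \<in> DA \<Longrightarrow> wderiv (r U) = R U"
    and X: "absorbable X" and pX: "\<And>U. U \<in> DA \<Longrightarrow> (norm (p (A U)))\<^sup>2 \<le> X U"
    and rX: "\<And>U. U \<in> DA \<Longrightarrow> (norm (r (A U)))\<^sup>2 \<le> X U"
  shows "absorbable (\<lambda>U. k1 * inner (shear U) (P U) + k2 * inner (bend U) (R U))"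
proof -
  obtain K where K: "K \<ge> 0" "\<And>U. (norm (mult_l2 D1 (shear (A U))))\<^sup>2 \<le> K * damp U"
    "\<And>U. (norm (mult_l2 D2 (bend (A U))))\<^sup>2 \<le> K * damp U" using damping_forces by blast
  let ?d1 = "\<lambda>U. inner (vel_v (A U)) (p U) + inner (vel_v U) (p (A U))"
  let ?d2 = "\<lambda>U. inner (vel_\<psi> (A U)) (r U) + inner (vel_\<psi> U) (r (A U))"
  have n: "absorbable (\<lambda>U. - r1 * ?d1 U)" "absorbable (\<lambda>U. - r2 * ?d2 U)"
    by (rule absorbable_total_derivative[OF bl_v p(1)], rule absorbable_total_derivative[OF bl_\<psi> r(1)])
  have m1: "absorbable (\<lambda>U. r1 * inner (p (A U)) (vel_v U))"
    by (rule absorbable_inner_bl[OF X contS_bl_A[OF p(1)] pX bl_v])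
  have m2: "absorbable (\<lambda>U. r2 * inner (r (A U)) (vel_\<psi> U))"
    by (rule absorbable_inner_bl[OF X contS_bl_A[OF r(1)] rX bl_\<psi>])
  have cD: "contS (\<lambda>U. mult_l2 D1 (shear (A U)))" "contS (\<lambda>U. mult_l2 D2 (bend (A U)))"
    by (intro contS_mult LD1 LD2 contS_comp)+
  have k: "absorbable (\<lambda>U. (-1) * inner (mult_l2 D1 (shear (A U))) (P U))" "absorbable (\<lambda>U. (-1) * inner (mult_l2 D2 (bend (A U))) (R U))"
    by (rule absorbable_inner_bl[OF absorbable_cmult[OF absorbable_damp K(1)] cD(1) K(2) P(1)],
        rule absorbable_inner_bl[OF absorbable_cmult[OF absorbable_damp K(1)] cD(2) K(3) R(1)])
  show ?thesis
  proof (rule absorbable_cong[OF absorbable_add[OF absorbable_add[OF n] absorbable_add[OF absorbable_add[OF m1 m2] absorbable_add[OF k]]]])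
    show "contS (\<lambda>U. k1 * inner (shear U) (P U) + k2 * inner (bend U) (R U))"
      by (intro contS_add contS_cmult contS_inner contS_comp contS_bl P(1) R(1))
    fix U assume U: "U \<in> DA"
    note d = domD[OF U]
    have "r1 * inner (vel_v (A U)) (p U) = - inner (stressT U) (wderiv (p U))"
      using inner_wderiv[OF d(5) p(2)[OF d(7)]] by (simp add: wderiv_stress)
    moreover have "r2 * inner (vel_\<psi> (A U)) (r U) = - inner (stressT U) (r U) - inner (stressR U) (R U)"
      using inner_wderiv[OF d(6) r(2)[OF d(7)]] by (simp add: wderiv_stress inner_add_left R(2)[OF U])
    moreover have "inner (stressT U) (wderiv (p U)) + inner (stressT U) (r U) = inner (stressT U) (P U)"
      by (simp add: inner_add_right[symmetric] P(2)[OF U])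
    moreover have "inner (stressT U) (P U) = k1 * inner (shear U) (P U) + inner (mult_l2 D1 (shear (A U))) (P U)"
      by (simp add: stressT_def inner_add_left)
    moreover have "inner (stressR U) (R U) = k2 * inner (bend U) (R U) + inner (mult_l2 D2 (bend (A U))) (R U)"
      by (simp add: stressR_def inner_add_left)
    ultimately show "k1 * inner (shear U) (P U) + k2 * inner (bend U) (R U) =
      (- r1 * ?d1 U + - r2 * ?d2 U)
      + ((r1 * inner (p (A U)) (vel_v U) + r2 * inner (r (A U)) (vel_\<psi> U))
      + ((-1) * inner (mult_l2 D1 (shear (A U))) (P U) + (-1) * inner (mult_l2 D2 (bend (A U))) (R U)))"
      by (simp add: algebra_simps inner_commute[of "vel_v U"] inner_commute[of "vel_\<psi> U"])
  qed
qed

text \<open>The multiplier solves the static problem with right side (D1 shear, D2 bend), so the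
  multiplier form becomes the damping-weighted strain energy. Differentiated in time, it solves the
  same problem with the damping forces as right side and is bounded by \<open>damp\<close>. Control
  of strain rates thus becomes control of the strains, low frequencies included.\<close>

lemma absorbable_static: "absorbable (\<lambda>U. wsq D1 (shear U) + wsq D2 (bend U))"
proof -
  obtain K where K: "K \<ge> 0" "\<And>U. (norm (mult_l2 D1 (shear (A U))))\<^sup>2 \<le> K * damp U"
    "\<And>U. (norm (mult_l2 D2 (bend (A U))))\<^sup>2 \<le> K * damp U" using damping_forces by blast
  obtain Zp Zr Wp Wr :: "l2 \<times> l2 \<Rightarrow> l2" where Z: "bounded_linear Zp" "bounded_linear Zr" "bounded_linear Wp" "bounded_linear Wr"
    "\<And>F. Zp F \<in> H10" "\<And>F. Zr F \<in> H10" "\<And>F. wderiv (Zp F) + Zr F = Wp F" "\<And>F. wderiv (Zr F) = Wr F"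
    "\<And>F1 F2 w \<phi>. w \<in> H10 \<Longrightarrow> \<phi> \<in> H10 \<Longrightarrow>
      k1 * inner (wderiv w + \<phi>) (Wp (F1, F2)) + k2 * inner (wderiv \<phi>) (Wr (F1, F2))
      = inner (wderiv w + \<phi>) F1 + inner (wderiv \<phi>) F2"
    by (rule static_problem[OF k1 k2]) blast
  let ?F = "\<lambda>U. (mult_l2 D1 (shear U), mult_l2 D2 (bend U))"
  have b: "bl (\<lambda>U. L (?F U))" if "bounded_linear L" for L
    by (intro bl_pair[OF that] bl_mult LD1 LD2 bl_shear bl_bend)
  obtain L1 where L1: "L1 \<ge> 0" "\<And>f g. (norm (Zp (f, g)))\<^sup>2 \<le> L1 * ((norm f)\<^sup>2 + (norm g)\<^sup>2)"
    using bounded_linear_pair_sq[OF Z(1)] by blast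
  obtain L2 where L2: "L2 \<ge> 0" "\<And>f g. (norm (Zr (f, g)))\<^sup>2 \<le> L2 * ((norm f)\<^sup>2 + (norm g)\<^sup>2)"
    using bounded_linear_pair_sq[OF Z(2)] by blast
  let ?C = "(L1 + L2) * (2 * K)"
  have le: "L * ((norm (mult_l2 D1 (shear (A U))))\<^sup>2 + (norm (mult_l2 D2 (bend (A U))))\<^sup>2) \<le> ?C * damp U"
    if "0 \<le> L" "L \<le> L1 + L2" for L U
  proof -
    have "(norm (mult_l2 D1 (shear (A U))))\<^sup>2 + (norm (mult_l2 D2 (bend (A U))))\<^sup>2 \<le> 2 * K * damp U"
      using K(2)[of U] K(3)[of U] by linarith
    then have "L * ((norm (mult_l2 D1 (shear (A U))))\<^sup>2 + (norm (mult_l2 D2 (bend (A U))))\<^sup>2) \<le> (L1 + L2) * (2 * K * damp U)"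
      using that by (intro mult_mono) auto
    then show ?thesis by (simp only: mult.assoc)
  qed
  have X: "absorbable (\<lambda>U. ?C * damp U)" by (intro absorbable_cmult absorbable_damp) (use K(1) L1(1) L2(1) in simp)
  have "absorbable (\<lambda>U. k1 * inner (shear U) (Wp (?F U)) + k2 * inner (bend U) (Wr (?F U)))"
  proof (rule absorbable_multiplier[OF b[OF Z(1)] Z(5) b[OF Z(2)] Z(6) b[OF Z(3)] Z(7) b[OF Z(4)] Z(8) X])
    fix U
    show "(norm (Zp (?F (A U))))\<^sup>2 \<le> ?C * damp U"
      by (rule order_trans[OF L1(2) le]) (use L1(1) L2(1) in auto)
    show "(norm (Zr (?F (A U))))\<^sup>2 \<le> ?C * damp U"
      by (rule order_trans[OF L2(2) le]) (use L1(1) L2(1) in auto)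
  qed
  then show ?thesis
  proof (rule absorbable_cong)
    show "contS (\<lambda>U. wsq D1 (shear U) + wsq D2 (bend U))"
      by (intro contS_add contS_inner contS_mult contS_comp LD1 LD2)
    fix U assume U: "U \<in> DA"
    show "wsq D1 (shear U) + wsq D2 (bend U)
        = k1 * inner (shear U) (Wp (?F U)) + k2 * inner (bend U) (Wr (?F U))"
      using Z(9)[OF domD(1,2)[OF U], of "mult_l2 D1 (shear U)" "mult_l2 D2 (bend U)"]
      by (simp add: shear_def bend_def inner_commute)
  qed
qed

text \<open>\<open>damping_stress\<close> splits each weighted stress into its elastic part, handled
  by \<open>absorbable_static\<close>, and its damping part, handled by \<open>damp\<close>.\<close>

lemma absorbable_stress_damped:
  "absorbable (\<lambda>U. wsq D1 (stressT U))" "absorbable (\<lambda>U. wsq D2 (stressR U))"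
proof -
  have n: "0 \<le> wsq D1 f" "0 \<le> wsq D2 f" for f
    by (rule inner_mult_nonneg[OF LD1 D1_nonneg], assumption+, rule inner_mult_nonneg[OF LD2 D2_nonneg])
  let ?X = "\<lambda>U. wsq D1 (shear U) + wsq D2 (bend U)"
  obtain K1 where K1: "K1 \<ge> 0" "\<And>f g. wsq D1 (k1 *\<^sub>R f + mult_l2 D1 g)
    \<le> K1 * (wsq D1 f + wsq D1 g)" using damping_stress[OF LD1 D1_nonneg k1] by blast
  obtain K2 where K2: "K2 \<ge> 0" "\<And>f g. wsq D2 (k2 *\<^sub>R f + mult_l2 D2 g)
    \<le> K2 * (wsq D2 f + wsq D2 g)" using damping_stress[OF LD2 D2_nonneg k2] by blast
  show "absorbable (\<lambda>U. wsq D1 (stressT U))"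
  proof (rule absorbable_mono[OF absorbable_cmult[OF absorbable_add[OF absorbable_static absorbable_damp] K1(1)]])
    show "contS (\<lambda>U. wsq D1 (stressT U))"
      by (intro contS_inner contS_mult LD1 contS_T)
    fix U
    show "wsq D1 (stressT U) \<le> K1 * (?X U + damp U)"
      unfolding stressT_def
      by (rule order_trans[OF K1(2) mult_left_mono[OF _ K1(1)]])
         (use damping_shear_le[of U] n(2)[of "bend U"] in simp)
  qed
  show "absorbable (\<lambda>U. wsq D2 (stressR U))"
  proof (rule absorbable_mono[OF absorbable_cmult[OF absorbable_add[OF absorbable_static absorbable_damp] K2(1)]])
    show "contS (\<lambda>U. wsq D2 (stressR U))"
      by (intro contS_inner contS_mult LD2 contS_R)
    fix U
    show "wsq D2 (stressR U) \<le> K2 * (?X U + damp U)"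
      unfolding stressR_def
      by (rule order_trans[OF K2(2) mult_left_mono[OF _ K2(1)]])
         (use damping_bend_le[of U] n(1)[of "shear U"] in simp)
  qed
qed

text \<open>Equipartition with the multiplier m w: since v is the time derivative of w, <m v, v> is
  a total derivative minus <v_t, m w>. The equation r1 v_t = T' and integration by parts turn the
  latter into stress terms with weights m and m'.\<close>

lemma absorbable_velocity:
  assumes m: "smooth m" and X: "absorbable X"
    and 1: "\<And>U. U \<in> DA \<Longrightarrow> (norm (mult_l2 m (stressT U)))\<^sup>2 \<le> X U"
    and 2: "\<And>U. U \<in> DA \<Longrightarrow> (norm (mult_l2 (vder m) (stressT U)))\<^sup>2 \<le> X U"
  shows "absorbable (\<lambda>U. wsq m (vel_v U))"
proof -
  note L = Linfty_smooth[OF m] Linfty_smooth[OF smooth_vder[OF m]]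
  have n: "absorbable (\<lambda>U. 1 * (inner (vel_v (A U)) (mult_l2 m (pos_w U)) + inner (vel_v U) (mult_l2 m (pos_w (A U)))))"
    by (rule absorbable_total_derivative[OF bl_v bl_mult[OF L(1) bl_w]])
  have n1: "absorbable (\<lambda>U. (1 / r1) * inner (mult_l2 (vder m) (stressT U)) (pos_w U))"
    by (rule absorbable_inner_bl[OF X contS_mult[OF L(2) contS_T] 2 bl_w])
  have n2: "absorbable (\<lambda>U. (1 / r1) * inner (mult_l2 m (stressT U)) (shear U - pos_\<phi> U))"
    by (rule absorbable_inner_bl[OF X contS_mult[OF L(1) contS_T] 1 bl_diff[OF bl_shear bl_\<phi>]])
  show ?thesis
  proof (rule absorbable_cong[OF absorbable_add[OF n absorbable_add[OF n1 n2]]])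
    show "contS (\<lambda>U. wsq m (vel_v U))" by (intro contS_inner contS_mult L contS_comp)
    fix U assume U: "U \<in> DA"
    note d = domD[OF U]
    have "r1 * inner (vel_v (A U)) (mult_l2 m (pos_w U)) =
        - inner (mult_l2 (vder m) (stressT U)) (pos_w U) - inner (mult_l2 m (stressT U)) (shear U - pos_\<phi> U)"
      using inner_wderiv[OF d(5) H10_mult[OF m d(1)]]
      by (simp add: wderiv_stress H1_mult(2)[OF m H10_H1[OF d(1)]] wderiv_w inner_add_right inner_mult_commute L)
    then have "inner (vel_v (A U)) (mult_l2 m (pos_w U)) = (1 / r1) *
        (- inner (mult_l2 (vder m) (stressT U)) (pos_w U) - inner (mult_l2 m (stressT U)) (shear U - pos_\<phi> U))"
      using r1 by (simp add: field_simps)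
    then show "wsq m (vel_v U) =
      1 * (inner (vel_v (A U)) (mult_l2 m (pos_w U)) + inner (vel_v U) (mult_l2 m (pos_w (A U)))) +
      ((1 / r1) * inner (mult_l2 (vder m) (stressT U)) (pos_w U) +
       (1 / r1) * inner (mult_l2 m (stressT U)) (shear U - pos_\<phi> U))"
      by (simp add: A_simps inner_mult_commute[OF L(1)] algebra_simps)
  qed
qed

text \<open>Typically F is a velocity, so F (A U) is an acceleration and not bounded by the energy.
  The derivative is shifted onto G, whose difference quotient the two dissipations control.\<close>

lemma absorbable_shift_bl:
  assumes F: "bl F" and G: "bl1 G"
    and GV: "\<And>U V. U \<in> DA \<Longrightarrow> V \<in> DA \<Longrightarrow> (norm (G V))\<^sup>2 \<le> K * (damp V + damp U + E (V - A U))" and K: "K \<ge> 0"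
  shows "absorbable (\<lambda>U. c * inner (G U) (F (A U)))"
proof -
  obtain K1 where K1: "K1 \<ge> 0" "\<And>U. U \<in> DA \<Longrightarrow> (norm (F U))\<^sup>2 \<le> K1 * E U" using bl_E[OF F] by blast
  obtain K2 where K2: "K2 \<ge> 0" "\<And>U. U \<in> H \<Longrightarrow> norm (F U) \<le> K2 * N U" using bl_bound[OF F] by blast
  obtain K3 where K3: "K3 \<ge> 0" "\<And>U. U \<in> DA \<Longrightarrow> (norm (G U))\<^sup>2 \<le> K3 * data U" using bl1_bound[OF G] by blast
  let ?K = "K + K1 + sqrt K3 * K2"
  have s: "0 \<le> sqrt K3 * K2" using K2(1) K3(1) by simp
  show ?thesis
  proof (rule absorbable_shift[OF bl1_bl[OF F] G contS_inner[OF bl1_contS[OF G] contS_bl_A[OF F]], where K = ?K])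
    show "?K \<ge> 0" using K K1(1) s by simp
    fix U assume U: "U \<in> DA"
    have "(norm (F U))\<^sup>2 \<le> K1 * (E U + damp U)"
      using K1(2)[OF U] mult_nonneg_nonneg[OF K1(1) damp_nonneg[of U]] by (simp add: distrib_left)
    also have "\<dots> \<le> ?K * (E U + damp U)"
      using K s E_nonneg[of U] damp_nonneg[of U] by (intro mult_right_mono) auto
    finally show "(norm (F U))\<^sup>2 \<le> ?K * (E U + damp U)" .
    fix V assume V: "V \<in> DA"
    have "(norm (G V))\<^sup>2 \<le> K * (damp V + damp U + E (V - A U))" by (rule GV[OF U V])
    also have "\<dots> \<le> ?K * (damp V + damp U + E (V - A U))"
      using K1(1) s E_nonneg damp_nonneg by (intro mult_right_mono add_nonneg_nonneg) auto
    finally show "(norm (G V))\<^sup>2 \<le> ?K * (damp V + damp U + E (V - A U))" .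
    have VA: "V - A U \<in> H" by (rule subspace_diff[OF subspace_energy_space domD(7)[OF V] domD(8)[OF U]])
    have "\<bar>inner (G U) (F V) - inner (G U) (F (A U))\<bar> = \<bar>inner (G U) (F (V - A U))\<bar>"
      by (simp add: bl_diff_eq[OF F domD(7)[OF V] domD(8)[OF U]] inner_diff_right)
    also have "\<dots> \<le> norm (G U) * norm (F (V - A U))" by (rule Cauchy_Schwarz_ineq2)
    also have "\<dots> \<le> (sqrt K3 * sqrt (data U)) * (K2 * N (V - A U))"
    proof (rule mult_mono)
      show "norm (G U) \<le> sqrt K3 * sqrt (data U)"
        using real_le_rsqrt[OF K3(2)[OF U]] by (simp add: real_sqrt_mult)
    qed (use K2(2)[OF VA] K3(1) data_nonneg in auto)
    also have "\<dots> = (sqrt K3 * K2) * (sqrt (data U) * N (V - A U))" by simp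
    also have "\<dots> \<le> ?K * (sqrt (data U) * N (V - A U))"
      using K K1(1) data_nonneg N_nonneg by (intro mult_right_mono mult_nonneg_nonneg) auto
    finally show "\<bar>inner (G U) (F V) - inner (G U) (F (A U))\<bar> \<le> ?K * sqrt (data U) * N (V - A U)" by simp
  qed
qed

section \<open>Propagation from the strip to the whole beam\<close>

lemma absorbable_weighted_forces:
  assumes q: "Linfty q" and F: "bl F"
  shows "absorbable (\<lambda>U. c * inner (mult_l2 q (mult_l2 D1 (shear (A U)))) (F (A U)))"
    "absorbable (\<lambda>U. c * inner (mult_l2 q (mult_l2 D2 (bend (A U)))) (F (A U)))"
proof -
  obtain K where K: "K \<ge> 0" "\<And>U. (norm (mult_l2 D1 (shear (A U))))\<^sup>2 \<le> K * damp U"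
    "\<And>U. (norm (mult_l2 D2 (bend (A U))))\<^sup>2 \<le> K * damp U" using damping_forces by blast
  obtain M where M: "M \<ge> 0" "\<And>f. (norm (mult_l2 q f))\<^sup>2 \<le> M * (norm f)\<^sup>2" using bounded_mult_sq[OF q] by blast
  \<comment> \<open>The force of the quotient V is bounded by its own dissipation; the other two
    summands are added only to match the form required by the shift lemma.\<close>
  have le: "(norm (mult_l2 q f))\<^sup>2 \<le> (M * K) * (damp V + damp U + E (V - A U))" if "(norm f)\<^sup>2 \<le> K * damp V" for f U V
  proof -
    have "(norm (mult_l2 q f))\<^sup>2 \<le> M * (K * damp V)"
      by (rule order_trans[OF M(2) mult_left_mono[OF that M(1)]])
    also have "\<dots> \<le> M * (K * (damp V + damp U + E (V - A U)))"
      using damp_nonneg[of U] E_nonneg[of "V - A U"] by (intro mult_left_mono M K) simp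
    finally show ?thesis by simp
  qed
  show "absorbable (\<lambda>U. c * inner (mult_l2 q (mult_l2 D1 (shear (A U)))) (F (A U)))"
    by (rule absorbable_shift_bl[OF F bl1_A[OF bl_mult[OF q bl_mult[OF LD1 bl_shear]]] le[OF K(2)]]) (use M K in simp)
  show "absorbable (\<lambda>U. c * inner (mult_l2 q (mult_l2 D2 (bend (A U)))) (F (A U)))"
    by (rule absorbable_shift_bl[OF F bl1_A[OF bl_mult[OF q bl_mult[OF LD2 bl_bend]]] le[OF K(3)]]) (use M K in simp)
qed

text \<open>Stresses replace strains because only the stresses are known to be in \<open>H1\<close>,
  so only they can be differentiated. The factors r1 k1 and r2 k2 put the velocities on the scale of
  squared stresses.\<close>

definition energy_density :: "(real \<Rightarrow> real) \<Rightarrow> state \<Rightarrow> real" where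
  "energy_density m U = wsq m (stressT U) + wsq m (stressR U)
    + r1 * k1 * wsq m (vel_v U) + r2 * k2 * wsq m (vel_\<psi> U)"

lemma energy_density_linear:
  assumes "Linfty m" "Linfty n"
  shows "energy_density (\<lambda>x. m x + c * n x) U = energy_density m U + c * energy_density n U"
  using assms by (simp add: energy_density_def mult_l2_add_left mult_l2_cmult Linfty_cmult inner_add_left algebra_simps)

lemma energy_density_mono:
  assumes "Linfty m" "Linfty n" "\<And>x. -1 < x \<Longrightarrow> x < 1 \<Longrightarrow> m x \<le> n x"
  shows "energy_density m U \<le> energy_density n U"
  unfolding energy_density_def using r1 r2 k1 k2
  by (intro add_mono mult_left_mono inner_mult_mono assms) auto

text \<open>The momentum equations are tested with q times the strains. Integration by parts puts q'
  on the energy density. What remains are total derivatives, damping forces against accelerations,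
  and coupling terms of order zero weighted by |q|, which the choice of q absorbs.\<close>

lemma absorbable_E_from_strip:
  assumes strip: "absorbable (energy_density zeta)"
  shows "absorbable E"
proof -
  \<comment> \<open>The coupling <q v, \<psi>> enters with factor r1 k1, whereas \<psi> is weighted
    by r2 k2 in the density. This K makes r1 k1 at most K times each of the two velocity
    weights.\<close>
  define K where "K = 1 + (r1 * k1) / (r2 * k2)"
  have K: "K \<ge> 1" using r1 r2 k1 k2 by (simp add: K_def)
  obtain q c C where q: "smooth q" "q 1 = 0" "q (-1) = (0::real)" "c > 0" "C \<ge> 0"
    "\<And>x. -1 < x \<Longrightarrow> x < 1 \<Longrightarrow> c \<le> vder q x - K * \<bar>q x\<bar> + C * zeta x"
    using weight_exists[of K] K by auto
  note L = Linfty_smooth[OF q(1)] Linfty_smooth[OF smooth_vder[OF q(1)]] Linfty_abs[OF Linfty_smooth[OF q(1)]]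
    Linfty_smooth[OF smooth_zeta]
  let ?a = "\<lambda>x. \<bar>q x\<bar>"
  let ?d1 = "\<lambda>U. inner (vel_v (A U)) (mult_l2 q (shear U)) + inner (vel_v U) (mult_l2 q (shear (A U)))"
  let ?d2 = "\<lambda>U. inner (vel_\<psi> (A U)) (mult_l2 q (bend U)) + inner (vel_\<psi> U) (mult_l2 q (bend (A U)))"
  let ?f1 = "\<lambda>U. inner (mult_l2 q (mult_l2 D1 (shear (A U)))) (vel_v (A U))"
  let ?f2 = "\<lambda>U. inner (mult_l2 q (mult_l2 D2 (bend (A U)))) (vel_\<psi> (A U))"
  \<comment> \<open>The first pair consists of total derivatives of <v, q shear> and <\<psi>, q
    bend>. The second pair cancels the damping forces left over when k1 shear and k2 bend are
    replaced by the stresses.\<close>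
  let ?n = "\<lambda>U. ((- 2 * r1 * k1) * ?d1 U + (- 2 * r2 * k2) * ?d2 U) + ((- 2 * r1) * ?f1 U + (- 2 * r2) * ?f2 U)"
  have n: "absorbable ?n"
    by (intro absorbable_add absorbable_total_derivative absorbable_weighted_forces bl_v bl_\<psi> bl_mult bl_shear bl_bend L)
  have ineq: "energy_density (vder q) U - K * energy_density ?a U \<le> ?n U" if U: "U \<in> DA" for U
  proof -
    note d = domD[OF U]
    let ?T = "stressT U" and ?R = "stressR U" and ?v = "vel_v U" and ?p = "vel_\<psi> U"
    interpret Q: bounded_linear "mult_l2 q" by (rule bounded_linear_mult_l2[OF L(1)])
    have T: "2 * inner (mult_l2 q (wderiv ?T)) ?T = - wsq (vder q) ?T"
      by (rule inner_mult_wderiv[OF q(1-3) d(5)])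
    have R: "2 * inner (mult_l2 q (wderiv ?R)) ?R = - wsq (vder q) ?R"
      by (rule inner_mult_wderiv[OF q(1-3) d(6)])
    have v: "2 * inner (mult_l2 q (wderiv ?v)) ?v = - wsq (vder q) ?v"
      by (rule inner_mult_wderiv_H10[OF q(1) d(3)])
    have p: "2 * inner (mult_l2 q (wderiv ?p)) ?p = - wsq (vder q) ?p"
      by (rule inner_mult_wderiv_H10[OF q(1) d(4)])
    have ks: "k1 *\<^sub>R shear U = ?T - mult_l2 D1 (shear (A U))" "k2 *\<^sub>R bend U = ?R - mult_l2 D2 (bend (A U))"
      by (simp_all add: stressT_def stressR_def)
    have e1: "r1 * k1 * inner (vel_v (A U)) (mult_l2 q (shear U)) = inner (mult_l2 q (wderiv ?T)) ?T - r1 * ?f1 U"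
    proof -
      have "r1 * k1 * inner (vel_v (A U)) (mult_l2 q (shear U)) = inner (wderiv ?T) (mult_l2 q (k1 *\<^sub>R shear U))"
        by (simp add: wderiv_stress Q.scaleR)
      also have "\<dots> = inner (mult_l2 q (wderiv ?T)) ?T - r1 * ?f1 U"
        unfolding ks by (simp add: Q.diff inner_diff_right inner_mult_commute[OF L(1)] wderiv_stress inner_commute Q.scaleR)
      finally show ?thesis .
    qed
    have e2: "r1 * k1 * inner ?v (mult_l2 q (shear (A U))) = r1 * k1 * inner (mult_l2 q (wderiv ?v)) ?v + r1 * k1 * inner (mult_l2 q ?v) ?p"
    proof -
      have "shear (A U) = wderiv ?v + ?p" by (simp add: A_simps)
      then show ?thesis
        by (simp add: Q.add inner_add_right inner_mult_commute[OF L(1)] distrib_left inner_commute[of ?v])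
    qed
    have e3: "r2 * k2 * inner (vel_\<psi> (A U)) (mult_l2 q (bend U)) = inner (mult_l2 q (wderiv ?R)) ?R - inner (mult_l2 q ?T) ?R - r2 * ?f2 U"
    proof -
      have w: "r2 *\<^sub>R vel_\<psi> (A U) = wderiv ?R - ?T" by (simp add: wderiv_stress)
      have "r2 * k2 * inner (vel_\<psi> (A U)) (mult_l2 q (bend U)) = inner (mult_l2 q (r2 *\<^sub>R vel_\<psi> (A U))) (k2 *\<^sub>R bend U)"
        by (simp add: Q.scaleR inner_mult_commute[OF L(1)])
      also have "\<dots> = inner (mult_l2 q (wderiv ?R - ?T)) ?R - inner (mult_l2 q (r2 *\<^sub>R vel_\<psi> (A U))) (mult_l2 D2 (bend (A U)))"
        unfolding ks w by (simp add: inner_diff_right)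
      also have "inner (mult_l2 q (r2 *\<^sub>R vel_\<psi> (A U))) (mult_l2 D2 (bend (A U))) = r2 * ?f2 U"
        unfolding Q.scaleR inner_scaleR_left inner_mult_commute[OF L(1), of "vel_\<psi> (A U)"] by (simp add: inner_commute)
      finally show ?thesis by (simp add: Q.diff inner_diff_left)
    qed
    have e4: "r2 * k2 * inner ?p (mult_l2 q (bend (A U))) = r2 * k2 * inner (mult_l2 q (wderiv ?p)) ?p"
      unfolding A_simps by (simp add: inner_commute)
    have i1: "2 * inner (mult_l2 q ?v) ?p \<le> wsq ?a ?v + wsq ?a ?p"
      by (rule inner_mult_le_abs[OF L(1)])
    have i2: "- 2 * inner (mult_l2 q ?T) ?R \<le> wsq ?a ?T + wsq ?a ?R"
    proof -
      interpret Q': bounded_linear "mult_l2 ?a" by (rule bounded_linear_mult_l2[OF L(3)])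
      have "2 * inner (mult_l2 q (- ?T)) ?R \<le> wsq ?a (- ?T) + wsq ?a ?R"
        by (rule inner_mult_le_abs[OF L(1)])
      then show ?thesis by (simp add: Q.neg Q'.neg)
    qed
    have nn: "0 \<le> wsq ?a f" for f by (rule inner_mult_nonneg[OF L(3)]) simp
    \<comment> \<open>An exact identity: the two terms besides \<open>?n\<close> are the only
      coupling, one from v' = shear rate - \<psi>, the other from T in the equation for R'.\<close>
    have "energy_density (vder q) U = ?n U + r1 * k1 * (2 * inner (mult_l2 q ?v) ?p) + (- 2 * inner (mult_l2 q ?T) ?R)"
    proof -
      have v': "r1 * k1 * wsq (vder q) ?v = - 2 * (r1 * k1 * inner (mult_l2 q (wderiv ?v)) ?v)"
        using v by (simp add: algebra_simps)
      have p': "r2 * k2 * wsq (vder q) ?p = - 2 * (r2 * k2 * inner (mult_l2 q (wderiv ?p)) ?p)"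
        using p by (simp add: algebra_simps)
      have nd: "?n U = - 2 * (r1 * k1 * inner (vel_v (A U)) (mult_l2 q (shear U)) + r1 * k1 * inner ?v (mult_l2 q (shear (A U))))
        - 2 * (r2 * k2 * inner (vel_\<psi> (A U)) (mult_l2 q (bend U)) + r2 * k2 * inner ?p (mult_l2 q (bend (A U))))
        - 2 * (r1 * ?f1 U) - 2 * (r2 * ?f2 U)"
        by (simp only: distrib_left distrib_right mult.assoc)
      show ?thesis unfolding energy_density_def nd v' p' e1 e2 e3 e4 using T R by (simp add: algebra_simps)
    qed
    also have "\<dots> \<le> ?n U + r1 * k1 * (wsq ?a ?v + wsq ?a ?p)
        + (wsq ?a ?T + wsq ?a ?R)"
      using r1 k1 by (intro add_mono order_refl mult_left_mono i1 i2) auto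
    also have "\<dots> \<le> ?n U + K * energy_density ?a U"
    proof -
      have k: "r1 * k1 \<le> K * (r1 * k1)" using K r1 k1 by simp
      have "K * (r2 * k2) = r2 * k2 + r1 * k1" using r2 k2 by (simp add: K_def field_simps)
      then have k': "r1 * k1 \<le> K * (r2 * k2)" using r2 k2 by simp
      have "r1 * k1 * wsq ?a ?v \<le> K * (r1 * k1) * wsq ?a ?v"
        "r1 * k1 * wsq ?a ?p \<le> K * (r2 * k2) * wsq ?a ?p"
        "1 * wsq ?a ?T \<le> K * wsq ?a ?T"
        "1 * wsq ?a ?R \<le> K * wsq ?a ?R"
        by (intro mult_right_mono nn k k' K)+
      then show ?thesis by (simp add: energy_density_def algebra_simps)
    qed
    finally show ?thesis by simp
  qed
  obtain M where M: "M \<ge> 0" "\<And>U. (norm (mult_l2 D1 (shear (A U))))\<^sup>2 \<le> M * damp U"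
    "\<And>U. (norm (mult_l2 D2 (bend (A U))))\<^sup>2 \<le> M * damp U" using damping_forces by blast
  have bound: "c * energy_density (\<lambda>x. 1) U \<le> ?n U + C * energy_density zeta U" if U: "U \<in> DA" for U
  proof -
    have "energy_density (\<lambda>x. c) U = c * energy_density (\<lambda>x. 1) U"
      by (simp add: energy_density_def mult_l2_const algebra_simps)
    moreover have "energy_density (\<lambda>x. c) U \<le> energy_density (\<lambda>x. (vder q x + (- K) * \<bar>q x\<bar>) + C * zeta x) U"
      by (rule energy_density_mono[OF Linfty_const Linfty_add[OF Linfty_add[OF L(2) Linfty_cmult[OF L(3)]] Linfty_cmult[OF L(4)]]])
         (use q(6) in auto)
    moreover have "\<dots> = energy_density (vder q) U + (- K) * energy_density ?a U + C * energy_density zeta U"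
      by (simp only: energy_density_linear[OF Linfty_add[OF L(2) Linfty_cmult[OF L(3)]] L(4)] energy_density_linear[OF L(2,3)])
    ultimately show ?thesis using ineq[OF U] by simp
  qed
  \<comment> \<open>The strains are recovered from the stresses by subtracting the damping forces,
    which costs a factor 2 and a multiple of \<open>damp\<close>.\<close>
  define B where "B = 2 * (1 / k1) + 2 * (1 / k2)"
  define B' where "B' = (2 / k1 + 2 / k2) * M"
  have B: "B \<ge> 0" "B' \<ge> 0" using k1 k2 M(1) by (simp_all add: B_def B'_def)
  have EB: "E U \<le> B * energy_density (\<lambda>x. 1) U + B' * damp U" for U
  proof -
    have one: "energy_density (\<lambda>x. 1) U = (norm (stressT U))\<^sup>2 + (norm (stressR U))\<^sup>2
        + r1 * k1 * (norm (vel_v U))\<^sup>2 + r2 * k2 * (norm (vel_\<psi> U))\<^sup>2"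
      by (simp add: energy_density_def mult_l2_const power2_norm_eq_inner)
    have s: "k * (norm f)\<^sup>2 \<le> (2 / k) * (norm (k *\<^sub>R f + g))\<^sup>2 + (2 / k) * (M * damp U)"
      if k: "k > 0" and g: "(norm g)\<^sup>2 \<le> M * damp U" for k and f g :: l2
    proof -
      have "(norm (k *\<^sub>R f))\<^sup>2 \<le> 2 * (norm (k *\<^sub>R f + g))\<^sup>2 + 2 * (norm (- g))\<^sup>2"
        using norm_add_sq_le[of "k *\<^sub>R f + g" "- g"] by simp
      then have "k * (k * (norm f)\<^sup>2) \<le> 2 * (norm (k *\<^sub>R f + g))\<^sup>2 + 2 * (M * damp U)"
        using g k by (simp add: power_mult_distrib power2_eq_square[of k] mult.assoc)
      then have "(1 / k) * (k * (k * (norm f)\<^sup>2)) \<le> (1 / k) * (2 * (norm (k *\<^sub>R f + g))\<^sup>2 + 2 * (M * damp U))"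
        using k by (intro mult_left_mono) auto
      then show ?thesis using k by (simp add: distrib_left)
    qed
    have 1: "k1 * (norm (shear U))\<^sup>2 \<le> (2 / k1) * (norm (stressT U))\<^sup>2 + (2 / k1) * (M * damp U)"
      unfolding stressT_def by (rule s[OF k1 M(2)])
    have 2: "k2 * (norm (bend U))\<^sup>2 \<le> (2 / k2) * (norm (stressR U))\<^sup>2 + (2 / k2) * (M * damp U)"
      unfolding stressR_def by (rule s[OF k2 M(3)])
    have 3: "r1 * (norm (vel_v U))\<^sup>2 = (1 / k1) * (r1 * k1 * (norm (vel_v U))\<^sup>2)"
      "r2 * (norm (vel_\<psi> U))\<^sup>2 = (1 / k2) * (r2 * k2 * (norm (vel_\<psi> U))\<^sup>2)" using k1 k2 by simp_all
    have "0 \<le> 1 / k1" "0 \<le> 1 / k2" "2 / k1 = 2 * (1 / k1)" "2 / k2 = 2 * (1 / k2)" using k1 k2 by simp_all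
    then have b: "2 / k1 \<le> B" "2 / k2 \<le> B" "1 / k1 \<le> B" "1 / k2 \<le> B" unfolding B_def by linarith+
    have "(2 / k1) * (norm (stressT U))\<^sup>2 \<le> B * (norm (stressT U))\<^sup>2"
      "(2 / k2) * (norm (stressR U))\<^sup>2 \<le> B * (norm (stressR U))\<^sup>2"
      "(1 / k1) * (r1 * k1 * (norm (vel_v U))\<^sup>2) \<le> B * (r1 * k1 * (norm (vel_v U))\<^sup>2)"
      "(1 / k2) * (r2 * k2 * (norm (vel_\<psi> U))\<^sup>2) \<le> B * (r2 * k2 * (norm (vel_\<psi> U))\<^sup>2)"
      by (rule mult_right_mono[OF b(1)] mult_right_mono[OF b(2)] mult_right_mono[OF b(3)] mult_right_mono[OF b(4)],
          use r1 r2 k1 k2 in simp)+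
    then have "E U \<le> B * (norm (stressT U))\<^sup>2 + B * (norm (stressR U))\<^sup>2 + B * (r1 * k1 * (norm (vel_v U))\<^sup>2)
        + B * (r2 * k2 * (norm (vel_\<psi> U))\<^sup>2) + ((2 / k1) * (M * damp U) + (2 / k2) * (M * damp U))"
      unfolding E_def using 1 2 unfolding 3 by linarith
    also have "\<dots> = B * energy_density (\<lambda>x. 1) U + B' * damp U"
      unfolding one B'_def by (simp add: distrib_left distrib_right mult.assoc)
    finally show ?thesis .
  qed
  have "absorbable (\<lambda>U. (B / c) * (?n U + C * energy_density zeta U) + B' * damp U)"
    by (rule absorbable_add[OF absorbable_cmult[OF absorbable_add[OF n absorbable_cmult[OF strip q(5)]]] absorbable_cmult[OF absorbable_damp B(2)]])
       (use B q in simp)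
  then show ?thesis
  proof (rule absorbable_mono[OF _ contS_E])
    fix U assume U: "U \<in> DA"
    have "energy_density (\<lambda>x. 1) U \<le> (?n U + C * energy_density zeta U) / c"
      using bound[OF U] q(4) by (simp add: pos_le_divide_eq mult.commute)
    then have "B * energy_density (\<lambda>x. 1) U \<le> B * ((?n U + C * energy_density zeta U) / c)" using B by (intro mult_left_mono) auto
    then show "E U \<le> (B / c) * (?n U + C * energy_density zeta U) + B' * damp U" using EB[of U] by simp
  qed
qed

text \<open>For a difference quotient V of the orbit, the strain of V is nearly the strain rate of
  U, which the dissipation of U controls where m lives. The damping part is controlled by the
  dissipation of V, and E (V - A U) records the mismatch. Hence the weighted stress of the
  differentiated orbit is controlled without any bound on its second time derivative.\<close>

lemma quotient_bound:
  assumes B: "bl B" and m: "Linfty m" and D: "Linfty D" and C: "C \<ge> 0" and K: "K \<ge> 0"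
    and le: "\<And>x. -1 < x \<Longrightarrow> x < 1 \<Longrightarrow> (m x)\<^sup>2 \<le> C * D x"
    and f: "\<And>U. (norm (mult_l2 D (B (A U))))\<^sup>2 \<le> K * damp U"
    and d: "\<And>U. wsq D (B (A U)) \<le> damp U"
  shows "\<exists>L\<ge>0. \<forall>U\<in>DA. \<forall>V\<in>DA.
    (norm (mult_l2 m (k *\<^sub>R B V + mult_l2 D (B (A V)))))\<^sup>2 \<le> L * (damp V + damp U + E (V - A U))"
proof -
  interpret M: bounded_linear "mult_l2 m" by (rule bounded_linear_mult_l2[OF m])
  obtain M where M: "M \<ge> 0" "\<And>f. (norm (mult_l2 m f))\<^sup>2 \<le> M * (norm f)\<^sup>2" using bounded_mult_sq[OF m] by blast
  obtain N where N: "N \<ge> 0" "\<And>U. U \<in> H \<Longrightarrow> (norm (mult_l2 m (B U)))\<^sup>2 \<le> N * E U"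
    using bl_bound_sq[OF bl_mult[OF m B]] by blast
  define L where "L = 4 * k\<^sup>2 * N + 4 * k\<^sup>2 * C + 2 * M * K"
  have parts: "0 \<le> 4 * k\<^sup>2 * N" "0 \<le> 4 * k\<^sup>2 * C" "0 \<le> 2 * M * K" using N M C K by simp_all
  have "(norm (mult_l2 m (k *\<^sub>R B V + mult_l2 D (B (A V)))))\<^sup>2 \<le> L * (damp V + damp U + E (V - A U))"
    if U: "U \<in> DA" and V: "V \<in> DA" for U V
  proof -
    have VA: "V - A U \<in> H" by (rule subspace_diff[OF subspace_energy_space domD(7)[OF V] domD(8)[OF U]])
    have "mult_l2 m (B V) = mult_l2 m (B (A U)) + mult_l2 m (B (V - A U))"
      by (simp add: bl_diff_eq[OF B domD(7)[OF V] domD(8)[OF U]] M.diff)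
    then have "(norm (mult_l2 m (B V)))\<^sup>2 \<le> 2 * (norm (mult_l2 m (B (A U))))\<^sup>2 + 2 * (norm (mult_l2 m (B (V - A U))))\<^sup>2"
      by (simp add: norm_add_sq_le)
    also have "\<dots> \<le> 2 * (C * damp U) + 2 * (N * E (V - A U))"
      using N(2)[OF VA] order_trans[OF norm_mult_le[OF m D le] mult_left_mono[OF d C], of U] by linarith
    finally have 1: "(norm (mult_l2 m (B V)))\<^sup>2 \<le> 2 * (C * damp U) + 2 * (N * E (V - A U))" .
    have 2: "(norm (mult_l2 m (mult_l2 D (B (A V)))))\<^sup>2 \<le> M * (K * damp V)"
      by (rule order_trans[OF M(2) mult_left_mono[OF f M(1)]])
    have "(norm (mult_l2 m (k *\<^sub>R B V + mult_l2 D (B (A V)))))\<^sup>2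
        \<le> 2 * (norm (k *\<^sub>R mult_l2 m (B V)))\<^sup>2 + 2 * (norm (mult_l2 m (mult_l2 D (B (A V)))))\<^sup>2"
      unfolding M.add M.scaleR by (rule norm_add_sq_le)
    also have "\<dots> \<le> 2 * (k\<^sup>2 * (2 * (C * damp U) + 2 * (N * E (V - A U)))) + 2 * (M * (K * damp V))"
      using mult_left_mono[OF 1, of "k\<^sup>2"] 2 by (simp add: power_mult_distrib)
    also have "\<dots> = (4 * k\<^sup>2 * C) * damp U + (4 * k\<^sup>2 * N) * E (V - A U) + (2 * M * K) * damp V"
      by (simp add: algebra_simps)
    also have "\<dots> \<le> L * damp U + L * E (V - A U) + L * damp V"
      using parts by (intro add_mono mult_right_mono damp_nonneg E_nonneg) (auto simp: L_def)
    also have "\<dots> = L * (damp V + damp U + E (V - A U))" by (simp add: algebra_simps)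
    finally show ?thesis .
  qed
  moreover have "L \<ge> 0" using parts unfolding L_def by linarith
  ultimately show ?thesis by blast
qed

section \<open>Estimates on the strip\<close>

lemma absorbable_weighted_norm:
  assumes m: "Linfty m" and n: "Linfty n" and C: "C \<ge> 0" and F: "contS F"
    and le: "\<And>x. -1 < x \<Longrightarrow> x < 1 \<Longrightarrow> m x \<le> C * n x" and X: "absorbable (\<lambda>U. wsq n (F U))"
  shows "absorbable (\<lambda>U. wsq m (F U))"
proof (rule absorbable_mono[OF absorbable_cmult[OF X C]])
  show "contS (\<lambda>U. wsq m (F U))" by (intro contS_inner contS_mult m F)
  fix U
  show "wsq m (F U) \<le> C * wsq n (F U)"
    using inner_mult_mono[OF m Linfty_cmult[OF n] le, of "F U"] by (simp add: mult_l2_cmult n)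
qed

lemmas L_eta = Linfty_smooth[OF smooth_eta] and L_deta = Linfty_smooth[OF smooth_vder[OF smooth_eta]]
  and L_zeta = Linfty_smooth[OF smooth_zeta] and L_dzeta = Linfty_smooth[OF smooth_vder[OF smooth_zeta]]

lemma strip_bounds:
  assumes nn: "\<And>x. -1 < x \<Longrightarrow> x < 1 \<Longrightarrow> 0 \<le> D x" and c0: "c0 > 0" and Dc: "\<And>x. 1 / 8 \<le> x \<Longrightarrow> x \<le> 7 / 8 \<Longrightarrow> c0 \<le> D x"
  shows "\<exists>C\<ge>0. \<forall>x. -1 < x \<longrightarrow> x < 1 \<longrightarrow> (eta x)\<^sup>2 \<le> C * D x \<and> (vder eta x)\<^sup>2 \<le> C * D x"
proof -
  have ex: "\<exists>C\<ge>0. \<forall>x. -1 < x \<longrightarrow> x < 1 \<longrightarrow> (m x)\<^sup>2 \<le> C * D x"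
    if m: "continuous_on UNIV m" "\<And>x. x \<notin> {1 / 8<..<7 / 8} \<Longrightarrow> m x = 0" for m :: "real \<Rightarrow> real"
  proof (rule strip_bound[of m D c0])
    fix C assume "0 \<le> C" "\<And>x. -1 < x \<Longrightarrow> x < 1 \<Longrightarrow> (m x)\<^sup>2 \<le> C * D x"
    then show ?thesis by blast
  qed (use m nn c0 Dc in auto)
  obtain C where C: "C \<ge> 0" "\<forall>x. -1 < x \<longrightarrow> x < 1 \<longrightarrow> (eta x)\<^sup>2 \<le> C * D x"
    using ex[OF smooth_continuous[OF smooth_eta] eta_props(3)] by blast
  obtain B where B: "B \<ge> 0" "\<forall>x. -1 < x \<longrightarrow> x < 1 \<longrightarrow> (vder eta x)\<^sup>2 \<le> B * D x"
    using ex[OF smooth_continuous[OF smooth_vder[OF smooth_eta]] eta_props(4)] by blast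
  show ?thesis
  proof (intro exI[of _ "C + B"] conjI allI impI)
    show "C + B \<ge> 0" using C B by simp
    fix x :: real assume x: "-1 < x" "x < 1"
    show "(eta x)\<^sup>2 \<le> (C + B) * D x" "(vder eta x)\<^sup>2 \<le> (C + B) * D x"
      using C(2)[rule_format, OF x] B(2)[rule_format, OF x]
        mult_nonneg_nonneg[OF C(1) nn[OF x]] mult_nonneg_nonneg[OF B(1) nn[OF x]]
      by (simp_all add: distrib_right)
  qed
qed

lemma zeta_le_eta_sq: "zeta x = (eta x)\<^sup>2" by (simp add: zeta_def power2_eq_square)

text \<open>Shear damping gives T, and equipartition gives v. The rotation is reached through \<psi>
  = shear rate - v', which requires the acceleration v_t on the strip. The bending strain then
  follows by equipartition, because \<psi> is the time derivative of \<phi>.\<close>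

lemma absorbable_strip_shear:
  assumes c0: "c0 > 0" and Dc: "\<And>x. 1 / 8 \<le> x \<Longrightarrow> x \<le> 7 / 8 \<Longrightarrow> c0 \<le> D1 x"
  shows "absorbable (energy_density zeta)"
proof -
  obtain C where C0: "C \<ge> 0" "\<forall>x. -1 < x \<longrightarrow> x < 1 \<longrightarrow> (eta x)\<^sup>2 \<le> C * D1 x \<and> (vder eta x)\<^sup>2 \<le> C * D1 x"
    using strip_bounds[of D1 c0] D1_nonneg c0 Dc by auto
  have C: "C \<ge> 0" "\<And>x. -1 < x \<Longrightarrow> x < 1 \<Longrightarrow> (eta x)\<^sup>2 \<le> C * D1 x"
    "\<And>x. -1 < x \<Longrightarrow> x < 1 \<Longrightarrow> (vder eta x)\<^sup>2 \<le> C * D1 x" using C0 by auto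
  obtain C' where C': "C' \<ge> 0" "\<And>x. -1 < x \<Longrightarrow> x < 1 \<Longrightarrow> (vder zeta x)\<^sup>2 \<le> C' * zeta x"
    using zeta_deriv_bound by blast
  obtain K where K: "K \<ge> 0" "\<And>U. (norm (mult_l2 D1 (shear (A U))))\<^sup>2 \<le> K * damp U"
    "\<And>U. (norm (mult_l2 D2 (bend (A U))))\<^sup>2 \<le> K * damp U" using damping_forces by blast
  have T: "absorbable (\<lambda>U. C * wsq D1 (stressT U))"
    by (rule absorbable_cmult[OF absorbable_stress_damped(1) C(1)])
  have v: "absorbable (\<lambda>U. wsq eta (vel_v U))"
    by (rule absorbable_velocity[OF smooth_eta T norm_mult_le[OF L_eta LD1 C(2)] norm_mult_le[OF L_deta LD1 C(3)]])
  have zv: "absorbable (\<lambda>U. wsq zeta (vel_v U))"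
    by (rule absorbable_weighted_norm[OF L_zeta L_eta zero_le_one contS_comp(3) _ v]) (simp add: zeta_props)
  have ey: "(norm (mult_l2 eta (shear (A U))))\<^sup>2 \<le> C * damp U" for U
    by (rule order_trans[OF norm_mult_le[OF L_eta LD1 C(2)] mult_left_mono[OF damping_shear_le C(1)]])
  have zeta2: "(norm (mult_l2 zeta f))\<^sup>2 \<le> 1 * wsq zeta f" for f
    by (rule norm_mult_le[OF L_zeta L_zeta]) (simp add: zeta_props)
  have dzeta2: "(norm (mult_l2 (vder zeta) f))\<^sup>2 \<le> C' * wsq zeta f" for f
    by (rule norm_mult_le[OF L_dzeta L_zeta C'(2)])
  \<comment> \<open>Formally, r1 <zeta v_t, v_t> = <T', zeta v_t> = -<T, (zeta v_t)'>. The time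
    derivative is moved from the right factor onto the stress by \<open>absorbable_shift\<close>,
    since (zeta v)' is bounded by energy and dissipation.\<close>
  have zv1: "absorbable (\<lambda>U. wsq zeta (vel_v (A U)))"
  proof -
    let ?m = "\<lambda>x. 2 * vder eta x"
    \<comment> \<open>This F satisfies eta F = (zeta v)'. One factor eta goes to the stress and one
      stays here, where it makes the shear rate controllable by \<open>damp\<close>.\<close>
    let ?F = "\<lambda>U. (mult_l2 ?m (vel_v U) - mult_l2 eta (vel_\<psi> U)) + mult_l2 eta (shear (A U))"
    let ?G = "\<lambda>U. mult_l2 eta (stressT U)"
    let ?X = "\<lambda>U. - r1 * wsq zeta (vel_v (A U))"
    have Lm: "Linfty ?m" by (rule Linfty_cmult[OF L_deta])
    have bF0: "bl (\<lambda>U. mult_l2 ?m (vel_v U) - mult_l2 eta (vel_\<psi> U))"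
      by (intro bl_diff bl_mult Lm L_eta bl_v bl_\<psi>)
    have bF: "bl1 ?F" by (rule bl1I[OF bF0 bl_mult[OF L_eta bl_shear]]) simp
    have "\<exists>L\<ge>0. \<forall>U\<in>DA. \<forall>V\<in>DA. (norm (?G V))\<^sup>2 \<le> L * (damp V + damp U + E (V - A U))"
      unfolding stressT_def by (rule quotient_bound[OF bl_shear L_eta LD1 C(1) K(1) C(2) K(2) damping_shear_le])
    then obtain L where L: "L \<ge> 0" "\<And>U V. U \<in> DA \<Longrightarrow> V \<in> DA \<Longrightarrow> (norm (?G V))\<^sup>2 \<le> L * (damp V + damp U + E (V - A U))"
      by blast
    obtain M where M: "M \<ge> 0" "\<And>U. U \<in> DA \<Longrightarrow> (norm (mult_l2 ?m (vel_v U) - mult_l2 eta (vel_\<psi> U)))\<^sup>2 \<le> M * E U"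
      using bl_E[OF bF0] by blast
    obtain P where P: "P \<ge> 0" "\<And>U. U \<in> H \<Longrightarrow> norm (mult_l2 zeta (vel_v U)) \<le> P * N U"
      using bl_bound[OF bl_mult[OF L_zeta bl_v]] by blast
    define Q where "Q = r1 * (1 / sqrt r1) * P"
    have Q: "Q \<ge> 0" using P r1 by (simp add: Q_def)
    have "absorbable (\<lambda>U. (- 1 / r1) * ?X U)"
    proof (rule absorbable_shift[OF bF bl1_mult[OF L_eta bl1_T], where K = "L + 2 * M + 2 * C + Q"])
      show "contS ?X" by (intro contS_cmult contS_inner contS_mult L_zeta contS_comp)
      show "0 \<le> L + 2 * M + 2 * C + Q" using L M C Q by simp
      fix U assume U: "U \<in> DA"
      note d = domD[OF U]
      have "(norm (?F U))\<^sup>2 \<le> 2 * (M * E U) + 2 * (C * damp U)"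
        using norm_add_sq_le[of "mult_l2 ?m (vel_v U) - mult_l2 eta (vel_\<psi> U)" "mult_l2 eta (shear (A U))"] M(2)[OF U] ey[of U]
        by linarith
      also have "\<dots> \<le> (2 * M) * (E U + damp U) + (2 * C) * (E U + damp U)"
        using mult_nonneg_nonneg[OF M(1) damp_nonneg[of U]] mult_nonneg_nonneg[OF C(1) E_nonneg[of U]] by (simp add: algebra_simps)
      also have "\<dots> \<le> (L + 2 * M + 2 * C + Q) * (E U + damp U)"
        using L(1) Q E_nonneg[of U] damp_nonneg[of U] by (simp add: distrib_right)
      finally show "(norm (?F U))\<^sup>2 \<le> (L + 2 * M + 2 * C + Q) * (E U + damp U)" .
      fix V assume V: "V \<in> DA"
      note dV = domD[OF V]
      have "(norm (?G V))\<^sup>2 \<le> L * (damp V + damp U + E (V - A U))" by (rule L(2)[OF U V])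
      also have "\<dots> \<le> (L + 2 * M + 2 * C + Q) * (damp V + damp U + E (V - A U))"
        using M C Q by (intro mult_right_mono add_nonneg_nonneg damp_nonneg E_nonneg) auto
      finally show "(norm (?G V))\<^sup>2 \<le> (L + 2 * M + 2 * C + Q) * (damp V + damp U + E (V - A U))" .
      interpret Me: bounded_linear "mult_l2 eta" by (rule bounded_linear_mult_l2[OF L_eta])
      interpret Mz: bounded_linear "mult_l2 zeta" by (rule bounded_linear_mult_l2[OF L_zeta])
      have eF: "mult_l2 eta (?F V) = wderiv (mult_l2 zeta (vel_v V))"
      proof -
        have "mult_l2 eta (mult_l2 ?m f) = mult_l2 (vder zeta) f" for f
          unfolding mult_l2_mult[OF L_eta Lm]
          by (rule mult_l2_cong[OF Linfty_mult[OF L_eta Lm] L_dzeta]) (simp add: eta_props)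
        moreover have "mult_l2 eta (mult_l2 eta f) = mult_l2 zeta f" for f
          unfolding mult_l2_mult[OF L_eta L_eta] by (simp add: zeta_def[abs_def])
        ultimately show ?thesis
          by (simp add: H1_mult(2)[OF smooth_zeta H10_H1[OF dV(3)]] wderiv_w Me.add Me.diff Mz.diff)
      qed
      have "inner (?G U) (?F V) = inner (stressT U) (wderiv (mult_l2 zeta (vel_v V)))"
        unfolding inner_mult_commute[OF L_eta] eF ..
      also have "\<dots> = - r1 * inner (vel_v (A U)) (mult_l2 zeta (vel_v V))"
        using inner_wderiv[OF d(5) H10_mult[OF smooth_zeta dV(3)]] by (simp add: wderiv_stress)
      \<comment> \<open>Replacing the velocity of V by the acceleration of U leaves an error linear
        in V - A U, as the shift lemma demands.\<close>
      finally have "inner (?G U) (?F V) - ?X U = - r1 * inner (vel_v (A U)) (mult_l2 zeta (vel_v (V - A U)))"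
        by (simp add: inner_mult_commute[OF L_zeta] Mz.diff inner_diff_right algebra_simps)
      then have "\<bar>inner (?G U) (?F V) - ?X U\<bar> = r1 * \<bar>inner (vel_v (A U)) (mult_l2 zeta (vel_v (V - A U)))\<bar>"
        using r1 by (simp add: abs_mult)
      also have "\<dots> \<le> r1 * (norm (vel_v (A U)) * norm (mult_l2 zeta (vel_v (V - A U))))"
        using r1 by (intro mult_left_mono Cauchy_Schwarz_ineq2) auto
      also have "\<dots> \<le> r1 * (((1 / sqrt r1) * sqrt (data U)) * (P * N (V - A U)))"
      proof (intro mult_left_mono mult_mono)
        show "norm (vel_v (A U)) \<le> (1 / sqrt r1) * sqrt (data U)"
          using component_bounds(3)[of "A U"] E_le_data(2)[of U] r1
          by (elim order_trans) (auto simp: N_E intro!: mult_left_mono divide_right_mono)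
        show "norm (mult_l2 zeta (vel_v (V - A U))) \<le> P * N (V - A U)"
          by (rule P(2)[OF subspace_diff[OF subspace_energy_space dV(7) d(8)]])
      qed (use r1 data_nonneg in auto)
      also have "\<dots> = Q * (sqrt (data U) * N (V - A U))" by (simp add: Q_def)
      also have "\<dots> \<le> (L + 2 * M + 2 * C + Q) * (sqrt (data U) * N (V - A U))"
        using L M C data_nonneg N_nonneg by (intro mult_right_mono mult_nonneg_nonneg) auto
      finally show "\<bar>inner (?G U) (?F V) - ?X U\<bar> \<le> (L + 2 * M + 2 * C + Q) * sqrt (data U) * N (V - A U)" by simp
    qed
    then show ?thesis using r1 by simp
  qed
  \<comment> \<open>Substituting \<psi> = shear rate - v' in one factor and integrating by parts
    leaves <v, zeta bend rate>. This is a total derivative minus <v_t, zeta bend>, where the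
    acceleration estimate enters.\<close>
  have z\<psi>: "absorbable (\<lambda>U. wsq zeta (vel_\<psi> U))"
  proof -
    interpret Mz: bounded_linear "mult_l2 zeta" by (rule bounded_linear_mult_l2[OF L_zeta])
    have z1: "(norm (mult_l2 zeta (shear (A U))))\<^sup>2 \<le> C * damp U" for U
    proof -
      have "(norm (mult_l2 zeta (shear (A U))))\<^sup>2 \<le> C * wsq D1 (shear (A U))"
      proof (rule norm_mult_le[OF L_zeta LD1])
        fix x :: real assume x: "-1 < x" "x < 1"
        show "(zeta x)\<^sup>2 \<le> C * D1 x" using zeta_props(4)[of x] C(2)[OF x] by (simp add: zeta_le_eta_sq)
      qed
      then show ?thesis by (rule order_trans[OF _ mult_left_mono[OF damping_shear_le C(1)]])
    qed
    have n1: "absorbable (\<lambda>U. 1 * inner (mult_l2 zeta (shear (A U))) (vel_\<psi> U))"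
      by (rule absorbable_inner_bl[OF absorbable_cmult[OF absorbable_damp C(1)] contS_mult[OF L_zeta contS_comp(7)] z1 bl_\<psi>])
    have n2: "absorbable (\<lambda>U. 1 * inner (mult_l2 (vder zeta) (vel_v U)) (vel_\<psi> U))"
      by (rule absorbable_inner_bl[OF absorbable_cmult[OF zv C'(1)] contS_mult[OF L_dzeta contS_comp(3)] dzeta2 bl_\<psi>])
    have n3: "absorbable (\<lambda>U. (-1) * inner (mult_l2 zeta (vel_v (A U))) (bend U))"
      by (rule absorbable_inner_bl[OF absorbable_cmult[OF zv1 zero_le_one] contS_mult[OF L_zeta contS_comp(9)] zeta2 bl_bend])
    have n4: "absorbable (\<lambda>U. 1 * (inner (vel_v (A U)) (mult_l2 zeta (bend U)) + inner (vel_v U) (mult_l2 zeta (bend (A U)))))"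
      by (rule absorbable_total_derivative[OF bl_v bl_mult[OF L_zeta bl_bend]])
    show ?thesis
    proof (rule absorbable_cong[OF absorbable_add[OF absorbable_add[OF n1 n2] absorbable_add[OF n3 n4]]])
      show "contS (\<lambda>U. wsq zeta (vel_\<psi> U))"
        by (intro contS_inner contS_mult L_zeta contS_comp)
      fix U assume U: "U \<in> DA"
      note d = domD[OF U]
      have "inner (wderiv (vel_v U)) (mult_l2 zeta (vel_\<psi> U)) = - inner (vel_v U) (mult_l2 (vder zeta) (vel_\<psi> U) + mult_l2 zeta (bend (A U)))"
        using inner_wderiv[OF H10_H1[OF d(3)] H10_mult[OF smooth_zeta d(4)]]
        by (simp add: H1_mult(2)[OF smooth_zeta H10_H1[OF d(4)]] wderiv_w)
      then show "wsq zeta (vel_\<psi> U) =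
        (1 * inner (mult_l2 zeta (shear (A U))) (vel_\<psi> U) + 1 * inner (mult_l2 (vder zeta) (vel_v U)) (vel_\<psi> U)) +
        ((-1) * inner (mult_l2 zeta (vel_v (A U))) (bend U) +
         1 * (inner (vel_v (A U)) (mult_l2 zeta (bend U)) + inner (vel_v U) (mult_l2 zeta (bend (A U)))))"
        unfolding inner_mult_commute[OF L_zeta] inner_mult_commute[OF L_dzeta]
        by (simp add: wderiv_w inner_diff_left inner_add_right algebra_simps)
    qed
  qed
  have zb: "absorbable (\<lambda>U. wsq zeta (bend U))"
  proof -
    obtain Zp Zr Wp Wr :: "l2 \<times> l2 \<Rightarrow> l2" where Z: "bounded_linear Zp" "bounded_linear Zr" "bounded_linear Wp" "bounded_linear Wr"
      "\<And>F. Zp F \<in> H10" "\<And>F. Zr F \<in> H10" "\<And>F. wderiv (Zp F) + Zr F = Wp F" "\<And>F. wderiv (Zr F) = Wr F"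
      "\<And>F1 F2 w \<phi>. w \<in> H10 \<Longrightarrow> \<phi> \<in> H10 \<Longrightarrow>
        k1 * inner (wderiv w + \<phi>) (Wp (F1, F2)) + k2 * inner (wderiv \<phi>) (Wr (F1, F2))
        = inner (wderiv w + \<phi>) F1 + inner (wderiv \<phi>) F2"
      by (rule static_problem[OF k1 k2]) blast
    \<comment> \<open>The multiplier (0, zeta \<phi>) yields zeta |bend|^2 together with lower-order
      terms in zeta \<phi> and zeta' \<phi>. A static solution with exactly these terms, negated, as
      right side is added to cancel them.\<close>
    let ?F = "\<lambda>U. ((- k1) *\<^sub>R mult_l2 zeta (pos_\<phi> U), (- k2) *\<^sub>R mult_l2 (vder zeta) (pos_\<phi> U))"
    have b: "bl (\<lambda>U. L (?F U))" if "bounded_linear L" for L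
      by (intro bl_pair[OF that] bl_scaleR bl_mult L_zeta L_dzeta bl_\<phi>)
    obtain L1 where L1: "L1 \<ge> 0" "\<And>f g. (norm (Zp (f, g)))\<^sup>2 \<le> L1 * ((norm f)\<^sup>2 + (norm g)\<^sup>2)"
      using bounded_linear_pair_sq[OF Z(1)] by blast
    obtain L2 where L2: "L2 \<ge> 0" "\<And>f g. (norm (Zr (f, g)))\<^sup>2 \<le> L2 * ((norm f)\<^sup>2 + (norm g)\<^sup>2)"
      using bounded_linear_pair_sq[OF Z(2)] by blast
    let ?I = "\<lambda>U. wsq zeta (vel_\<psi> U)"
    define G where "G = k1\<^sup>2 + k2\<^sup>2 * C'"
    have G: "G \<ge> 0" using C'(1) by (simp add: G_def)
    have I: "0 \<le> ?I U" for U by (rule inner_mult_nonneg[OF L_zeta]) (simp add: zeta_props)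
    \<comment> \<open>Differentiated in time, the right side contains \<psi> in place of \<phi>, so
      the corrected multiplier is controlled by the estimate for \<psi> on the strip.\<close>
    have Fle: "(norm ((- k1) *\<^sub>R mult_l2 zeta (vel_\<psi> U)))\<^sup>2 + (norm ((- k2) *\<^sub>R mult_l2 (vder zeta) (vel_\<psi> U)))\<^sup>2 \<le> G * ?I U" for U
    proof -
      have "k1\<^sup>2 * (norm (mult_l2 zeta (vel_\<psi> U)))\<^sup>2 + k2\<^sup>2 * (norm (mult_l2 (vder zeta) (vel_\<psi> U)))\<^sup>2
          \<le> k1\<^sup>2 * (1 * ?I U) + k2\<^sup>2 * (C' * ?I U)"
        by (intro add_mono mult_left_mono zeta2 dzeta2) auto
      then show ?thesis by (simp add: power_mult_distrib G_def algebra_simps)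
    qed
    let ?C = "2 + (2 * L1 + 2 * L2) * G"
    have X: "absorbable (\<lambda>U. ?C * ?I U)" by (rule absorbable_cmult[OF z\<psi>]) (use L1 L2 G in simp)
    let ?p = "\<lambda>U. Zp (?F U)" and ?r = "\<lambda>U. mult_l2 zeta (pos_\<phi> U) + Zr (?F U)"
    let ?P = "\<lambda>U. Wp (?F U) + mult_l2 zeta (pos_\<phi> U)"
    let ?R = "\<lambda>U. Wr (?F U) + (mult_l2 (vder zeta) (pos_\<phi> U) + mult_l2 zeta (bend U))"
    have "absorbable (\<lambda>U. k1 * inner (shear U) (?P U) + k2 * inner (bend U) (?R U))"
    proof (rule absorbable_multiplier[of ?p ?r ?P ?R, OF _ _ _ _ _ _ _ _ X])
      show "bl ?p" by (rule b[OF Z(1)])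
      show "bl ?r" by (intro bl_add b[OF Z(2)] bl_mult L_zeta bl_\<phi>)
      show "bl ?P" by (intro bl_add b[OF Z(3)] bl_mult L_zeta bl_\<phi>)
      show "bl ?R" by (intro bl_add b[OF Z(4)] bl_mult L_zeta L_dzeta bl_\<phi> bl_bend)
      fix U
      show "?p U \<in> H10" by (rule Z(5))
      have a1: "(norm (?p (A U)))\<^sup>2 \<le> L1 * (G * ?I U)"
        using order_trans[OF L1(2) mult_left_mono[OF Fle[of U] L1(1)]] by (simp add: A_simps)
      show "(norm (?p (A U)))\<^sup>2 \<le> ?C * ?I U"
      proof -
        have "0 \<le> 2 * ?I U" "0 \<le> L1 * (G * ?I U)" "0 \<le> L2 * (G * ?I U)" using I[of U] G L1(1) L2(1) by simp_all
        then show ?thesis using a1 by (simp add: algebra_simps)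
      qed
      have a2: "(norm (Zr (?F (A U))))\<^sup>2 \<le> L2 * (G * ?I U)"
        using order_trans[OF L2(2) mult_left_mono[OF Fle[of U] L2(1)]] by (simp add: A_simps)
      have "(norm (?r (A U)))\<^sup>2 \<le> 2 * (norm (mult_l2 zeta (vel_\<psi> U)))\<^sup>2 + 2 * (norm (Zr (?F (A U))))\<^sup>2"
        using norm_add_sq_le[of "mult_l2 zeta (pos_\<phi> (A U))" "Zr (?F (A U))"] by (simp add: A_simps)
      also have "\<dots> \<le> 2 * ?I U + 2 * (L2 * (G * ?I U))" using a2 zeta2[of "vel_\<psi> U"] by simp
      also have "\<dots> \<le> ?C * ?I U"
      proof -
        have "0 \<le> L1 * (G * ?I U)" using I[of U] G L1(1) by simp
        then show ?thesis by (simp add: algebra_simps)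
      qed
      finally show "(norm (?r (A U)))\<^sup>2 \<le> ?C * ?I U" .
    next
      fix U assume U: "U \<in> H"
      then show "?r U \<in> H10"
        by (intro subspace_add[OF subspace_H10] Z(6) H10_mult smooth_zeta) (simp add: energy_space_iff)
    next
      fix U assume U: "U \<in> DA"
      note d = domD[OF U]
      show "wderiv (?p U) + ?r U = ?P U" using Z(7)[of "?F U"] by (simp add: algebra_simps)
      show "wderiv (?r U) = ?R U"
        by (simp add: wderiv_add H10_H1 H10_mult[OF smooth_zeta d(2)] Z(6,8) H1_mult(2)[OF smooth_zeta H10_H1[OF d(2)]] wderiv_w)
    qed
    then have "absorbable (\<lambda>U. (1 / k2) * (k1 * inner (shear U) (?P U) + k2 * inner (bend U) (?R U)))"
      by (rule absorbable_cmult) (use k2 in simp)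
    then show ?thesis
    proof (rule absorbable_cong)
      show "contS (\<lambda>U. wsq zeta (bend U))" by (intro contS_inner contS_mult L_zeta contS_comp)
      fix U assume U: "U \<in> DA"
      have "k1 * inner (shear U) (Wp (?F U)) + k2 * inner (bend U) (Wr (?F U)) =
          - k1 * inner (shear U) (mult_l2 zeta (pos_\<phi> U)) - k2 * inner (bend U) (mult_l2 (vder zeta) (pos_\<phi> U))"
        using Z(9)[OF domD(1,2)[OF U], of "(- k1) *\<^sub>R mult_l2 zeta (pos_\<phi> U)" "(- k2) *\<^sub>R mult_l2 (vder zeta) (pos_\<phi> U)"]
        by (simp add: shear_def bend_def)
      then have "k1 * inner (shear U) (?P U) + k2 * inner (bend U) (?R U) = k2 * inner (bend U) (mult_l2 zeta (bend U))"
        by (simp add: inner_add_right distrib_left)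
      then show "wsq zeta (bend U) = (1 / k2) * (k1 * inner (shear U) (?P U) + k2 * inner (bend U) (?R U))"
        using k2 by (simp add: inner_commute)
    qed
  qed
  have zT: "absorbable (\<lambda>U. wsq zeta (stressT U))"
    by (rule absorbable_weighted_norm[OF L_zeta LD1 C(1) contS_T _ absorbable_stress_damped(1)]) (simp add: zeta_le_eta_sq C(2))
  have zR: "absorbable (\<lambda>U. wsq zeta (stressR U))"
  proof -
    have "absorbable (\<lambda>U. (2 * k2\<^sup>2) * wsq zeta (bend U) + (2 * K) * damp U)"
      by (intro absorbable_add absorbable_cmult zb absorbable_damp) (use K in auto)
    then show ?thesis
    proof (rule absorbable_mono)
      show "contS (\<lambda>U. wsq zeta (stressR U))" by (intro contS_inner contS_mult L_zeta contS_R)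
      fix U
      interpret Mz: bounded_linear "mult_l2 zeta" by (rule bounded_linear_mult_l2[OF L_zeta])
      have "wsq zeta (stressR U) \<le> 2 * wsq zeta (k2 *\<^sub>R bend U)
          + 2 * wsq zeta (mult_l2 D2 (bend (A U)))"
        unfolding stressR_def by (rule inner_mult_add_le[OF L_zeta]) (simp add: zeta_props)
      also have "wsq zeta (mult_l2 D2 (bend (A U))) \<le> wsq (\<lambda>x. 1) (mult_l2 D2 (bend (A U)))"
        by (rule inner_mult_mono[OF L_zeta]) (auto simp: zeta_props)
      also have "\<dots> \<le> K * damp U" using K(3)[of U] by (simp add: mult_l2_const power2_norm_eq_inner)
      finally show "wsq zeta (stressR U) \<le> (2 * k2\<^sup>2) * wsq zeta (bend U) + (2 * K) * damp U"
        by (simp add: Mz.scaleR power2_eq_square mult_ac)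
    qed
  qed
  show ?thesis
    unfolding energy_density_def[abs_def] using r1 r2 k1 k2 by (intro absorbable_add absorbable_cmult zT zR zv z\<psi>) auto
qed

text \<open>Here the dissipation controls \<psi>', and the boundary condition at 1 upgrades this to
  \<psi> itself. That is why the lower bound on the damping has to extend up to the endpoint. The
  moment equation T = R' - r2 \<psi>_t then gives the shear stress, and equipartition gives
  v.\<close>

lemma absorbable_strip_bend:
  assumes c0: "c0 > 0" and Dc: "\<And>x. 1 / 8 \<le> x \<Longrightarrow> x < 1 \<Longrightarrow> c0 \<le> D2 x"
    and D1: "\<And>x. -1 < x \<Longrightarrow> x < 1 \<Longrightarrow> D1 x = 0"
  shows "absorbable (energy_density zeta)"
proof -
  obtain C where C0: "C \<ge> 0" "\<forall>x. -1 < x \<longrightarrow> x < 1 \<longrightarrow> (eta x)\<^sup>2 \<le> C * D2 x \<and> (vder eta x)\<^sup>2 \<le> C * D2 x"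
    using strip_bounds[of D2 c0] D2_nonneg c0 Dc by auto
  have C: "C \<ge> 0" "\<And>x. -1 < x \<Longrightarrow> x < 1 \<Longrightarrow> (eta x)\<^sup>2 \<le> C * D2 x"
    "\<And>x. -1 < x \<Longrightarrow> x < 1 \<Longrightarrow> (vder eta x)\<^sup>2 \<le> C * D2 x" using C0 by auto
  obtain C' where C': "C' \<ge> 0" "\<And>x. -1 < x \<Longrightarrow> x < 1 \<Longrightarrow> (vder zeta x)\<^sup>2 \<le> C' * zeta x"
    using zeta_deriv_bound by blast
  obtain K where K: "K \<ge> 0" "\<And>U. (norm (mult_l2 D1 (shear (A U))))\<^sup>2 \<le> K * damp U"
    "\<And>U. (norm (mult_l2 D2 (bend (A U))))\<^sup>2 \<le> K * damp U" using damping_forces by blast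
  have T: "stressT U = k1 *\<^sub>R shear U" for U
    unfolding stressT_def using mult_l2_cong[OF LD1 Linfty_const D1, of "shear (A U)"] by (simp add: mult_l2_zero)
  \<comment> \<open>Without shear damping T is a multiple of the shear strain, hence bounded by the
    energy and admissible as the second factor in \<open>absorbable_inner_bl\<close>.\<close>
  have bT: "bl stressT" unfolding T[abs_def] by (intro bl_scaleR bl_shear)
  have R: "absorbable (\<lambda>U. C * wsq D2 (stressR U))"
    by (rule absorbable_cmult[OF absorbable_stress_damped(2) C(1)])
  have eta2: "(norm (mult_l2 eta f))\<^sup>2 \<le> 1 * wsq eta f" for f
    by (rule norm_mult_le[OF L_eta L_eta]) (use eta_props(1,2) in \<open>auto simp: power2_eq_square intro: mult_left_le\<close>)
  \<comment> \<open>One-sided Poincare inequality: the weight \<open>rampw\<close> vanishes to the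
    left and f vanishes at 1, so no boundary term arises.\<close>
  have hardy: "wsq eta f \<le> (6 / c0) * wsq D2 (wderiv f)" if f: "f \<in> H10" for f
  proof -
    note Lr = Linfty_smooth[OF smooth_rampw] Linfty_smooth[OF smooth_vder[OF smooth_rampw]]
    interpret Mr: bounded_linear "mult_l2 rampw" by (rule bounded_linear_mult_l2[OF Lr(1)])
    let ?a = "wsq (vder rampw) f" and ?b = "wsq rampw (wderiv f)"
    have abs: "(\<lambda>x. \<bar>rampw x\<bar>) = rampw" using rampw_props(1) by auto
    have "?a = - 2 * inner (mult_l2 rampw (wderiv f)) f" using inner_mult_wderiv_H10[OF smooth_rampw f] by simp
    \<comment> \<open>The factors -2 and 1/2 give a <= 4 b + a/4 after using \<open>rampw\<close> <=
      its derivative. Thus a <= (16/3) b, rounded up to 6 b.\<close>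
    also have "\<dots> = 2 * inner (mult_l2 rampw ((- 2) *\<^sub>R wderiv f)) ((1 / 2) *\<^sub>R f)" by (simp add: Mr.neg Mr.scaleR)
    also have "\<dots> \<le> wsq rampw ((- 2) *\<^sub>R wderiv f)
        + wsq rampw ((1 / 2) *\<^sub>R f)"
      using inner_mult_le_abs[OF Lr(1), of "(- 2) *\<^sub>R wderiv f" "(1 / 2) *\<^sub>R f"] unfolding abs .
    also have "\<dots> = 4 * ?b + (1 / 4) * wsq rampw f" unfolding Mr.scaleR by simp
    finally have "?a \<le> 4 * ?b + (1 / 4) * wsq rampw f" .
    moreover have "wsq rampw f \<le> ?a" by (rule inner_mult_mono[OF Lr rampw_props(5)])
    moreover have "0 \<le> ?b" by (rule inner_mult_nonneg[OF Lr(1) rampw_props(1)])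
    ultimately have ab: "?a \<le> 6 * ?b" by linarith
    have "wsq eta f \<le> ?a"
      by (rule inner_mult_mono[OF L_eta Lr(2)]) (use rampw_props(4,5) order_trans in blast)
    also note ab
    also have "6 * ?b \<le> 6 * wsq (\<lambda>x. (1 / c0) * D2 x) (wderiv f)"
    proof (intro mult_left_mono inner_mult_mono Lr(1) Linfty_cmult LD2)
      fix x :: real assume x: "-1 < x" "x < 1"
      show "rampw x \<le> (1 / c0) * D2 x"
      proof (cases "x \<le> 1 / 8")
        case True
        then show ?thesis using rampw_props(3) D2_nonneg[OF x] c0 by simp
      next
        case False
        then have "1 \<le> (1 / c0) * D2 x" using Dc[of x] x c0 by (simp add: field_simps)
        then show ?thesis using rampw_props(2)[of x] by linarith
      qed
    qed simp
    finally show ?thesis unfolding mult_l2_cmult[OF LD2] inner_scaleR_left by simp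
  qed
  have h: "wsq eta (vel_\<psi> U) \<le> (6 / c0) * damp U" if "U \<in> DA" for U
  proof -
    have "(6 / c0) * wsq D2 (bend (A U)) \<le> (6 / c0) * damp U"
      by (rule mult_left_mono[OF damping_bend_le]) (use c0 in simp)
    then show ?thesis using hardy[OF domD(4)[OF that]] unfolding wderiv_w by linarith
  qed
  have e\<psi>: "absorbable (\<lambda>U. wsq eta (vel_\<psi> U))"
    by (rule absorbable_mono[OF absorbable_cmult[OF absorbable_damp, of "6 / c0"] contS_inner[OF contS_mult[OF L_eta contS_comp(4)] contS_comp(4)] h])
       (use c0 in auto)
  \<comment> \<open>The bound for \<psi> is pointwise in time, so it applies to the difference
    quotient V in place of the orbit and controls \<psi>_t without any shift.\<close>
  have e\<psi>1: "absorbable (\<lambda>U. wsq eta (vel_\<psi> (A U)))"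
  proof -
    obtain M where M: "M \<ge> 0" "\<And>f. (norm (mult_l2 eta f))\<^sup>2 \<le> M * (norm f)\<^sup>2" using bounded_mult_sq[OF L_eta] by blast
    obtain P where P: "P \<ge> 0" "\<And>U. U \<in> H \<Longrightarrow> (norm (vel_\<psi> U))\<^sup>2 \<le> P * E U" using bl_bound_sq[OF bl_\<psi>] by blast
    have n: "0 \<le> wsq eta f" for f by (rule inner_mult_nonneg[OF L_eta]) (simp add: eta_props)
    have one: "wsq eta f \<le> (norm f)\<^sup>2" for f
      using inner_mult_mono[OF L_eta Linfty_const, of 1 f] by (simp add: eta_props mult_l2_const power2_norm_eq_inner)
    show ?thesis
    proof (rule absorbable_dq[where K = "12 / c0 + 2 * P"])
      show "contS (\<lambda>U. wsq eta (vel_\<psi> (A U)))"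
        by (intro contS_inner contS_mult L_eta contS_comp)
      show "0 \<le> 12 / c0 + 2 * P" using c0 P by simp
      fix U V assume U: "U \<in> DA" and V: "V \<in> DA"
      have VA: "V - A U \<in> H" by (rule subspace_diff[OF subspace_energy_space domD(7)[OF V] domD(8)[OF U]])
      interpret Me: bounded_linear "mult_l2 eta" by (rule bounded_linear_mult_l2[OF L_eta])
      have "vel_\<psi> (A U) = vel_\<psi> V + (- vel_\<psi> (V - A U))" by simp
      then have "wsq eta (vel_\<psi> (A U)) \<le> 2 * wsq eta (vel_\<psi> V)
          + 2 * wsq eta (- vel_\<psi> (V - A U))"
        using inner_mult_add_le[OF L_eta eta_props(1), of "vel_\<psi> V" "- vel_\<psi> (V - A U)"] by simp
      also have "\<dots> \<le> 2 * ((6 / c0) * damp V) + 2 * (P * E (V - A U))"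
        using h[OF V] one[of "- vel_\<psi> (V - A U)", unfolded norm_minus_cancel] P(2)[OF VA] by linarith
      also have "\<dots> \<le> (12 / c0 + 2 * P) * (damp V + damp U + E (V - A U))"
      proof -
        have "0 \<le> (12 / c0) * (damp U + E (V - A U))" "0 \<le> 2 * P * (damp V + damp U)"
          using c0 P damp_nonneg E_nonneg by (auto intro!: mult_nonneg_nonneg add_nonneg_nonneg)
        then show ?thesis by (simp add: algebra_simps)
      qed
      finally show "wsq eta (vel_\<psi> (A U)) \<le> (12 / c0 + 2 * P) * (damp V + damp U + E (V - A U))" .
    qed
  qed
  have eT: "absorbable (\<lambda>U. wsq eta (stressT U))"
  proof -
    have "\<exists>L\<ge>0. \<forall>U\<in>DA. \<forall>V\<in>DA. (norm (mult_l2 eta (stressR V)))\<^sup>2 \<le> L * (damp V + damp U + E (V - A U))"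
      unfolding stressR_def by (rule quotient_bound[OF bl_bend L_eta LD2 C(1) K(1) C(2) K(3) damping_bend_le])
    then obtain L where L: "L \<ge> 0" "\<And>U V. U \<in> DA \<Longrightarrow> V \<in> DA \<Longrightarrow> (norm (mult_l2 eta (stressR V)))\<^sup>2 \<le> L * (damp V + damp U + E (V - A U))"
      by blast
    \<comment> \<open>Testing R' with eta T produces T' = r1 v_t, an acceleration. Its time
      derivative is moved onto eta R, whose quotient is controlled on the strip.\<close>
    have n1: "absorbable (\<lambda>U. (- r1) * inner (mult_l2 eta (stressR U)) (vel_v (A U)))"
      by (rule absorbable_shift_bl[OF bl_v bl1_mult[OF L_eta bl1_R] L(2,1)])
    have n2: "absorbable (\<lambda>U. (-1) * inner (mult_l2 (vder eta) (stressR U)) (stressT U))"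
      by (rule absorbable_inner_bl[OF R contS_mult[OF L_deta contS_R] norm_mult_le[OF L_deta LD2 C(3)] bT])
    have n3: "absorbable (\<lambda>U. (- r2) * inner (mult_l2 eta (vel_\<psi> (A U))) (stressT U))"
      by (rule absorbable_inner_bl[OF absorbable_cmult[OF e\<psi>1 zero_le_one] contS_mult[OF L_eta contS_comp(10)] eta2 bT])
    show ?thesis
    proof (rule absorbable_cong[OF absorbable_add[OF n1 absorbable_add[OF n2 n3]]])
      show "contS (\<lambda>U. wsq eta (stressT U))" by (intro contS_inner contS_mult L_eta contS_T)
      fix U assume U: "U \<in> DA"
      note d = domD[OF U]
      interpret Me: bounded_linear "mult_l2 eta" by (rule bounded_linear_mult_l2[OF L_eta])
      have e1: "eta 1 = 0" "eta (-1) = 0" by (simp_all add: eta_props)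
      have w: "inner (r2 *\<^sub>R vel_\<psi> (A U) + stressT U) (mult_l2 eta (stressT U)) =
          - inner (stressR U) (mult_l2 (vder eta) (stressT U) + mult_l2 eta (r1 *\<^sub>R vel_v (A U)))"
        using inner_wderiv[OF d(6) H10_mult_boundary[OF smooth_eta e1 d(5)]]
        by (simp add: H1_mult(2)[OF smooth_eta d(5)] wderiv_stress)
      show "wsq eta (stressT U) = (- r1) * inner (mult_l2 eta (stressR U)) (vel_v (A U)) +
        ((-1) * inner (mult_l2 (vder eta) (stressR U)) (stressT U) + (- r2) * inner (mult_l2 eta (vel_\<psi> (A U))) (stressT U))"
        using w unfolding inner_mult_commute[OF L_eta] inner_mult_commute[OF L_deta]
        by (simp add: inner_add_left inner_add_right Me.scaleR algebra_simps)
    qed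
  qed
  have zT: "absorbable (\<lambda>U. wsq zeta (stressT U))"
    by (rule absorbable_weighted_norm[OF L_zeta L_eta zero_le_one contS_T _ eT]) (simp add: zeta_props)
  have z\<psi>: "absorbable (\<lambda>U. wsq zeta (vel_\<psi> U))"
    by (rule absorbable_weighted_norm[OF L_zeta L_eta zero_le_one contS_comp(4) _ e\<psi>]) (simp add: zeta_props)
  have zR: "absorbable (\<lambda>U. wsq zeta (stressR U))"
    by (rule absorbable_weighted_norm[OF L_zeta LD2 C(1) contS_R _ absorbable_stress_damped(2)]) (simp add: zeta_le_eta_sq C(2))
  have zv: "absorbable (\<lambda>U. wsq zeta (vel_v U))"
  proof (rule absorbable_velocity[OF smooth_zeta absorbable_cmult[OF zT, of "1 + C'"]])
    show "0 \<le> 1 + C'" using C' by simp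
    fix U
    have n: "0 \<le> wsq zeta (stressT U)" by (rule inner_mult_nonneg[OF L_zeta]) (simp add: zeta_props)
    have "(norm (mult_l2 zeta (stressT U)))\<^sup>2 \<le> 1 * wsq zeta (stressT U)"
      by (rule norm_mult_le[OF L_zeta L_zeta]) (simp add: zeta_props)
    then show "(norm (mult_l2 zeta (stressT U)))\<^sup>2 \<le> (1 + C') * wsq zeta (stressT U)"
      using mult_nonneg_nonneg[OF C'(1) n] by (simp add: distrib_right)
    show "(norm (mult_l2 (vder zeta) (stressT U)))\<^sup>2 \<le> (1 + C') * wsq zeta (stressT U)"
      using norm_mult_le[OF L_dzeta L_zeta C'(2), of "stressT U"] n by (simp add: distrib_right)
  qed
  show ?thesis
    unfolding energy_density_def[abs_def] using r1 r2 k1 k2 by (intro absorbable_add absorbable_cmult zT zR zv z\<psi>) auto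
qed

end

theorem theorem2p1:
  fixes \<rho>\<^sub>1 \<rho>\<^sub>2 \<kappa>\<^sub>1 \<kappa>\<^sub>2 :: real
    and D\<^sub>1 D\<^sub>2 D a a' :: "real \<Rightarrow> real"
    and S :: "real \<Rightarrow> state \<Rightarrow> state"
  assumes "\<rho>\<^sub>1 > 0" and "\<rho>\<^sub>2 > 0" and "\<kappa>\<^sub>1 > 0" and "\<kappa>\<^sub>2 > 0"
    and "Linfty D\<^sub>1" and "Linfty D\<^sub>2"
    and "(D = D\<^sub>1 \<and> (\<forall>x\<in>{-1<..<1}. D\<^sub>2 x = 0)) \<or> (D = D\<^sub>2 \<and> (\<forall>x\<in>{-1<..<1}. D\<^sub>1 x = 0))"
    and "\<forall>x\<in>{-1..0}. D x = 0" and "\<forall>x\<in>{0<..1}. D x = a x"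
    and "continuous_on {0..1} a"
    and "\<forall>x\<in>{0<..1}. (a has_real_derivative a' x) (at x within {0<..1})"
    and "continuous_on {0<..1} a'"
    and "a 0 = 0" and "\<forall>x\<in>{0<..1}. a x > 0"
    and "0 \<le> damping_index a a'" and "damping_index a a' < 1"
    and "timoshenko_semigroup \<rho>\<^sub>1 \<rho>\<^sub>2 \<kappa>\<^sub>1 \<kappa>\<^sub>2 D\<^sub>1 D\<^sub>2 S"
  shows "\<exists>C>0. \<forall>t>0. \<forall>U\<in>timoshenko_domain \<kappa>\<^sub>1 \<kappa>\<^sub>2 D\<^sub>1 D\<^sub>2.
    energy_norm \<rho>\<^sub>1 \<rho>\<^sub>2 \<kappa>\<^sub>1 \<kappa>\<^sub>2 (S t U) \<le> C / sqrt t * graph_norm \<rho>\<^sub>1 \<rho>\<^sub>2 \<kappa>\<^sub>1 \<kappa>\<^sub>2 D\<^sub>1 D\<^sub>2 U"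
proof -
  have D_nonneg: "0 \<le> D x" if "-1 < x" "x < 1" for x
    using assms(8,9,14) that by (cases "x \<le> 0") (auto intro: less_imp_le)
  have "continuous_on {1 / 8..1} a" by (rule continuous_on_subset[OF assms(10)]) auto
  \<comment> \<open>The minimum of a over the compact interval [1/8, 1], away from the degeneracy at
    0, is the positive lower bound used on the strip.\<close>
  then obtain y where y: "y \<in> {1 / 8..1}" "\<And>x. x \<in> {1 / 8..1} \<Longrightarrow> a y \<le> a x"
    using continuous_attains_inf[of "{1 / 8..1}" a] by auto
  have c0: "a y > 0" using assms(14) y(1) by auto
  have Dc: "a y \<le> D x" if "1 / 8 \<le> x" "x \<le> 1" for x
    using y(2)[of x] assms(9) that by auto
  have D12: "0 \<le> D\<^sub>1 x" "0 \<le> D\<^sub>2 x" if "-1 < x" "x < 1" for x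
    using assms(7) D_nonneg[OF that] that by auto
  interpret timoshenko \<rho>\<^sub>1 \<rho>\<^sub>2 \<kappa>\<^sub>1 \<kappa>\<^sub>2 D\<^sub>1 D\<^sub>2 S
    by unfold_locales (use assms(1-6,17) D12 in auto)
  have "absorbable (energy_density zeta)"
    using assms(7)
  proof
    assume "D = D\<^sub>1 \<and> (\<forall>x\<in>{-1<..<1}. D\<^sub>2 x = 0)"
    then show ?thesis by (intro absorbable_strip_shear[OF c0]) (use Dc in auto)
  next
    assume "D = D\<^sub>2 \<and> (\<forall>x\<in>{-1<..<1}. D\<^sub>1 x = 0)"
    then show ?thesis by (intro absorbable_strip_bend[OF c0]) (use Dc in auto)
  qed
  then show ?thesis by (rule absorbable_E_imp_decay[OF absorbable_E_from_strip])
qed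

end
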